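(* Let $H\le G$. (a) For $(L,\Psi)\in\mathcal{X}(H)$ one has $s_{(L,\Psi)}^H\circ \mathrm{res}^G_H = s_{(L,\Psi)}^G\colon B^A_{\mathbb{K}}(G)\to \mathbb{K}$. (b) For $(K,\Phi)\in\mathcal{X}(G)$ one has $$\mathrm{res}^G_H(e_{(K,\Phi)}^G) = \sum_{\substack{(L,\Psi)\in[H\backslash \mathcal{X}(H)] \\ (L,\Psi)=_G (K,\Phi)}} e_{(L,\Psi)}^H.$$ (c) For $\Phi\in \mathrm{Hom}(G^*,\mathbb{K}^\times)$ and $H<G$ one has $\mathrm{res}^G_H(e_{(G,\Phi)}^G)=0$.
   Context: $A$ is a multiplicatively written abelian group; for a finite group $H$, $H^*:=\mathrm{Hom}(H,A)$ with pointwise multiplication. $G$ is a finite group such that $S^*$ is finite for all subquotients $S$ of $G$, and $\mathbb{K}$ is a field of characteristic $0$ which is a splitting field of $S^*$ for all subquotients $S$ of $G$. For a finite group $S$, $[U,\phi]_S$ denotes the $S$-conjugacy class of a pair $(U,\phi)$ with $U\le S$, $\phi\in U^*$, where ${}^g(U,\phi)=({}^gU,{}^g\phi)$, ${}^gU=gUg^{-1}$, $({}^g\phi)(x)=\phi(g^{-1}xg)$. $B^A_{\mathbb{K}}(S)$ is the $\mathbb{K}$-vector space with basis these classes and multiplication $[U,\phi]_S\cdot[V,\psi]_S=\sum_{g\in[U\backslash S/V]}[U\cap{}^gV,\phi|_{U\cap{}^gV}\cdot({}^g\psi)|_{U\cap{}^gV}]_S$. $\mathcal{X}(S)$ is the set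 of pairs $(H,\Phi)$ with $H\le S$, $\Phi\in\mathrm{Hom}(H^*,\mathbb{K}^\times)$, with $S$-action ${}^g(H,\Phi)=({}^gH,{}^g\Phi)$, ${}^g\Phi(\phi)=\Phi({}^{g^{-1}}\phi)$. $s^S_{(H,\Phi)}:=s^H_\Phi\circ\pi_H\circ\mathrm{res}^S_H\colon B^A_{\mathbb{K}}(S)\to\mathbb{K}$, where $\mathrm{res}^S_H([U,\phi]_S)=\sum_{g\in[H\backslash S/U]}[H\cap{}^gU,({}^g\phi)|_{H\cap{}^gU}]_H$, $\pi_H([U,\phi]_H)=\phi\in\mathbb{K}H^*$ if $U=H$ and $0$ otherwise, $s^H_\Phi\colon\mathbb{K}H^*\to\mathbb{K}$ the linear extension of $\Phi$. $e^S_{(H,\Phi)}\in B^A_{\mathbb{K}}(S)$ is the unique (primitive) idempotent with $s^S_{(K,\Psi)}(e^S_{(H,\Phi)})=1$ if $(K,\Psi)$ is $S$-conjugate to $(H,\Phi)$ and $0$ otherwise. $[H\backslash X]$ denotes a set of representatives of the $H$-orbits of $X$; $x=_Gy$ means $x$ and $y$ lie in the same $G$-orbit. For $H\le G$, $\mathcal{X}(H)\subseteq\mathcal{X}(G)$. *)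

theory Defs
  imports "HOL-Algebra.Algebra" "HOL-Library.Poly_Mapping" "Jordan_Normal_Form.VS_Connect"
begin

text \<open>
  Subgroups \<open>H\<close> of \<open>S\<close>, regarded as groups, are written \<open>S\<lparr>carrier := H\<rparr>\<close>. Homomorphisms are made
  extensional (\<open>undefined\<close> outside the domain), so that equality of functions is equality of
  homomorphisms.
\<close>

definition hom_group :: "('g, 'm) monoid_scheme \<Rightarrow> ('a, 'n) monoid_scheme \<Rightarrow> ('g \<Rightarrow> 'a) monoid" where
  "hom_group S A = \<lparr>carrier = hom S A \<inter> extensional (carrier S),
                    monoid.mult = (\<lambda>f g. \<lambda>x\<in>carrier S. f x \<otimes>\<^bsub>A\<^esub> g x),
                    one = (\<lambda>x\<in>carrier S. \<one>\<^bsub>A\<^esub>)\<rparr>"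

abbreviation field_units :: "'k::field monoid" where
  "field_units \<equiv> units_of class_ring"

subsection \<open>Splitting fields\<close>

definition matrix_rep :: "('d, 'm) monoid_scheme \<Rightarrow> nat \<Rightarrow> ('d \<Rightarrow> 'k::field mat) \<Rightarrow> bool" where
  "matrix_rep D n \<rho> \<longleftrightarrow> \<rho> \<in> hom D (units_of (ring_mat TYPE('k) n ()))"

definition irreducible_rep :: "('d, 'm) monoid_scheme \<Rightarrow> nat \<Rightarrow> ('d \<Rightarrow> 'k::field mat) \<Rightarrow> bool" where
  "irreducible_rep D n \<rho> \<longleftrightarrow> matrix_rep D n \<rho> \<and> n > 0 \<and>
     (\<forall>W. VectorSpace.subspace class_ring W (module_vec TYPE('k) n) \<longrightarrow>
          (\<forall>x\<in>carrier D. \<forall>w\<in>W. \<rho> x *\<^sub>v w \<in> W) \<longrightarrow>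
          W = {0\<^sub>v n} \<or> W = carrier_vec n)"

text \<open>
  \<open>K\<close> is a splitting field of the finite group \<open>D\<close> if every simple \<open>KD\<close>-module has endomorphism ring
  \<open>K\<close>. Simple modules of a finite group are finite-dimensional, so it suffices to consider matrix
  representations.
\<close>

definition splitting_field :: "'k::field itself \<Rightarrow> ('d, 'm) monoid_scheme \<Rightarrow> bool" where
  "splitting_field (_ :: 'k itself) D \<longleftrightarrow>
     (\<forall>n (\<rho> :: 'd \<Rightarrow> 'k mat). irreducible_rep D n \<rho> \<longrightarrow>
        (\<forall>M\<in>carrier_mat n n. (\<forall>x\<in>carrier D. M * \<rho> x = \<rho> x * M) \<longrightarrow>
           (\<exists>c. M = c \<cdot>\<^sub>m 1\<^sub>m n)))"

subsection \<open>Vector spaces with a given basis\<close>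

text \<open>
  Elements of the \<open>K\<close>-vector space with basis \<open>\<B>\<close> are the finitely supported functions
  \<open>x :: 'b \<Rightarrow>\<^sub>0 'k\<close> with \<open>keys x \<subseteq> \<B>\<close>. The basis vector \<open>b\<close> is \<open>Poly_Mapping.single b 1\<close>.
\<close>

definition scale :: "'k::field \<Rightarrow> ('b \<Rightarrow>\<^sub>0 'k) \<Rightarrow> ('b \<Rightarrow>\<^sub>0 'k)" where
  "scale c x = Poly_Mapping.map ((*) c) x"

definition lin_ext :: "('b \<Rightarrow> ('c \<Rightarrow>\<^sub>0 'k)) \<Rightarrow> ('b \<Rightarrow>\<^sub>0 'k::field) \<Rightarrow> ('c \<Rightarrow>\<^sub>0 'k)" where
  "lin_ext f x = (\<Sum>b\<in>Poly_Mapping.keys x. scale (Poly_Mapping.lookup x b) (f b))"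

definition bilin_ext ::
  "('b \<Rightarrow> 'b \<Rightarrow> ('c \<Rightarrow>\<^sub>0 'k)) \<Rightarrow> ('b \<Rightarrow>\<^sub>0 'k::field) \<Rightarrow> ('b \<Rightarrow>\<^sub>0 'k) \<Rightarrow> ('c \<Rightarrow>\<^sub>0 'k)" where
  "bilin_ext f x y = (\<Sum>b\<in>Poly_Mapping.keys x. \<Sum>c\<in>Poly_Mapping.keys y.
     scale (Poly_Mapping.lookup x b * Poly_Mapping.lookup y c) (f b c))"

subsection \<open>Conjugation and orbits\<close>

definition conj_set :: "('g, 'm) monoid_scheme \<Rightarrow> 'g \<Rightarrow> 'g set \<Rightarrow> 'g set" where
  "conj_set S g U = (\<lambda>u. g \<otimes>\<^bsub>S\<^esub> u \<otimes>\<^bsub>S\<^esub> inv\<^bsub>S\<^esub> g) ` U"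

text \<open>\<open>conj_hom S g U \<phi>\<close> is the conjugate by \<open>g\<close> of the homomorphism \<open>\<phi>\<close> defined on \<open>U\<close>.\<close>

definition conj_hom :: "('g, 'm) monoid_scheme \<Rightarrow> 'g \<Rightarrow> 'g set \<Rightarrow> ('g \<Rightarrow> 'a) \<Rightarrow> ('g \<Rightarrow> 'a)" where
  "conj_hom S g U \<phi> = (\<lambda>x\<in>conj_set S g U. \<phi> (inv\<^bsub>S\<^esub> g \<otimes>\<^bsub>S\<^esub> x \<otimes>\<^bsub>S\<^esub> g))"

definition conj_pair ::
  "('g, 'm) monoid_scheme \<Rightarrow> 'g \<Rightarrow> 'g set \<times> ('g \<Rightarrow> 'a) \<Rightarrow> 'g set \<times> ('g \<Rightarrow> 'a)" where
  "conj_pair S g = (\<lambda>(U, \<phi>). (conj_set S g U, conj_hom S g U \<phi>))"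

definition transversal :: "('g, 'm) monoid_scheme \<Rightarrow> ('g \<Rightarrow> 'e \<Rightarrow> 'e) \<Rightarrow> 'e set \<Rightarrow> 'e set \<Rightarrow> bool" where
  "transversal S act E R \<longleftrightarrow> R \<subseteq> E \<and> (\<forall>p\<in>E. \<exists>!q. q \<in> R \<and> q \<in> orbit S act p)"

text \<open>A chosen set of representatives of the double cosets \<open>HgU\<close> in \<open>S\<close>.\<close>

definition double_coset_reps :: "('g, 'm) monoid_scheme \<Rightarrow> 'g set \<Rightarrow> 'g set \<Rightarrow> 'g set" where
  "double_coset_reps S H U =
     (\<lambda>D. SOME g. g \<in> D) ` {(H #>\<^bsub>S\<^esub> g) <#>\<^bsub>S\<^esub> U | g. g \<in> carrier S}"

subsection \<open>The fibered Burnside algebra\<close>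

type_synonym ('g, 'a) pair_class = "('g set \<times> ('g \<Rightarrow> 'a)) set"

definition char_pairs :: "('g, 'm) monoid_scheme \<Rightarrow> ('a, 'n) monoid_scheme \<Rightarrow> ('g set \<times> ('g \<Rightarrow> 'a)) set" where
  "char_pairs S A = {(U, \<phi>). subgroup U S \<and> \<phi> \<in> carrier (hom_group (S\<lparr>carrier := U\<rparr>) A)}"

abbreviation pair_class :: "('g, 'm) monoid_scheme \<Rightarrow> 'g set \<Rightarrow> ('g \<Rightarrow> 'a) \<Rightarrow> ('g, 'a) pair_class" where
  "pair_class S U \<phi> \<equiv> orbit S (conj_pair S) (U, \<phi>)"

definition burnside ::
  "('g, 'm) monoid_scheme \<Rightarrow> ('a, 'n) monoid_scheme \<Rightarrow> (('g, 'a) pair_class \<Rightarrow>\<^sub>0 'k::field) set" where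
  "burnside S A = {x. Poly_Mapping.keys x \<subseteq> orbits S (char_pairs S A) (conj_pair S)}"

text \<open>
  The values on basis elements below are computed from a chosen representative
  \<open>SOME p. p \<in> c\<close> of the class \<open>c\<close>; they do not depend on that choice.
\<close>

definition burnside_mult ::
  "('g, 'm) monoid_scheme \<Rightarrow> ('a, 'n) monoid_scheme \<Rightarrow>
   (('g, 'a) pair_class \<Rightarrow>\<^sub>0 'k::field) \<Rightarrow> (('g, 'a) pair_class \<Rightarrow>\<^sub>0 'k) \<Rightarrow> (('g, 'a) pair_class \<Rightarrow>\<^sub>0 'k)" where
  "burnside_mult S A = bilin_ext (\<lambda>c d.
     let (U, \<phi>) = (SOME p. p \<in> c); (V, \<psi>) = (SOME p. p \<in> d) in
     \<Sum>g\<in>double_coset_reps S U V.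
       let W = U \<inter> conj_set S g V in
       Poly_Mapping.single
         (pair_class S W
            (restrict \<phi> W \<otimes>\<^bsub>hom_group (S\<lparr>carrier := W\<rparr>) A\<^esub> restrict (conj_hom S g V \<psi>) W)) 1)"

definition res ::
  "('g, 'm) monoid_scheme \<Rightarrow> 'g set \<Rightarrow>
   (('g, 'a) pair_class \<Rightarrow>\<^sub>0 'k::field) \<Rightarrow> (('g, 'a) pair_class \<Rightarrow>\<^sub>0 'k)" where
  "res S H = lin_ext (\<lambda>c.
     let (U, \<phi>) = (SOME p. p \<in> c) in
     \<Sum>g\<in>double_coset_reps S H U.
       let W = H \<inter> conj_set S g U in
       Poly_Mapping.single (pair_class (S\<lparr>carrier := H\<rparr>) W (restrict (conj_hom S g U \<phi>) W)) 1)"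

text \<open>The projection \<open>\<pi>\<^sub>H\<close> to the group algebra of \<open>Hom(H, A)\<close>, for a group \<open>H\<close>.\<close>

definition proj :: "('g, 'm) monoid_scheme \<Rightarrow> (('g, 'a) pair_class \<Rightarrow>\<^sub>0 'k::field) \<Rightarrow> (('g \<Rightarrow> 'a) \<Rightarrow>\<^sub>0 'k)" where
  "proj H = lin_ext (\<lambda>c.
     let (U, \<phi>) = (SOME p. p \<in> c) in if U = carrier H then Poly_Mapping.single \<phi> 1 else 0)"

definition lin_char :: "(('g \<Rightarrow> 'a) \<Rightarrow> 'k::field) \<Rightarrow> (('g \<Rightarrow> 'a) \<Rightarrow>\<^sub>0 'k) \<Rightarrow> 'k" where
  "lin_char \<Phi> x = (\<Sum>\<phi>\<in>Poly_Mapping.keys x. Poly_Mapping.lookup x \<phi> * \<Phi> \<phi>)"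

subsection \<open>Species and primitive idempotents\<close>

definition species_pairs ::
  "('g, 'm) monoid_scheme \<Rightarrow> ('a, 'n) monoid_scheme \<Rightarrow> ('g set \<times> (('g \<Rightarrow> 'a) \<Rightarrow> 'k::field)) set" where
  "species_pairs S A = {(H, \<Phi>). subgroup H S \<and>
     \<Phi> \<in> carrier (hom_group (hom_group (S\<lparr>carrier := H\<rparr>) A) field_units)}"

definition conj_species ::
  "('g, 'm) monoid_scheme \<Rightarrow> ('a, 'n) monoid_scheme \<Rightarrow> 'g \<Rightarrow>
   'g set \<times> (('g \<Rightarrow> 'a) \<Rightarrow> 'k::field) \<Rightarrow> 'g set \<times> (('g \<Rightarrow> 'a) \<Rightarrow> 'k)" where
  "conj_species S A g = (\<lambda>(H, \<Phi>).
     let gH = conj_set S g H in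
     (gH, \<lambda>\<phi>\<in>carrier (hom_group (S\<lparr>carrier := gH\<rparr>) A). \<Phi> (conj_hom S (inv\<^bsub>S\<^esub> g) gH \<phi>)))"

definition species ::
  "('g, 'm) monoid_scheme \<Rightarrow> 'g set \<times> (('g \<Rightarrow> 'a) \<Rightarrow> 'k::field) \<Rightarrow> (('g, 'a) pair_class \<Rightarrow>\<^sub>0 'k) \<Rightarrow> 'k" where
  "species S = (\<lambda>(H, \<Phi>). lin_char \<Phi> \<circ> proj (S\<lparr>carrier := H\<rparr>) \<circ> res S H)"

definition idem ::
  "('g, 'm) monoid_scheme \<Rightarrow> ('a, 'n) monoid_scheme \<Rightarrow>
   'g set \<times> (('g \<Rightarrow> 'a) \<Rightarrow> 'k::field) \<Rightarrow> (('g, 'a) pair_class \<Rightarrow>\<^sub>0 'k)" where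
  "idem S A p = (THE e. e \<in> burnside S A \<and> burnside_mult S A e e = e \<and>
     (\<forall>q\<in>species_pairs S A.
        species S q e = (if q \<in> orbit S (conj_species S A) p then 1 else 0)))"

end

theory Submission
  imports Defs
begin

text \<open>
  The species have a closed formula in which double cosets no longer occur. For a class \<open>[U, \<phi>]\<close>,
  \<open>s (L, \<Psi>) [U, \<phi>]\<close> is the sum of \<open>\<Psi> (g\<phi> restricted to L)\<close> over all \<open>g \<in> S\<close> with \<open>L \<subseteq> gUg\<^sup>-\<^sup>1\<close>,
  divided by \<open>|U|\<close> (\<open>species_eq_mark\<close>); this value is called a mark below. It comes from the
  weighting formula \<open>sum_double_coset_reps\<close>, which turns a sum over representatives of the double cosets
  \<open>HgU\<close> into a sum over the whole group in which \<open>x\<close> has weight \<open>|H \<inter> xUx\<^sup>-\<^sup>1| / (|H||U|)\<close>.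
  In this form two facts reduce to interchanging two sums over groups and translating one of them:
  that restriction does not change marks (\<open>mark_res\<close>), which is part (a), and that marks are
  multiplicative (\<open>mark_burnside_mult\<close>).
  
  Parts (b) and (c) are then comparisons of species values. By (a), the species \<open>(L, \<Psi>)\<close> of \<open>H\<close> has on
  the restriction of the idempotent of \<open>p\<close> the value \<open>1\<close> if \<open>(L, \<Psi>)\<close> is \<open>G\<close>-conjugate to \<open>p\<close>, and
  \<open>0\<close> otherwise. The sum in (b) has the same values, since each \<open>H\<close>-orbit meets the transversal once. In
  (c) all values vanish, because no subgroup of a proper subgroup \<open>H\<close> is conjugate to \<open>G\<close>.
  
  This needs that the species separate the elements of the algebra (\<open>species_separate\<close>), and that the
  idempotents, which are given by a definite description, exist (\<open>idempotent_exists\<close>). Both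
  rest on the triangular shape of the marks: \<open>(L, \<Psi>)\<close> vanishes on \<open>[U, \<phi>]\<close> unless \<open>L\<close> is conjugate to a
  subgroup of \<open>U\<close>. On the diagonal, where \<open>L = U\<close>, they are Fourier inversion on the finite abelian group
  \<open>Hom(U, A)\<close>. Orthogonality of characters provides the
  idempotents, and the fact that the characters separate the group algebra provides uniqueness. The
  latter is where the splitting field enters: a nonzero element that all
  characters annihilate would generate a finite-dimensional representation, which contains a common
  eigenvector (\<open>common_eigenvector\<close>); this eigenvector is a multiple of the sum of \<open>\<chi>(x)\<^sup>-\<^sup>1 x\<close> for some
  character \<open>\<chi>\<close>, and \<open>\<chi>\<close> does not annihilate it.
\<close>
section \<open>Linear functionals on free vector spaces\<close>

text \<open>
  Elements of a free vector space are compared by applying these functionals, because linear and bilinear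
  extensions are easily evaluated under them.
\<close>
definition lin_eval :: "('b \<Rightarrow> 'k) \<Rightarrow> ('b \<Rightarrow>\<^sub>0 'k::field) \<Rightarrow> 'k" where
  "lin_eval f x = (\<Sum>b\<in>Poly_Mapping.keys x. Poly_Mapping.lookup x b * f b)"

lemma lookup_scale [simp]: "Poly_Mapping.lookup (scale c x) b = c * Poly_Mapping.lookup x b"
  unfolding scale_def by (simp add: Poly_Mapping.map.rep_eq when_def)

interpretation free_vs: vector_space "scale :: 'k::field \<Rightarrow> ('b \<Rightarrow>\<^sub>0 'k) \<Rightarrow> _"
  by (rule vector_space.intro; rule poly_mapping_eqI)
    (simp_all add: lookup_add distrib_left distrib_right)

lemma keys_scale: "Poly_Mapping.keys (scale c x) \<subseteq> Poly_Mapping.keys x"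
  by (auto simp: in_keys_iff)

lemma lin_eval_superset:
  assumes "finite B" "Poly_Mapping.keys x \<subseteq> B"
  shows "lin_eval f x = (\<Sum>b\<in>B. Poly_Mapping.lookup x b * f b)"
  unfolding lin_eval_def using assms by (intro sum.mono_neutral_left) (auto simp: in_keys_iff)

lemma lin_eval_cong:
  "(\<And>b. b \<in> Poly_Mapping.keys x \<Longrightarrow> f b = g b) \<Longrightarrow> lin_eval f x = lin_eval g x"
  unfolding lin_eval_def by (intro sum.cong) auto

lemma lin_eval_0 [simp]: "lin_eval f 0 = 0"
  unfolding lin_eval_def by simp

lemma lin_eval_add [simp]: "lin_eval f (x + y) = lin_eval f x + lin_eval f y"
proof -
  let ?B = "Poly_Mapping.keys x \<union> Poly_Mapping.keys y"
  have "Poly_Mapping.keys (x + y) \<subseteq> ?B"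
    by (rule Poly_Mapping.keys_add)
  then show ?thesis
    by (simp add: lin_eval_superset[of ?B] lookup_add algebra_simps sum.distrib)
qed

lemma lin_eval_diff [simp]: "lin_eval f (x - y) = lin_eval f x - lin_eval f y"
  using lin_eval_add[of f "x - y" y] by simp

lemma lin_eval_scale [simp]: "lin_eval f (scale c x) = c * lin_eval f x"
proof -
  have "lin_eval f (scale c x) = (\<Sum>b\<in>Poly_Mapping.keys x. (c * Poly_Mapping.lookup x b) * f b)"
    using lin_eval_superset[OF finite_keys keys_scale, of f c x] by simp
  then show ?thesis
    by (simp add: lin_eval_def sum_distrib_left mult.assoc)
qed

lemma lin_eval_sum [simp]: "lin_eval f (sum g I) = (\<Sum>i\<in>I. lin_eval f (g i))"
  by (induction I rule: infinite_finite_induct) auto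

lemma lin_eval_single [simp]: "lin_eval f (Poly_Mapping.single b c) = c * f b"
  unfolding lin_eval_def by (cases "c = 0") auto

lemma lin_eval_lin_ext: "lin_eval f (lin_ext g x) = lin_eval (\<lambda>b. lin_eval f (g b)) x"
  unfolding lin_ext_def by (simp add: lin_eval_def[of "\<lambda>b. lin_eval f (g b)"])

lemma lin_eval_bilin_ext:
  "lin_eval f (bilin_ext g x y) = lin_eval (\<lambda>b. lin_eval (\<lambda>c. lin_eval f (g b c)) y) x"
proof -
  have "lin_eval f (bilin_ext g x y) =
      (\<Sum>b\<in>Poly_Mapping.keys x. Poly_Mapping.lookup x b *
         (\<Sum>c\<in>Poly_Mapping.keys y. Poly_Mapping.lookup y c * lin_eval f (g b c)))"
    by (simp add: bilin_ext_def sum_distrib_left mult.assoc)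
  then show ?thesis
    by (simp only: lin_eval_def[of _ x] lin_eval_def[of _ y])
qed

lemma lookup_eq_lin_eval:
  "Poly_Mapping.lookup x c = lin_eval (\<lambda>b. if b = c then 1 else 0) x"
proof -
  have "lin_eval (\<lambda>b. if b = c then 1 else 0) x =
      (\<Sum>b\<in>Poly_Mapping.keys x. if b = c then Poly_Mapping.lookup x b else 0)"
    unfolding lin_eval_def by (intro sum.cong) auto
  then show ?thesis
    by (simp add: in_keys_iff)
qed

lemma poly_mapping_eq_lin_evalI: "(\<And>f. lin_eval f x = lin_eval f y) \<Longrightarrow> x = y"
  by (rule poly_mapping_eqI) (simp only: lookup_eq_lin_eval)

lemma keys_sum_subset:
  "(\<And>i. i \<in> I \<Longrightarrow> Poly_Mapping.keys (g i) \<subseteq> B) \<Longrightarrow> Poly_Mapping.keys (sum g I) \<subseteq> B"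
proof (induction I rule: infinite_finite_induct)
  case (insert i I)
  have "Poly_Mapping.keys (g i + sum g I) \<subseteq> Poly_Mapping.keys (g i) \<union> Poly_Mapping.keys (sum g I)"
    by (rule Poly_Mapping.keys_add)
  with insert show ?case by auto
qed auto

lemma keys_lin_ext_subset:
  assumes "\<And>b. b \<in> Poly_Mapping.keys x \<Longrightarrow> Poly_Mapping.keys (f b) \<subseteq> B"
  shows "Poly_Mapping.keys (lin_ext f x) \<subseteq> B"
  unfolding lin_ext_def
  by (rule keys_sum_subset, rule subset_trans[OF keys_scale]) (rule assms)

section \<open>Characters of finite abelian groups over a splitting field\<close>

text \<open>
  A representation of minimal dimension inside \<open>W\<close> is irreducible. The operators of an abelian group
  commute, so each of them is an endomorphism of this irreducible representation and hence a
  scalar. Since splitting fields are defined through matrix representations, the proof chooses a basis and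
  translates between coordinate vectors and elements of \<open>W\<close> by the map \<open>L\<close>.
\<close>
lemma (in vector_space) common_eigenvector:
  fixes D :: "('d, 'm) monoid_scheme" and T :: "'d \<Rightarrow> 'b \<Rightarrow> 'b"
  assumes D: "comm_group D" and split: "splitting_field TYPE('a) D"
    and W: "subspace W" "W \<subseteq> span F" "finite F" "w \<in> W" "w \<noteq> 0"
    and inv: "\<And>x v. x \<in> carrier D \<Longrightarrow> v \<in> W \<Longrightarrow> T x v \<in> W"
    and T_add: "\<And>x u v. T x (u + v) = T x u + T x v"
    and T_scale: "\<And>x c v. T x (scale c v) = scale c (T x v)"
    and T_one: "\<And>v. v \<in> W \<Longrightarrow> T \<one>\<^bsub>D\<^esub> v = v"
    and T_mult: "\<And>x y v. x \<in> carrier D \<Longrightarrow> y \<in> carrier D \<Longrightarrow> v \<in> W \<Longrightarrow>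
                   T (x \<otimes>\<^bsub>D\<^esub> y) v = T x (T y v)"
  obtains f c where "f \<in> W" "f \<noteq> 0" "\<And>x. x \<in> carrier D \<Longrightarrow> T x f = scale (c x) f"
proof -
  interpret D: comm_group D by fact
  \<comment> \<open>The bases of nonzero invariant subspaces of \<open>W\<close>; one of minimal size spans an irreducible one.\<close>
  define good where "good B \<longleftrightarrow> B \<subseteq> W \<and> B \<noteq> {} \<and> finite B \<and> independent B \<and>
      (\<forall>x\<in>carrier D. \<forall>v\<in>span B. T x v \<in> span B)" for B
  have basis: "\<exists>B. independent B \<and> finite B \<and> B \<noteq> {} \<and> span B = Y \<and> B \<subseteq> Y"
    if Y: "subspace Y" "Y \<subseteq> W" "Y \<noteq> {0}" for Y
  proof -
    obtain B where B: "B \<subseteq> Y" "independent B" "Y \<subseteq> span B"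
      using maximal_independent_subset by blast
    have "span B = Y"
      using span_minimal[OF B(1) Y(1)] B(3) by (rule subset_antisym)
    moreover have "finite B"
      using independent_span_bound[OF W(3) B(2)] B(1) Y(2) W(2) by blast
    moreover have "B \<noteq> {}"
      using Y(3) \<open>span B = Y\<close> by auto
    ultimately show ?thesis using B by blast
  qed
  have "\<exists>B. good B"
  proof -
    have "W \<noteq> {0}" using W(4,5) by blast
    then obtain B where "independent B" "finite B" "B \<noteq> {}" "span B = W" "B \<subseteq> W"
      using basis[OF W(1) order_refl] by blast
    then show ?thesis unfolding good_def using inv by blast
  qed
  then have "good (arg_min card good)" "\<And>B'. good B' \<Longrightarrow> card (arg_min card good) \<le> card B'"
    using arg_min_nat_le arg_min_natI by (metis, metis)
  then obtain B where good: "good B" and min: "\<And>B'. good B' \<Longrightarrow> card B \<le> card B'"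
    by blast
  have B: "B \<subseteq> W" "B \<noteq> {}" "finite B" "independent B"
    and Binv: "\<And>x v. x \<in> carrier D \<Longrightarrow> v \<in> span B \<Longrightarrow> T x v \<in> span B"
    using good unfolding good_def by auto
  have spanW: "span B \<subseteq> W" using B(1) W(1) by (rule span_minimal)
  define m where "m = card B"
  have m: "m > 0" using B by (simp add: m_def card_gt_0_iff)
  obtain b where b: "bij_betw b {..<m} B"
    using ex_bij_betw_nat_finite[OF B(3)] unfolding m_def lessThan_atLeast0 by blast
  have bB: "b i \<in> B" if "i < m" for i using b that by (auto simp: bij_betw_def)
  define L where "L v = (\<Sum>i<m. scale (v $ i) (b i))" for v :: "'a vec"
  have L_add: "L (u + v) = L u + L v" if "u \<in> carrier_vec m" "v \<in> carrier_vec m" for u v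
    using that by (simp add: L_def scale_left_distrib sum.distrib)
  have L_smult: "L (c \<cdot>\<^sub>v v) = scale c (L v)" if "v \<in> carrier_vec m" for c v
    using that by (simp add: L_def scale_sum_right)
  have L_zero: "L (0\<^sub>v m) = 0" by (simp add: L_def)
  have L_span: "L v \<in> span B" for v
    unfolding L_def by (intro span_sum span_scale span_base) (auto intro: bB)
  have L_B: "(\<Sum>u\<in>B. scale (c u) u) = L (Matrix.vec m (\<lambda>i. c (b i)))" for c
    unfolding L_def using sum.reindex_bij_betw[OF b, of "\<lambda>u. scale (c u) u"] by simp
  have L_surj: "\<exists>v. v \<in> carrier_vec m \<and> L v = u" if u: "u \<in> span B" for u
  proof -
    obtain c where "u = (\<Sum>v\<in>B. scale (c v) v)"
      using u unfolding span_finite[OF B(3)] by blast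
    then show ?thesis using L_B by (intro exI[of _ "Matrix.vec m (\<lambda>i. c (b i))"]) auto
  qed
  have L_eq0: "v = 0\<^sub>v m" if v: "v \<in> carrier_vec m" "L v = 0" for v
  proof -
    define c where "c u = v $ (the_inv_into {..<m} b u)" for u
    have c: "c (b i) = v $ i" if "i < m" for i
      using b that by (simp add: c_def bij_betw_def the_inv_into_f_f)
    have "Matrix.vec m (\<lambda>i. c (b i)) = v" using v(1) c by (intro eq_vecI) auto
    then have "(\<Sum>u\<in>B. scale (c u) u) = 0" using L_B[of c] v(2) by simp
    then have "c u = 0" if "u \<in> B" for u using independentD[OF B(4,3) order_refl] that by blast
    then have "v $ i = 0" if "i < m" for i using c[OF that] bB[OF that] by simp
    then show ?thesis using v(1) by (intro eq_vecI) auto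
  qed
  have L_inj: "u = v" if "u \<in> carrier_vec m" "v \<in> carrier_vec m" "L u = L v" for u v
  proof -
    have "L (u + (- 1) \<cdot>\<^sub>v v) = L u + scale (- 1) (L v)" using that L_add L_smult by simp
    then have *: "u + (- 1) \<cdot>\<^sub>v v = 0\<^sub>v m" using L_eq0[of "u + (- 1) \<cdot>\<^sub>v v"] that by simp
    have "u $ i = v $ i" if "i < m" for i
      using arg_cong[OF *, of "\<lambda>w. w $ i"] that \<open>u \<in> carrier_vec m\<close> \<open>v \<in> carrier_vec m\<close> by simp
    then show ?thesis using that by (intro eq_vecI) auto
  qed
  define co where "co u = (SOME v. v \<in> carrier_vec m \<and> L v = u)" for u
  have co: "L (co u) = u" if "u \<in> span B" for u
    using someI_ex[OF L_surj[OF that]] unfolding co_def by auto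
  \<comment> \<open>The matrix of \<open>T x\<close> in the basis \<open>b\<close>: its \<open>j\<close>-th column holds the coordinates of \<open>T x (b j)\<close>.\<close>
  define \<rho> where "\<rho> x = Matrix.mat m m (\<lambda>(i, j). co (T x (b j)) $ i)" for x
  have \<rho>_carrier [simp]: "\<rho> x \<in> carrier_mat m m" for x by (simp add: \<rho>_def)
  have \<rho>_vec [simp]: "\<rho> x *\<^sub>v v \<in> carrier_vec m" if "v \<in> carrier_vec m" for x v
    using mult_mat_vec_carrier[OF \<rho>_carrier that] .
  have T_sum: "T x (sum g I) = (\<Sum>i\<in>I. T x (g i))" for x g and I :: "nat set"
  proof -
    have "T x 0 = 0" using T_scale[of x 0 0] by simp
    then show ?thesis by (induction I rule: infinite_finite_induct) (auto simp: T_add)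
  qed
  have L_\<rho>: "L (\<rho> x *\<^sub>v v) = T x (L v)" if x: "x \<in> carrier D" and v: "v \<in> carrier_vec m" for x v
  proof -
    have ent: "(\<rho> x *\<^sub>v v) $ i = (\<Sum>j<m. v $ j * co (T x (b j)) $ i)" if "i < m" for i
      using that v by (simp add: \<rho>_def scalar_prod_def lessThan_atLeast0 mult.commute)
    have "L (\<rho> x *\<^sub>v v) = (\<Sum>i<m. \<Sum>j<m. scale (v $ j * co (T x (b j)) $ i) (b i))"
      unfolding L_def using ent by (simp add: scale_sum_left)
    also have "\<dots> = (\<Sum>j<m. \<Sum>i<m. scale (v $ j * co (T x (b j)) $ i) (b i))"
      by (rule sum.swap)
    also have "\<dots> = (\<Sum>j<m. scale (v $ j) (L (co (T x (b j)))))"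
      by (simp add: L_def scale_sum_right)
    also have "\<dots> = (\<Sum>j<m. scale (v $ j) (T x (b j)))"
      using x bB by (intro sum.cong refl) (simp add: co Binv span_base)
    also have "\<dots> = T x (L v)" by (simp add: L_def T_sum T_scale)
    finally show ?thesis .
  qed
  have eqmat: "M = N" if MN: "M \<in> carrier_mat m m" "N \<in> carrier_mat m m"
    and eq: "\<And>v. v \<in> carrier_vec m \<Longrightarrow> L (M *\<^sub>v v) = L (N *\<^sub>v v)" for M N :: "'a mat"
  proof (rule mat_col_eqI)
    fix j assume "j < dim_col N"
    then have j: "j < m" using MN by simp
    have col: "P *\<^sub>v unit_vec m j = col P j" if "P \<in> carrier_mat m m" for P :: "'a mat"
      using that j by (intro eq_vecI) (auto simp: scalar_prod_right_unit)
    have "M *\<^sub>v unit_vec m j = N *\<^sub>v unit_vec m j"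
      using MN by (intro L_inj eq) (auto intro: mult_mat_vec_carrier)
    then show "col M j = col N j"
      using MN by (simp add: col)
  qed (use MN in auto)
  have \<rho>_mult: "\<rho> (x \<otimes>\<^bsub>D\<^esub> y) = \<rho> x * \<rho> y" if xy: "x \<in> carrier D" "y \<in> carrier D" for x y
  proof (rule eqmat)
    fix v :: "'a vec" assume v: "v \<in> carrier_vec m"
    have "L (\<rho> (x \<otimes>\<^bsub>D\<^esub> y) *\<^sub>v v) = T x (T y (L v))"
      using L_\<rho>[OF D.m_closed[OF xy] v] T_mult[OF xy] L_span spanW by auto
    also have "\<dots> = L (\<rho> x *\<^sub>v (\<rho> y *\<^sub>v v))"
      using xy v by (simp add: L_\<rho>)
    finally show "L (\<rho> (x \<otimes>\<^bsub>D\<^esub> y) *\<^sub>v v) = L (\<rho> x * \<rho> y *\<^sub>v v)"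
      using v by (simp add: assoc_mult_mat_vec[OF \<rho>_carrier \<rho>_carrier v])
  qed (rule \<rho>_carrier mult_carrier_mat[OF \<rho>_carrier \<rho>_carrier])+
  have \<rho>_one: "\<rho> \<one>\<^bsub>D\<^esub> = 1\<^sub>m m"
  proof (rule eqmat)
    fix v :: "'a vec" assume v: "v \<in> carrier_vec m"
    have "L v \<in> W" using L_span spanW by blast
    then show "L (\<rho> \<one>\<^bsub>D\<^esub> *\<^sub>v v) = L (1\<^sub>m m *\<^sub>v v)" using v by (simp add: L_\<rho> T_one)
  qed auto
  have rep: "matrix_rep D m \<rho>"
    unfolding matrix_rep_def hom_def
  proof (intro CollectI conjI ballI Pi_I)
    fix x assume x: "x \<in> carrier D"
    have "\<rho> x * \<rho> (inv\<^bsub>D\<^esub> x) = 1\<^sub>m m" "\<rho> (inv\<^bsub>D\<^esub> x) * \<rho> x = 1\<^sub>m m"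
      using x by (simp_all add: \<rho>_mult[symmetric] \<rho>_one)
    then show "\<rho> x \<in> carrier (units_of (ring_mat TYPE('a) m ()))"
      unfolding units_of_carrier Units_def by (auto simp: ring_mat_def intro!: bexI[of _ "\<rho> (inv\<^bsub>D\<^esub> x)"])
  qed (simp add: \<rho>_mult units_of_mult ring_mat_def)
  have irr: "irreducible_rep D m \<rho>"
    unfolding irreducible_rep_def
  proof (intro conjI rep m allI impI)
    fix W0 :: "'a vec set"
    assume "VectorSpace.subspace class_ring W0 (module_vec TYPE('a) m)"
      and W0_inv: "\<forall>x\<in>carrier D. \<forall>w\<in>W0. \<rho> x *\<^sub>v w \<in> W0"
    then have sub: "submodule class_ring W0 (module_vec TYPE('a) m)"
      by (simp add: VectorSpace.subspace_def)
    have W0_carrier: "W0 \<subseteq> carrier_vec m"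
      using submodule.subset[OF sub] by (simp add: module_vec_def)
    have W0_add: "u + v \<in> W0" if "u \<in> W0" "v \<in> W0" for u v
      using submodule.m_closed[OF sub that] by (simp add: module_vec_def)
    have W0_zero: "0\<^sub>v m \<in> W0"
      using submodule.zero_closed[OF sub] by (simp add: module_vec_def)
    have W0_smult: "c \<cdot>\<^sub>v v \<in> W0" if "v \<in> W0" for c v
      using submodule.smult_closed[OF sub _ that, of c] by (simp add: module_vec_def)
    show "W0 = {0\<^sub>v m} \<or> W0 = carrier_vec m"
    proof (rule disjCI, rule ccontr)
      assume ne: "W0 \<noteq> carrier_vec m" "W0 \<noteq> {0\<^sub>v m}"
      let ?X = "L ` W0"
      have "subspace ?X"
      proof (rule subspaceI)
        show "0 \<in> ?X" using W0_zero L_zero by force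
        show "u + v \<in> ?X" if uv: "u \<in> ?X" "v \<in> ?X" for u v
        proof -
          obtain u' v' where "u' \<in> W0" "v' \<in> W0" "u = L u'" "v = L v'" using uv by blast
          then show ?thesis
            using W0_carrier by (intro image_eqI[of _ _ "u' + v'"]) (auto simp: W0_add L_add subsetD)
        qed
        show "scale c v \<in> ?X" if v: "v \<in> ?X" for c v
        proof -
          obtain v' where "v' \<in> W0" "v = L v'" using v by blast
          then show ?thesis
            using W0_carrier by (intro image_eqI[of _ _ "c \<cdot>\<^sub>v v'"]) (auto simp: W0_smult L_smult subsetD)
        qed
      qed
      moreover have XB: "?X \<subseteq> span B" using L_span by blast
      moreover have "?X \<noteq> {0}"
      proof
        assume "?X = {0}"
        then have "W0 \<subseteq> {0\<^sub>v m}" using L_eq0 W0_carrier by blast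
        then show False using W0_zero ne(2) by blast
      qed
      ultimately obtain B' where B': "independent B'" "finite B'" "B' \<noteq> {}" "span B' = ?X" "B' \<subseteq> ?X"
        using basis[of ?X] spanW by (meson subset_trans)
      have "good B'"
        unfolding good_def
      proof (intro conjI ballI B')
        show "B' \<subseteq> W" using B'(5) XB spanW by (meson subset_trans)
        fix x v assume x: "x \<in> carrier D" and "v \<in> span B'"
        then obtain u where u: "u \<in> W0" "v = L u" using B'(4) by auto
        then have "T x v = L (\<rho> x *\<^sub>v u)" using L_\<rho>[OF x] W0_carrier by auto
        then show "T x v \<in> span B'"
          using W0_inv x u(1) unfolding B'(4) by auto
      qed
      \<comment> \<open>By minimality \<open>B'\<close> has at least \<open>m\<close> elements, so a vector outside \<open>W0\<close> would give more than \<open>m\<close>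
          independent vectors in a space of dimension \<open>m\<close>.\<close>
      then have le: "m \<le> card B'" using min m_def by simp
      obtain v where v: "v \<in> carrier_vec m" "v \<notin> W0" using ne(1) W0_carrier by blast
      then have "L v \<notin> span B'" using B'(4) L_inj W0_carrier by blast
      then have "independent (insert (L v) B')" "L v \<notin> B'"
        using independent_insertI[OF _ B'(1)] span_base by blast+
      moreover have "insert (L v) B' \<subseteq> span B" using L_span B'(5) XB by blast
      ultimately have "card (insert (L v) B') \<le> m"
        using independent_span_bound[OF B(3)] m_def by blast
      then show False using le \<open>L v \<notin> B'\<close> B'(2) by simp
    qed
  qed
  have "\<exists>c. \<rho> x = c \<cdot>\<^sub>m 1\<^sub>m m" if x: "x \<in> carrier D" for x
  proof -
    have "\<forall>y\<in>carrier D. \<rho> x * \<rho> y = \<rho> y * \<rho> x"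
      using x by (simp add: \<rho>_mult[symmetric] D.m_comm)
    then show ?thesis
      using split irr \<rho>_carrier[of x] unfolding splitting_field_def by blast
  qed
  then obtain c where c: "\<And>x. x \<in> carrier D \<Longrightarrow> \<rho> x = c x \<cdot>\<^sub>m 1\<^sub>m m" by metis
  have "T x (b 0) = scale (c x) (b 0)" if x: "x \<in> carrier D" for x
  proof -
    let ?e = "unit_vec m 0 :: 'a vec"
    have "L ?e = (\<Sum>i<m. if i = 0 then b 0 else 0)"
      unfolding L_def using m by (intro sum.cong) (auto simp: unit_vec_def)
    then have e: "L ?e = b 0" using m by (simp add: sum.delta)
    have "\<rho> x *\<^sub>v ?e = c x \<cdot>\<^sub>v ?e"
      unfolding c[OF x] using m by (intro eq_vecI) auto
    then show ?thesis using L_\<rho>[OF x, of ?e] L_smult[of ?e "c x"] e by simp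
  qed
  moreover have "b 0 \<in> B" using bB m by blast
  moreover have "b 0 \<noteq> 0" using \<open>b 0 \<in> B\<close> B(4) dependent_zero by metis
  ultimately show thesis using that B(1) by blast
qed

lemma carrier_hom_group: "f \<in> carrier (hom_group S A) \<longleftrightarrow> f \<in> hom S A \<and> f \<in> extensional (carrier S)"
  by (simp add: hom_group_def)

lemma hom_group_mult_apply: "x \<in> carrier S \<Longrightarrow> (f \<otimes>\<^bsub>hom_group S A\<^esub> g) x = f x \<otimes>\<^bsub>A\<^esub> g x"
  by (simp add: hom_group_def)

lemma hom_groupI:
  assumes "\<And>x. x \<in> carrier S \<Longrightarrow> f x \<in> carrier A"
    and "\<And>x y. x \<in> carrier S \<Longrightarrow> y \<in> carrier S \<Longrightarrow> f (x \<otimes>\<^bsub>S\<^esub> y) = f x \<otimes>\<^bsub>A\<^esub> f y"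
    and "f \<in> extensional (carrier S)"
  shows "f \<in> carrier (hom_group S A)"
  using assms by (auto simp: carrier_hom_group hom_def)

lemma hom_groupD:
  assumes "f \<in> carrier (hom_group S A)"
  shows "x \<in> carrier S \<Longrightarrow> f x \<in> carrier A"
    and "x \<in> carrier S \<Longrightarrow> y \<in> carrier S \<Longrightarrow> f (x \<otimes>\<^bsub>S\<^esub> y) = f x \<otimes>\<^bsub>A\<^esub> f y"
    and "f \<in> extensional (carrier S)"
  using assms by (auto simp: carrier_hom_group hom_def)

lemma hom_group_eqI:
  assumes "f \<in> carrier (hom_group S A)" "g \<in> carrier (hom_group S A)"
    and "\<And>x. x \<in> carrier S \<Longrightarrow> f x = g x"
  shows "f = g"
  using assms extensionalityI[OF hom_groupD(3) hom_groupD(3)] by blast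

lemma comm_group_hom_group:
  assumes "group S" "comm_group A"
  shows "comm_group (hom_group S A)"
proof -
  interpret S: group S by fact
  interpret A: comm_group A by fact
  have mult: "f \<otimes>\<^bsub>hom_group S A\<^esub> g \<in> carrier (hom_group S A)"
    if f: "f \<in> carrier (hom_group S A)" and g: "g \<in> carrier (hom_group S A)" for f g
  proof (rule hom_groupI)
    fix x y assume xy: "x \<in> carrier S" "y \<in> carrier S"
    show "(f \<otimes>\<^bsub>hom_group S A\<^esub> g) (x \<otimes>\<^bsub>S\<^esub> y) =
        (f \<otimes>\<^bsub>hom_group S A\<^esub> g) x \<otimes>\<^bsub>A\<^esub> (f \<otimes>\<^bsub>hom_group S A\<^esub> g) y"
      using xy by (simp add: hom_group_mult_apply hom_groupD[OF f] hom_groupD[OF g] A.m_ac)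
  qed (auto simp: hom_group_mult_apply hom_groupD[OF f] hom_groupD[OF g], simp add: hom_group_def)
  have one: "\<one>\<^bsub>hom_group S A\<^esub> \<in> carrier (hom_group S A)"
    by (rule hom_groupI) (auto simp: hom_group_def)
  have one_apply: "\<one>\<^bsub>hom_group S A\<^esub> x = \<one>\<^bsub>A\<^esub>" if "x \<in> carrier S" for x
    using that by (simp add: hom_group_def)
  show ?thesis
  proof (rule comm_groupI)
    fix f assume f: "f \<in> carrier (hom_group S A)"
    define g where "g = (\<lambda>x\<in>carrier S. inv\<^bsub>A\<^esub> f x)"
    have g: "g \<in> carrier (hom_group S A)"
      by (rule hom_groupI) (auto simp: g_def hom_groupD[OF f] A.inv_mult)
    have "g \<otimes>\<^bsub>hom_group S A\<^esub> f = \<one>\<^bsub>hom_group S A\<^esub>"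
      by (rule hom_group_eqI[OF mult[OF g f] one])
        (simp add: hom_group_mult_apply one_apply, simp add: g_def hom_groupD[OF f])
    then show "\<exists>g\<in>carrier (hom_group S A). g \<otimes>\<^bsub>hom_group S A\<^esub> f = \<one>\<^bsub>hom_group S A\<^esub>"
      using g by blast
  next
    fix f g assume f: "f \<in> carrier (hom_group S A)" and g: "g \<in> carrier (hom_group S A)"
    show "f \<otimes>\<^bsub>hom_group S A\<^esub> g = g \<otimes>\<^bsub>hom_group S A\<^esub> f"
      by (rule hom_group_eqI[OF mult[OF f g] mult[OF g f]])
        (simp add: hom_group_mult_apply hom_groupD[OF f] hom_groupD[OF g] A.m_comm)
  next
    fix f g h assume f: "f \<in> carrier (hom_group S A)" and g: "g \<in> carrier (hom_group S A)"
      and h: "h \<in> carrier (hom_group S A)"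
    show "f \<otimes>\<^bsub>hom_group S A\<^esub> g \<otimes>\<^bsub>hom_group S A\<^esub> h = f \<otimes>\<^bsub>hom_group S A\<^esub> (g \<otimes>\<^bsub>hom_group S A\<^esub> h)"
      by (rule hom_group_eqI[OF mult[OF mult[OF f g] h] mult[OF f mult[OF g h]]])
        (simp add: hom_group_mult_apply hom_groupD[OF f] hom_groupD[OF g] hom_groupD[OF h] A.m_assoc)
  next
    fix f assume f: "f \<in> carrier (hom_group S A)"
    show "\<one>\<^bsub>hom_group S A\<^esub> \<otimes>\<^bsub>hom_group S A\<^esub> f = f"
      by (rule hom_group_eqI[OF mult[OF one f] f])
        (simp add: hom_group_mult_apply one_apply hom_groupD[OF f])
  qed (use mult one in auto)
qed

lemma field_units_simps [simp]:
  "carrier (field_units :: 'k::field monoid) = - {0}"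
  "x \<otimes>\<^bsub>field_units\<^esub> y = x * y" "\<one>\<^bsub>field_units\<^esub> = 1"
proof -
  show "carrier (field_units :: 'k monoid) = - {0}"
  proof -
    have "\<exists>y. y * x = 1 \<and> x * y = 1" if "x \<noteq> 0" for x :: 'k
      using that by (intro exI[of _ "inverse x"]) simp
    then show ?thesis by (auto simp: units_of_carrier Units_def)
  qed
qed (simp_all add: units_of_mult units_of_one)

lemma characterI:
  assumes "\<And>x. x \<in> carrier D \<Longrightarrow> \<chi> x \<noteq> (0 :: 'k::field)"
    and "\<And>x y. x \<in> carrier D \<Longrightarrow> y \<in> carrier D \<Longrightarrow> \<chi> (x \<otimes>\<^bsub>D\<^esub> y) = \<chi> x * \<chi> y"
    and "\<chi> \<in> extensional (carrier D)"
  shows "\<chi> \<in> carrier (hom_group D field_units)"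
  using assms by (intro hom_groupI) auto

lemma characterD:
  assumes "\<chi> \<in> carrier (hom_group D (field_units :: 'k::field monoid))"
  shows "x \<in> carrier D \<Longrightarrow> \<chi> x \<noteq> 0"
    and "x \<in> carrier D \<Longrightarrow> y \<in> carrier D \<Longrightarrow> \<chi> (x \<otimes>\<^bsub>D\<^esub> y) = \<chi> x * \<chi> y"
  using hom_groupD[OF assms] by auto

lemma character_one:
  assumes "group D" "\<chi> \<in> carrier (hom_group D (field_units :: 'k::field monoid))"
  shows "\<chi> \<one>\<^bsub>D\<^esub> = 1"
proof -
  interpret group D by fact
  have "\<chi> \<one>\<^bsub>D\<^esub> * \<chi> \<one>\<^bsub>D\<^esub> = \<chi> \<one>\<^bsub>D\<^esub>" using characterD(2)[OF assms(2), of "\<one>\<^bsub>D\<^esub>" "\<one>\<^bsub>D\<^esub>"] by simp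
  then show ?thesis using characterD(1)[OF assms(2)] by simp
qed

lemma (in group) sum_translate:
  assumes "a \<in> carrier G"
  shows "(\<Sum>x\<in>carrier G. f (a \<otimes> x)) = (\<Sum>x\<in>carrier G. f x)"
  using assms
  by (intro sum.reindex_bij_witness[of _ "\<lambda>x. inv a \<otimes> x" "\<lambda>x. a \<otimes> x"])
    (auto simp: m_assoc[symmetric])

lemma character_orthogonality:
  fixes \<Phi> \<Psi> :: "'d \<Rightarrow> 'k::field"
  assumes "group D" "\<Phi> \<in> carrier (hom_group D field_units)" "\<Psi> \<in> carrier (hom_group D field_units)"
  shows "(\<Sum>x\<in>carrier D. \<Phi> (inv\<^bsub>D\<^esub> x) * \<Psi> x) = (if \<Phi> = \<Psi> then of_nat (card (carrier D)) else 0)"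
proof -
  interpret group D by fact
  note \<Phi> = characterD[OF assms(2)] and \<Psi> = characterD[OF assms(3)]
  have inv: "\<Phi> (inv\<^bsub>D\<^esub> x) * \<Phi> x = 1" if "x \<in> carrier D" for x
    using that \<Phi>(2)[of "inv\<^bsub>D\<^esub> x" x] character_one[OF assms(1,2)] by simp
  show ?thesis
  proof (cases "\<Phi> = \<Psi>")
    case True
    then show ?thesis using inv by simp
  next
    case False
    then obtain a where a: "a \<in> carrier D" "\<Phi> a \<noteq> \<Psi> a"
      using hom_group_eqI[OF assms(2,3)] by blast
    let ?f = "\<lambda>x. \<Phi> (inv\<^bsub>D\<^esub> x) * \<Psi> x"
    have "\<Phi> a * ?f (a \<otimes>\<^bsub>D\<^esub> x) = \<Psi> a * ?f x" if x: "x \<in> carrier D" for x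
    proof -
      have "\<Phi> a * ?f (a \<otimes>\<^bsub>D\<^esub> x) = (\<Phi> (inv\<^bsub>D\<^esub> a) * \<Phi> a) * (\<Psi> a * ?f x)"
        using a(1) x by (simp add: \<Phi>(2) \<Psi>(2) inv_mult_group mult_ac)
      then show ?thesis using inv[OF a(1)] by simp
    qed
    then have "\<Phi> a * (\<Sum>x\<in>carrier D. ?f (a \<otimes>\<^bsub>D\<^esub> x)) = \<Psi> a * (\<Sum>x\<in>carrier D. ?f x)"
      by (simp add: sum_distrib_left)
    then have "(\<Phi> a - \<Psi> a) * (\<Sum>x\<in>carrier D. ?f x) = 0"
      using sum_translate[OF a(1), of ?f] by (simp add: algebra_simps)
    then show ?thesis using a(2) False by simp
  qed
qed

text \<open>
  The values of a character are roots of \<open>z\<^sup>n - 1\<close> for the group order \<open>n\<close>.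
\<close>
lemma finite_characters:
  assumes "group D" "finite (carrier D)"
  shows "finite (carrier (hom_group D (field_units :: 'k::field monoid)))"
proof -
  interpret group D by fact
  let ?n = "Coset.order D"
  have n: "?n > 0" using assms(2) by (simp add: order_gt_0_iff_finite)
  let ?R = "{z :: 'k. z ^ ?n = 1}"
  have pow: "\<chi> (x [^]\<^bsub>D\<^esub> k) = \<chi> x ^ k"
    if "\<chi> \<in> carrier (hom_group D (field_units :: 'k::field monoid))" "x \<in> carrier D" for \<chi> x and k :: nat
    using that by (induction k) (auto simp: character_one[OF assms(1)] characterD)
  have "carrier (hom_group D (field_units :: 'k::field monoid)) \<subseteq> PiE (carrier D) (\<lambda>_. ?R)"
  proof
    fix \<chi> assume \<chi>: "\<chi> \<in> carrier (hom_group D (field_units :: 'k monoid))"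
    have "\<chi> x ^ ?n = 1" if "x \<in> carrier D" for x
      using pow[OF \<chi> that, of ?n] that by (simp add: pow_order_eq_1 character_one[OF assms(1) \<chi>])
    then show "\<chi> \<in> PiE (carrier D) (\<lambda>_. ?R)" using hom_groupD(3)[OF \<chi>] by (auto simp: PiE_def)
  qed
  moreover have "finite ?R"
  proof -
    have "finite {z. poly (Polynomial.monom 1 ?n - 1 :: 'k poly) z = 0}"
    proof (rule poly_roots_finite)
      have "coeff (Polynomial.monom 1 ?n - 1 :: 'k poly) ?n = 1" using n by simp
      then show "Polynomial.monom 1 ?n - 1 \<noteq> (0 :: 'k poly)" by (metis coeff_0 zero_neq_one)
    qed
    then show ?thesis by (simp add: poly_monom)
  qed
  ultimately show ?thesis using assms(2) by (blast intro: finite_subset finite_PiE)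
qed

text \<open>
  Inflation along a surjection preserves irreducibility and endomorphisms. It is needed to pass from the quotient of a
  subgroup by its trivial subgroup to the subgroup itself, which are different types here.
\<close>
lemma splitting_field_surj_hom:
  assumes i: "i \<in> hom D E" "i ` carrier D = carrier E" and split: "splitting_field TYPE('k::field) D"
  shows "splitting_field TYPE('k) E"
  unfolding splitting_field_def
proof (intro allI impI ballI)
  fix n and \<rho> :: "'b \<Rightarrow> 'k mat" and M :: "'k mat"
  assume irr: "irreducible_rep E n \<rho>" and M: "M \<in> carrier_mat n n"
    and comm: "\<forall>x\<in>carrier E. M * \<rho> x = \<rho> x * M"
  have "irreducible_rep D n (\<rho> \<circ> i)"
    unfolding irreducible_rep_def
  proof (intro conjI allI impI)
    show "matrix_rep D n (\<rho> \<circ> i)"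
      using irr hom_compose[OF i(1)] unfolding irreducible_rep_def matrix_rep_def by blast
    show "0 < n" using irr by (simp add: irreducible_rep_def)
    fix W assume W: "VectorSpace.subspace class_ring W (module_vec TYPE('k) n)"
      "\<forall>x\<in>carrier D. \<forall>w\<in>W. (\<rho> \<circ> i) x *\<^sub>v w \<in> W"
    have "\<forall>x\<in>carrier E. \<forall>w\<in>W. \<rho> x *\<^sub>v w \<in> W"
      using W(2) unfolding i(2)[symmetric] by simp
    then show "W = {0\<^sub>v n} \<or> W = carrier_vec n"
      using irr W(1) unfolding irreducible_rep_def by blast
  qed
  moreover have "\<forall>x\<in>carrier D. M * (\<rho> \<circ> i) x = (\<rho> \<circ> i) x * M"
    using comm unfolding i(2)[symmetric] by simp
  ultimately show "\<exists>c. M = c \<cdot>\<^sub>m 1\<^sub>m n"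
    using split M unfolding splitting_field_def by blast
qed

text \<open>
  The elements on which all characters vanish form a subspace that is stable under translations. If it were
  nonzero, it would contain a common eigenvector \<open>g\<close> of the translations. With eigenvalues \<open>c\<close>,
  comparing coefficients gives \<open>c x * g x = g 1\<close>; so \<open>c\<close> is a character, and its value on \<open>g\<close> is
  \<open>|D| * g 1\<close>, which is nonzero in characteristic \<open>0\<close>.
\<close>
lemma characters_separate_group_algebra:
  fixes f :: "'d \<Rightarrow>\<^sub>0 'k::field_char_0"
  assumes D: "comm_group D" and fin: "finite (carrier D)" and split: "splitting_field TYPE('k) D"
    and keys: "Poly_Mapping.keys f \<subseteq> carrier D"
    and vanish: "\<And>\<chi>. \<chi> \<in> carrier (hom_group D field_units) \<Longrightarrow> lin_eval \<chi> f = 0"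
  shows "f = 0"
proof (rule ccontr)
  assume "f \<noteq> 0"
  interpret D: comm_group D by fact
  define W where "W = {f :: 'd \<Rightarrow>\<^sub>0 'k. Poly_Mapping.keys f \<subseteq> carrier D \<and>
      (\<forall>\<chi>\<in>carrier (hom_group D field_units). lin_eval \<chi> f = 0)}"
  define T where "T x = lin_ext (\<lambda>y. Poly_Mapping.single (x \<otimes>\<^bsub>D\<^esub> y) (1 :: 'k))" for x
  have eval_T: "lin_eval \<chi> (T x f) = lin_eval (\<lambda>y. \<chi> (x \<otimes>\<^bsub>D\<^esub> y)) f" for \<chi> :: "'d \<Rightarrow> 'k" and x f
    by (simp add: T_def lin_eval_lin_ext)
  have keys_T: "Poly_Mapping.keys (T x f) \<subseteq> carrier D"
    if "x \<in> carrier D" "Poly_Mapping.keys f \<subseteq> carrier D" for x f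
    unfolding T_def using that by (intro keys_lin_ext_subset) auto
  have sub: "free_vs.subspace W"
  proof (rule free_vs.subspaceI)
    fix u v assume "u \<in> W" "v \<in> W"
    then show "u + v \<in> W" using Poly_Mapping.keys_add[of u v] by (auto simp: W_def)
  next
    fix c v assume "v \<in> W"
    then show "scale c v \<in> W" using keys_scale[of c v] by (auto simp: W_def)
  qed (simp add: W_def)
  let ?F = "(\<lambda>x. Poly_Mapping.single x (1::'k)) ` carrier D"
  have span: "W \<subseteq> free_vs.span ?F"
  proof
    fix v assume "v \<in> W"
    then have v: "Poly_Mapping.keys v \<subseteq> carrier D" by (simp add: W_def)
    have "lin_eval g v = lin_eval g (\<Sum>x\<in>Poly_Mapping.keys v. scale (Poly_Mapping.lookup v x) (Poly_Mapping.single x 1))" for g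
      by (simp add: lin_eval_def[of g v])
    then have "v = (\<Sum>x\<in>Poly_Mapping.keys v. scale (Poly_Mapping.lookup v x) (Poly_Mapping.single x 1))"
      by (rule poly_mapping_eq_lin_evalI)
    moreover have "\<dots> \<in> free_vs.span ?F"
      using v by (intro free_vs.span_sum free_vs.span_scale free_vs.span_base) auto
    ultimately show "v \<in> free_vs.span ?F" by simp
  qed
  have fW: "f \<in> W" using keys vanish by (simp add: W_def)
  have inv: "T x v \<in> W" if x: "x \<in> carrier D" and v: "v \<in> W" for x v
  proof -
    have "lin_eval \<chi> (T x v) = 0" if \<chi>: "\<chi> \<in> carrier (hom_group D field_units)" for \<chi>
    proof -
      have "lin_eval \<chi> (T x v) = lin_eval (\<lambda>y. \<chi> x * \<chi> y) v"
        unfolding eval_T using x v by (intro lin_eval_cong) (auto simp: W_def characterD[OF \<chi>])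
      also have "\<dots> = \<chi> x * lin_eval \<chi> v"
        by (simp add: lin_eval_def sum_distrib_left mult_ac)
      finally show ?thesis using v \<chi> by (simp add: W_def)
    qed
    then show ?thesis using keys_T x v by (simp add: W_def)
  qed
  obtain g c where g: "g \<in> W" "g \<noteq> 0" and c: "\<And>x. x \<in> carrier D \<Longrightarrow> T x g = scale (c x) g"
  proof (rule free_vs.common_eigenvector[OF D split sub span _ fW \<open>f \<noteq> 0\<close>, of T])
    show "T x (u + v) = T x u + T x v" for x u v
      by (rule poly_mapping_eq_lin_evalI) (simp add: eval_T)
    show "T x (scale c v) = scale c (T x v)" for x c v
      by (rule poly_mapping_eq_lin_evalI) (simp add: eval_T)
    show "T \<one>\<^bsub>D\<^esub> v = v" if "v \<in> W" for v
      using that by (intro poly_mapping_eq_lin_evalI, unfold eval_T) (auto simp: W_def intro!: lin_eval_cong)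
    show "T (x \<otimes>\<^bsub>D\<^esub> y) v = T x (T y v)" if "x \<in> carrier D" "y \<in> carrier D" "v \<in> W" for x y v
      using that by (intro poly_mapping_eq_lin_evalI, unfold eval_T)
        (auto simp: W_def D.m_assoc intro!: lin_eval_cong)
  qed (use fin inv in auto)
  have g_keys: "Poly_Mapping.keys g \<subseteq> carrier D" using g(1) by (simp add: W_def)
  have coeff: "Poly_Mapping.lookup g y = c x * Poly_Mapping.lookup g (x \<otimes>\<^bsub>D\<^esub> y)"
    if xy: "x \<in> carrier D" "y \<in> carrier D" for x y
  proof -
    have "Poly_Mapping.lookup (T x g) (x \<otimes>\<^bsub>D\<^esub> y) =
        lin_eval (\<lambda>z. if x \<otimes>\<^bsub>D\<^esub> z = x \<otimes>\<^bsub>D\<^esub> y then 1 else 0) g"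
      by (simp only: lookup_eq_lin_eval eval_T)
    also have "\<dots> = lin_eval (\<lambda>z. if z = y then 1 else 0) g"
      using xy g_keys by (intro lin_eval_cong) auto
    also have "\<dots> = Poly_Mapping.lookup g y" by (simp only: lookup_eq_lin_eval)
    finally show ?thesis by (simp add: c[OF xy(1)])
  qed
  define z where "z = Poly_Mapping.lookup g \<one>\<^bsub>D\<^esub>"
  have cz: "c x * Poly_Mapping.lookup g x = z" if "x \<in> carrier D" for x
    using coeff[OF that, of "\<one>\<^bsub>D\<^esub>"] that by (simp add: z_def)
  have z: "z \<noteq> 0"
  proof
    assume "z = 0"
    have "Poly_Mapping.lookup g y = 0" if y: "y \<in> carrier D" for y
      using coeff[of "inv\<^bsub>D\<^esub> y" y] y \<open>z = 0\<close> by (simp add: z_def)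
    then have "g = 0" using g_keys by (intro poly_mapping_eqI) (auto simp: in_keys_iff)
    then show False using g(2) by simp
  qed
  have c_ne: "c x \<noteq> 0" if "x \<in> carrier D" for x using cz[OF that] z by auto
  define \<chi> where "\<chi> = (\<lambda>x\<in>carrier D. c x)"
  have "\<chi> \<in> carrier (hom_group D field_units)"
  proof (rule characterI)
    fix x y assume xy: "x \<in> carrier D" "y \<in> carrier D"
    have "c x * c y * Poly_Mapping.lookup g (x \<otimes>\<^bsub>D\<^esub> y) = c y * (c x * Poly_Mapping.lookup g (x \<otimes>\<^bsub>D\<^esub> y))"
      by (simp add: mult_ac)
    also have "\<dots> = z" using coeff[OF xy] cz[OF xy(2)] by simp
    also have "\<dots> = c (x \<otimes>\<^bsub>D\<^esub> y) * Poly_Mapping.lookup g (x \<otimes>\<^bsub>D\<^esub> y)" using cz xy by simp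
    finally have "c (x \<otimes>\<^bsub>D\<^esub> y) = c x * c y" using cz[of "x \<otimes>\<^bsub>D\<^esub> y"] xy z by auto
    then show "\<chi> (x \<otimes>\<^bsub>D\<^esub> y) = \<chi> x * \<chi> y" using xy by (simp add: \<chi>_def)
  qed (auto simp: \<chi>_def c_ne)
  then have "lin_eval \<chi> g = 0" using g(1) by (simp add: W_def)
  moreover have "lin_eval \<chi> g = of_nat (card (carrier D)) * z"
    using cz by (simp add: lin_eval_superset[OF fin g_keys] \<chi>_def mult.commute)
  moreover have "card (carrier D) \<noteq> 0" using fin D.one_closed by auto
  ultimately show False using z by simp
qed

lemma characters_separate:
  fixes f :: "'d \<Rightarrow> 'k::field_char_0"
  assumes D: "comm_group D" "finite (carrier D)" "splitting_field TYPE('k) D"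
    and vanish: "\<And>\<chi>. \<chi> \<in> carrier (hom_group D field_units) \<Longrightarrow> (\<Sum>x\<in>carrier D. f x * \<chi> x) = 0"
    and x: "x \<in> carrier D"
  shows "f x = 0"
proof -
  define F where "F = (\<Sum>y\<in>carrier D. Poly_Mapping.single y (f y))"
  have "F = 0"
  proof (rule characters_separate_group_algebra[OF D])
    show "Poly_Mapping.keys F \<subseteq> carrier D" unfolding F_def by (rule keys_sum_subset) auto
    show "lin_eval \<chi> F = 0" if "\<chi> \<in> carrier (hom_group D field_units)" for \<chi>
      using vanish[OF that] by (simp add: F_def)
  qed
  have "lin_eval (\<lambda>b. if b = x then 1 else 0) F = (\<Sum>y\<in>carrier D. if y = x then f y else 0)"
    unfolding F_def lin_eval_sum by (intro sum.cong) auto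
  then show ?thesis using x D(2) \<open>F = 0\<close> by simp
qed

section \<open>Conjugation of subgroups and of homomorphisms\<close>

text \<open>
  The conjugate of \<open>\<phi>\<close> by \<open>g\<close>, restricted to \<open>L\<close>. It is meaningful when \<open>L\<close> lies in the conjugate by \<open>g\<close> of
  the domain of \<open>\<phi>\<close>. Naming the domain \<open>L\<close> instead of that of \<open>\<phi>\<close> lets one operation serve for conjugation and
  restriction, and makes composition a single rule (\<open>twist_twist\<close>).
\<close>
definition twist :: "('g, 'm) monoid_scheme \<Rightarrow> 'g set \<Rightarrow> 'g \<Rightarrow> ('g \<Rightarrow> 'a) \<Rightarrow> ('g \<Rightarrow> 'a)" where
  "twist G L g \<phi> = (\<lambda>x\<in>L. \<phi> (inv\<^bsub>G\<^esub> g \<otimes>\<^bsub>G\<^esub> x \<otimes>\<^bsub>G\<^esub> g))"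

context group
begin

lemma inv_cancel_left:
  assumes "g \<in> carrier G" "x \<in> carrier G"
  shows "inv g \<otimes> (g \<otimes> x) = x" "g \<otimes> (inv g \<otimes> x) = x"
  using assms by (simp_all add: m_assoc[symmetric])

lemma conj_set_iff:
  assumes "U \<subseteq> carrier G" "g \<in> carrier G"
  shows "x \<in> conj_set G g U \<longleftrightarrow> x \<in> carrier G \<and> inv g \<otimes> x \<otimes> g \<in> U"
proof
  assume "x \<in> conj_set G g U"
  then obtain u where u: "u \<in> U" "x = g \<otimes> u \<otimes> inv g" by (auto simp: conj_set_def)
  then have "inv g \<otimes> x \<otimes> g = u"
    using assms by (simp add: m_assoc inv_cancel_left subsetD)
  then show "x \<in> carrier G \<and> inv g \<otimes> x \<otimes> g \<in> U" using u assms by auto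
next
  assume x: "x \<in> carrier G \<and> inv g \<otimes> x \<otimes> g \<in> U"
  then have "x = g \<otimes> (inv g \<otimes> x \<otimes> g) \<otimes> inv g"
    using assms by (simp add: m_assoc inv_cancel_left)
  then show "x \<in> conj_set G g U" using x unfolding conj_set_def by blast
qed

lemma conj_set_subset: "U \<subseteq> carrier G \<Longrightarrow> g \<in> carrier G \<Longrightarrow> conj_set G g U \<subseteq> carrier G"
  using conj_set_iff by blast

lemma conj_set_mono: "U \<subseteq> V \<Longrightarrow> conj_set G g U \<subseteq> conj_set G g V"
  unfolding conj_set_def by blast

lemma conj_set_Int:
  assumes "U \<subseteq> carrier G" "V \<subseteq> carrier G" "g \<in> carrier G"
  shows "conj_set G g (U \<inter> V) = conj_set G g U \<inter> conj_set G g V"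
proof -
  have "U \<inter> V \<subseteq> carrier G" using assms by blast
  then show ?thesis using assms by (auto simp: conj_set_iff)
qed

lemma inner_mult:
  assumes "g \<in> carrier G" "h \<in> carrier G" "x \<in> carrier G"
  shows "inv h \<otimes> (inv g \<otimes> x \<otimes> g) \<otimes> h = inv (g \<otimes> h) \<otimes> x \<otimes> (g \<otimes> h)"
  using assms by (simp add: inv_mult_group m_assoc)

lemma conj_set_mult:
  assumes "U \<subseteq> carrier G" "g \<in> carrier G" "h \<in> carrier G"
  shows "conj_set G (g \<otimes> h) U = conj_set G g (conj_set G h U)"
  using assms conj_set_subset[OF assms(1,3)] by (auto simp: conj_set_iff inner_mult)

lemma conj_set_one: "U \<subseteq> carrier G \<Longrightarrow> conj_set G \<one> U = U"
  by (auto simp: conj_set_iff subsetD)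

lemma conj_set_inv_cancel:
  assumes "U \<subseteq> carrier G" "g \<in> carrier G"
  shows "conj_set G (inv g) (conj_set G g U) = U" "conj_set G g (conj_set G (inv g) U) = U"
  using assms by (simp_all add: conj_set_mult[symmetric] conj_set_one)

lemma conj_set_subset_iff:
  assumes "U \<subseteq> carrier G" "V \<subseteq> carrier G" "g \<in> carrier G"
  shows "conj_set G g U \<subseteq> conj_set G g V \<longleftrightarrow> U \<subseteq> V"
  using conj_set_mono[of U V g] conj_set_mono[of "conj_set G g U" "conj_set G g V" "inv g"]
  by (auto simp: conj_set_inv_cancel[OF assms(1,3)] conj_set_inv_cancel[OF assms(2,3)])

lemma conj_set_subgroup:
  assumes "subgroup U G" "g \<in> U"
  shows "conj_set G g U = U"
proof -
  interpret U: subgroup U G by fact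
  have g: "g \<in> carrier G" using assms(2) by (rule U.mem_carrier)
  have "x \<in> U" if x: "x \<in> carrier G" "inv g \<otimes> x \<otimes> g \<in> U" for x
  proof -
    have "g \<otimes> (inv g \<otimes> x \<otimes> g) \<otimes> inv g \<in> U" using x(2) assms(2) by blast
    also have "g \<otimes> (inv g \<otimes> x \<otimes> g) \<otimes> inv g = x" using x(1) g by (simp add: m_assoc inv_cancel_left)
    finally show ?thesis .
  qed
  moreover have "inv g \<otimes> x \<otimes> g \<in> U" if "x \<in> U" for x using that assms(2) by blast
  ultimately show ?thesis using conj_set_iff[OF U.subset g] U.mem_carrier by blast
qed

lemma card_conj_set:
  assumes "U \<subseteq> carrier G" "g \<in> carrier G"
  shows "card (conj_set G g U) = card U"
  unfolding conj_set_def using assms by (intro card_image inj_onI) (auto simp: subsetD)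

lemma subgroup_conj_set:
  assumes "subgroup U G" "g \<in> carrier G"
  shows "subgroup (conj_set G g U) G"
proof -
  interpret U: subgroup U G by fact
  show ?thesis
  proof (rule subgroupI)
    show "conj_set G g U \<subseteq> carrier G" using conj_set_subset U.subset assms by blast
    show "conj_set G g U \<noteq> {}" using U.one_closed unfolding conj_set_def by blast
  next
    fix x assume x: "x \<in> conj_set G g U"
    then have "inv (inv g \<otimes> x \<otimes> g) \<in> U" using U.subset assms by (simp add: conj_set_iff)
    then show "inv x \<in> conj_set G g U"
      using x U.subset assms by (simp add: conj_set_iff inv_mult_group m_assoc)
  next
    fix x y assume xy: "x \<in> conj_set G g U" "y \<in> conj_set G g U"
    then have c: "x \<in> carrier G" "y \<in> carrier G" using U.subset assms by (simp_all add: conj_set_iff)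
    have "(inv g \<otimes> x \<otimes> g) \<otimes> (inv g \<otimes> y \<otimes> g) \<in> U"
      using xy U.subset assms by (simp add: conj_set_iff)
    also have "(inv g \<otimes> x \<otimes> g) \<otimes> (inv g \<otimes> y \<otimes> g) = inv g \<otimes> (x \<otimes> y) \<otimes> g"
    proof -
      have "g \<otimes> (inv g \<otimes> (y \<otimes> g)) = y \<otimes> g" using c assms by (simp add: m_assoc[symmetric])
      then show ?thesis using c assms by (simp add: m_assoc)
    qed
    finally show "x \<otimes> y \<in> conj_set G g U" using c U.subset assms by (simp add: conj_set_iff)
  qed
qed

lemma twist_apply: "x \<in> L \<Longrightarrow> twist G L g \<phi> x = \<phi> (inv g \<otimes> x \<otimes> g)"
  by (simp add: twist_def)

lemma conj_pair_eq: "conj_pair G g (U, \<phi>) = (conj_set G g U, twist G (conj_set G g U) g \<phi>)"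
  by (simp add: conj_pair_def conj_hom_def twist_def)

lemma restrict_conj_hom: "L \<subseteq> conj_set G g U \<Longrightarrow> restrict (conj_hom G g U \<phi>) L = twist G L g \<phi>"
  by (auto simp: conj_hom_def twist_def restrict_def fun_eq_iff)

lemma twist_twist:
  assumes "L \<subseteq> conj_set G g M" "M \<subseteq> carrier G" "g \<in> carrier G" "h \<in> carrier G"
  shows "twist G L g (twist G M h \<phi>) = twist G L (g \<otimes> h) \<phi>"
proof
  fix x
  show "twist G L g (twist G M h \<phi>) x = twist G L (g \<otimes> h) \<phi> x"
  proof (cases "x \<in> L")
    case True
    then have "x \<in> carrier G" "inv g \<otimes> x \<otimes> g \<in> M" using assms conj_set_iff by blast+
    then show ?thesis using True assms by (simp add: twist_apply inner_mult)
  qed (simp add: twist_def)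
qed

lemma twist_one:
  assumes "\<phi> \<in> extensional U" "U \<subseteq> carrier G"
  shows "twist G U \<one> \<phi> = \<phi>"
  using assms by (intro extensionalityI[of _ U]) (auto simp: twist_def subsetD)

lemma twist_in_hom_group:
  assumes "subgroup U G" "subgroup L G" "g \<in> carrier G" "L \<subseteq> conj_set G g U"
    and \<phi>: "\<phi> \<in> carrier (hom_group (G\<lparr>carrier := U\<rparr>) A)"
  shows "twist G L g \<phi> \<in> carrier (hom_group (G\<lparr>carrier := L\<rparr>) A)"
proof (rule hom_groupI)
  interpret U: subgroup U G by fact
  interpret L: subgroup L G by fact
  have U: "inv g \<otimes> x \<otimes> g \<in> U" if "x \<in> L" for x
    using that assms(3,4) conj_set_iff[OF U.subset assms(3)] by blast
  show "twist G L g \<phi> x \<in> carrier A" if "x \<in> carrier (G\<lparr>carrier := L\<rparr>)" for x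
    using that U hom_groupD(1)[OF \<phi>] by (simp add: twist_apply)
  fix x y assume "x \<in> carrier (G\<lparr>carrier := L\<rparr>)" "y \<in> carrier (G\<lparr>carrier := L\<rparr>)"
  then have xy: "x \<in> L" "y \<in> L" by auto
  then have c: "x \<in> carrier G" "y \<in> carrier G" by auto
  have "g \<otimes> (inv g \<otimes> (y \<otimes> g)) = y \<otimes> g" using c assms(3) by (simp add: m_assoc[symmetric])
  then have "inv g \<otimes> (x \<otimes> y) \<otimes> g = (inv g \<otimes> x \<otimes> g) \<otimes> (inv g \<otimes> y \<otimes> g)"
    using c assms(3) by (simp add: m_assoc)
  then show "twist G L g \<phi> (x \<otimes>\<^bsub>G\<lparr>carrier := L\<rparr>\<^esub> y) = twist G L g \<phi> x \<otimes>\<^bsub>A\<^esub> twist G L g \<phi> y"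
    using xy U hom_groupD(2)[OF \<phi>, of "inv g \<otimes> x \<otimes> g" "inv g \<otimes> y \<otimes> g"] by (simp add: twist_apply)
qed (simp add: twist_def)

lemma twist_mult:
  assumes "L \<subseteq> conj_set G g U" "U \<subseteq> carrier G" "g \<in> carrier G"
  shows "twist G L g (\<phi> \<otimes>\<^bsub>hom_group (G\<lparr>carrier := U\<rparr>) A\<^esub> \<psi>) =
    twist G L g \<phi> \<otimes>\<^bsub>hom_group (G\<lparr>carrier := L\<rparr>) A\<^esub> twist G L g \<psi>"
proof
  fix x
  have "inv g \<otimes> x \<otimes> g \<in> U" if "x \<in> L" using that assms conj_set_iff by blast
  then show "twist G L g (\<phi> \<otimes>\<^bsub>hom_group (G\<lparr>carrier := U\<rparr>) A\<^esub> \<psi>) x =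
      (twist G L g \<phi> \<otimes>\<^bsub>hom_group (G\<lparr>carrier := L\<rparr>) A\<^esub> twist G L g \<psi>) x"
    by (simp add: hom_group_def twist_def)
qed

text \<open>
  Inner conjugation is invisible to homomorphisms into an abelian group. Hence the data attached to a coset
  \<open>gU\<close> depend only on the coset.
\<close>
lemma twist_inner:
  assumes "comm_group A" "subgroup U G" "u \<in> U" "\<phi> \<in> carrier (hom_group (G\<lparr>carrier := U\<rparr>) A)"
  shows "twist G U u \<phi> = \<phi>"
proof (rule extensionalityI[of _ U])
  interpret A: comm_group A by fact
  interpret U: subgroup U G by fact
  note \<phi> = hom_groupD[OF assms(4), simplified]
  show "\<phi> \<in> extensional U" by (rule \<phi>(3))
  fix x assume x: "x \<in> U"
  have "\<phi> (inv u \<otimes> x \<otimes> u) = \<phi> x \<otimes>\<^bsub>A\<^esub> \<phi> (inv u) \<otimes>\<^bsub>A\<^esub> \<phi> u"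
    using x assms(3) by (simp add: \<phi> A.m_ac)
  also have "\<dots> = \<phi> (x \<otimes> inv u \<otimes> u)" using x assms(3) by (simp add: \<phi>)
  finally show "twist G U u \<phi> x = \<phi> x"
    using x assms(3) by (simp add: twist_apply m_assoc)
qed (simp add: twist_def)

end

text \<open>
  Conjugation of pairs is given by functions on a whole type that form an action only on the pairs of
  interest; this weak notion is what the orbit arguments use.
\<close>
definition acts :: "('g, 'm) monoid_scheme \<Rightarrow> ('g \<Rightarrow> 'e \<Rightarrow> 'e) \<Rightarrow> 'e set \<Rightarrow> bool" where
  "acts G act E \<longleftrightarrow> (\<forall>g\<in>carrier G. \<forall>p\<in>E. act g p \<in> E) \<and> (\<forall>p\<in>E. act \<one>\<^bsub>G\<^esub> p = p) \<and>
     (\<forall>g\<in>carrier G. \<forall>h\<in>carrier G. \<forall>p\<in>E. act (g \<otimes>\<^bsub>G\<^esub> h) p = act g (act h p))"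

context group
begin

lemma orbit_refl: "acts G act E \<Longrightarrow> p \<in> E \<Longrightarrow> p \<in> orbit G act p"
  unfolding acts_def orbit_def by force

lemma orbit_closed: "acts G act E \<Longrightarrow> p \<in> E \<Longrightarrow> q \<in> orbit G act p \<Longrightarrow> q \<in> E"
  unfolding acts_def orbit_def by auto

lemma orbit_sym:
  assumes "acts G act E" "p \<in> E" "q \<in> orbit G act p"
  shows "p \<in> orbit G act q"
proof -
  obtain g where g: "g \<in> carrier G" "q = act g p" using assms(3) by (auto simp: orbit_def)
  have "act (inv g) q = act (inv g \<otimes> g) p"
    unfolding g(2) using assms(1,2) g(1) inv_closed[OF g(1)] unfolding acts_def by metis
  also have "\<dots> = p" using g(1) assms(1,2) unfolding acts_def by simp
  finally show ?thesis using g(1) unfolding orbit_def by force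
qed

lemma orbit_trans:
  assumes "acts G act E" "p \<in> E" "q \<in> orbit G act p" "r \<in> orbit G act q"
  shows "r \<in> orbit G act p"
proof -
  obtain g h where "g \<in> carrier G" "q = act g p" "h \<in> carrier G" "r = act h q"
    using assms(3,4) by (auto simp: orbit_def)
  then have "h \<otimes> g \<in> carrier G" "r = act (h \<otimes> g) p" using assms(1,2) unfolding acts_def by auto
  then show ?thesis unfolding orbit_def by blast
qed

lemma orbit_eq:
  assumes "acts G act E" "p \<in> E" "q \<in> orbit G act p"
  shows "orbit G act q = orbit G act p"
proof
  show "orbit G act q \<subseteq> orbit G act p" using orbit_trans[OF assms] by blast
  show "orbit G act p \<subseteq> orbit G act q"
    using orbit_trans[OF assms(1) orbit_closed[OF assms] orbit_sym[OF assms]] by blast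
qed

lemma acts_conj_pair: "acts G (conj_pair G) (char_pairs G A)"
  unfolding acts_def
proof (intro conjI ballI)
  fix p assume "p \<in> char_pairs G A"
  then obtain U \<phi> where p: "p = (U, \<phi>)" and U: "subgroup U G"
    and \<phi>: "\<phi> \<in> carrier (hom_group (G\<lparr>carrier := U\<rparr>) A)" by (auto simp: char_pairs_def)
  have Uc: "U \<subseteq> carrier G" using U by (rule subgroup.subset)
  show "conj_pair G \<one> p = p"
    using hom_groupD(3)[OF \<phi>] Uc by (simp add: p conj_pair_eq conj_set_one twist_one)
  fix g assume g: "g \<in> carrier G"
  show "conj_pair G g p \<in> char_pairs G A"
    using U \<phi> g by (simp add: p conj_pair_eq char_pairs_def subgroup_conj_set twist_in_hom_group)
  fix h assume h: "h \<in> carrier G"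
  show "conj_pair G (g \<otimes> h) p = conj_pair G g (conj_pair G h p)"
    using Uc g h by (simp add: p conj_pair_eq conj_set_mult conj_set_subset twist_twist)
qed

end

section \<open>Double cosets\<close>

context group
begin

text \<open>
  The map \<open>(h, u) \<mapsto> hgu\<close> from \<open>H \<times> U\<close> onto the double coset of \<open>g\<close> has fibres of size \<open>|H \<inter> gUg\<^sup>-\<^sup>1|\<close>.
  So this size, which is constant on the double coset, adds up to \<open>|H||U|\<close> over it.
\<close>
lemma sum_double_coset_reps:
  fixes F :: "'a \<Rightarrow> 'k::field_char_0"
  assumes fin: "finite (carrier G)" and H: "subgroup H G" and U: "subgroup U G"
    and F: "\<And>h g u. h \<in> H \<Longrightarrow> g \<in> carrier G \<Longrightarrow> u \<in> U \<Longrightarrow> F (h \<otimes> g \<otimes> u) = F g"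
  shows "(\<Sum>g\<in>double_coset_reps G H U. F g) =
    (\<Sum>x\<in>carrier G. F x * of_nat (card (H \<inter> conj_set G x U))) / of_nat (card H * card U)"
proof -
  interpret H: subgroup H G by fact
  interpret U: subgroup U G by fact
  define D where "D g = (\<lambda>(h, u). h \<otimes> g \<otimes> u) ` (H \<times> U)" for g
  have D_eq: "H #> g <#> U = D g" for g
    by (auto simp: D_def set_mult_def r_coset_def)
  have D_sub: "D g \<subseteq> carrier G" if "g \<in> carrier G" for g using that by (auto simp: D_def)
  have D_self: "g \<in> D g" if "g \<in> carrier G" for g
    unfolding D_def using that by (intro image_eqI[of _ _ "(\<one>, \<one>)"]) auto
  have D_mult: "D (h \<otimes> g \<otimes> u) = D g" if "h \<in> H" "g \<in> carrier G" "u \<in> U" for h g u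
  proof
    show "D (h \<otimes> g \<otimes> u) \<subseteq> D g"
    proof
      fix x assume "x \<in> D (h \<otimes> g \<otimes> u)"
      then obtain h' u' where "h' \<in> H" "u' \<in> U" "x = h' \<otimes> (h \<otimes> g \<otimes> u) \<otimes> u'" by (auto simp: D_def)
      then show "x \<in> D g"
        unfolding D_def using that by (intro image_eqI[of _ _ "(h' \<otimes> h, u \<otimes> u')"]) (auto simp: m_assoc)
    qed
    show "D g \<subseteq> D (h \<otimes> g \<otimes> u)"
    proof
      fix x assume "x \<in> D g"
      then obtain h' u' where *: "h' \<in> H" "u' \<in> U" "x = h' \<otimes> g \<otimes> u'" by (auto simp: D_def)
      then have "x = h' \<otimes> inv h \<otimes> (h \<otimes> g \<otimes> u) \<otimes> (inv u \<otimes> u')"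
        using that by (simp add: m_assoc inv_cancel_left)
      then show "x \<in> D (h \<otimes> g \<otimes> u)"
        unfolding D_def using that * by (intro image_eqI[of _ _ "(h' \<otimes> inv h, inv u \<otimes> u')"]) auto
    qed
  qed
  have D_in: "D x = D g" if g: "g \<in> carrier G" and x: "x \<in> D g" for g x
  proof -
    obtain h u where hu: "h \<in> H" "u \<in> U" "x = h \<otimes> g \<otimes> u" using x by (auto simp: D_def)
    show ?thesis unfolding hu(3) by (rule D_mult[OF hu(1) g hu(2)])
  qed
  define \<D> where "\<D> = D ` carrier G"
  have reps: "double_coset_reps G H U = (\<lambda>d. SOME g. g \<in> d) ` \<D>"
    unfolding double_coset_reps_def \<D>_def D_eq by (simp add: setcompr_eq_image)
  have some: "(SOME g. g \<in> d) \<in> d" "d \<subseteq> carrier G" "\<And>x. x \<in> d \<Longrightarrow> D x = d" if d: "d \<in> \<D>" for d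
  proof -
    obtain g where g: "g \<in> carrier G" "d = D g" using d by (auto simp: \<D>_def)
    show "(SOME g. g \<in> d) \<in> d" using someI[of "\<lambda>x. x \<in> d", OF D_self[OF g(1), folded g(2)]] .
    show "d \<subseteq> carrier G" unfolding g(2) by (rule D_sub[OF g(1)])
    show "D x = d" if "x \<in> d" for x using D_in[OF g(1)] that unfolding g(2) by blast
  qed
  have inj: "inj_on (\<lambda>d. SOME g. g \<in> d) \<D>"
  proof (rule inj_onI)
    fix d d' assume d: "d \<in> \<D>" "d' \<in> \<D>" and eq: "(SOME g. g \<in> d) = (SOME g. g \<in> d')"
    have "d = D (SOME g. g \<in> d)" using some(1,3)[OF d(1)] by simp
    also have "\<dots> = d'" unfolding eq using some(1,3)[OF d(2)] by simp
    finally show "d = d'" .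
  qed
  have Union: "\<Union>\<D> = carrier G" using D_self D_sub by (auto simp: \<D>_def)
  have disj: "d \<inter> d' = {}" if d: "d \<in> \<D>" "d' \<in> \<D>" "d \<noteq> d'" for d d'
    using some(3)[OF d(1)] some(3)[OF d(2)] d(3) by auto
  let ?w = "\<lambda>x. of_nat (card (H \<inter> conj_set G x U)) :: 'k"
  have fiber: "card {p \<in> H \<times> U. (\<lambda>(h, u). h \<otimes> g \<otimes> u) p = x} = card (H \<inter> conj_set G g U)"
    if g: "g \<in> carrier G" and x: "x \<in> D g" for g x
  proof -
    obtain h0 u0 where x0: "h0 \<in> H" "u0 \<in> U" "x = h0 \<otimes> g \<otimes> u0" using x by (auto simp: D_def)
    \<comment> \<open>The fibre is a torsor: \<open>k\<close> moves \<open>(h0, u0)\<close> to \<open>(h0 k, (g\<^sup>-\<^sup>1 k g)\<^sup>-\<^sup>1 u0)\<close>.\<close>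
    have "bij_betw (\<lambda>k. (h0 \<otimes> k, inv (inv g \<otimes> k \<otimes> g) \<otimes> u0)) (H \<inter> conj_set G g U)
        {p \<in> H \<times> U. (\<lambda>(h, u). h \<otimes> g \<otimes> u) p = x}"
    proof (rule bij_betwI[where g = "\<lambda>(h, u). inv h0 \<otimes> h"], goal_cases)
      case 1
      have "h0 \<otimes> k \<otimes> g \<otimes> (inv (inv g \<otimes> k \<otimes> g) \<otimes> u0) = h0 \<otimes> g \<otimes> u0" if k: "k \<in> carrier G" for k
      proof -
        have "k \<otimes> g \<otimes> inv (inv g \<otimes> k \<otimes> g) = g"
          using k g by (simp add: inv_mult_group m_assoc inv_cancel_left)
        moreover have "h0 \<otimes> k \<otimes> g \<otimes> (inv (inv g \<otimes> k \<otimes> g) \<otimes> u0) =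
            h0 \<otimes> (k \<otimes> g \<otimes> inv (inv g \<otimes> k \<otimes> g)) \<otimes> u0"
          using k g x0 by (simp add: m_assoc)
        ultimately show ?thesis by simp
      qed
      moreover have "inv (inv g \<otimes> k \<otimes> g) \<otimes> u0 \<in> U" if "k \<in> conj_set G g U" for k
        using that x0(2) unfolding conj_set_iff[OF U.subset g] by blast
      ultimately show ?case using x0 by auto
    next
      case 2
      have "inv h0 \<otimes> h \<in> conj_set G g U"
        if h: "h \<in> H" and u: "u \<in> U" and eq: "h \<otimes> g \<otimes> u = x" for h u
      proof -
        have "h \<otimes> g = h0 \<otimes> g \<otimes> u0 \<otimes> inv u"
          using eq x0 h u g by (simp add: inv_solve_right)
        then have "inv g \<otimes> (inv h0 \<otimes> h) \<otimes> g = inv g \<otimes> (inv h0 \<otimes> (h0 \<otimes> g \<otimes> u0 \<otimes> inv u))"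
          using x0 h g by (simp add: m_assoc)
        also have "\<dots> = (inv g \<otimes> ((inv h0 \<otimes> h0) \<otimes> g)) \<otimes> (u0 \<otimes> inv u)"
          using x0 u g by (simp only: m_assoc m_closed inv_closed H.mem_carrier U.mem_carrier)
        also have "\<dots> = u0 \<otimes> inv u" using x0 u g by simp
        finally have "inv g \<otimes> (inv h0 \<otimes> h) \<otimes> g \<in> U" using x0(2) u by simp
        then show ?thesis using x0 h unfolding conj_set_iff[OF U.subset g] by simp
      qed
      then show ?case using x0(1) by auto
    next
      case (3 k)
      then show ?case using x0 by (simp add: m_assoc[symmetric])
    next
      case (4 p)
      then obtain h u where p: "p = (h, u)" "h \<in> H" "u \<in> U" "h \<otimes> g \<otimes> u = x" by auto
      have "h0 \<otimes> (inv h0 \<otimes> h) = h" using p x0 by (simp add: m_assoc[symmetric])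
      moreover have "inv (inv g \<otimes> (inv h0 \<otimes> h) \<otimes> g) \<otimes> u0 = u"
      proof -
        have "inv (inv g \<otimes> (inv h0 \<otimes> h) \<otimes> g) \<otimes> u0 = inv (h \<otimes> g) \<otimes> (h0 \<otimes> g \<otimes> u0)"
          using p x0 g by (simp add: inv_mult_group m_assoc)
        also have "\<dots> = inv (h \<otimes> g) \<otimes> (h \<otimes> g \<otimes> u)" using p(4) x0(3) by simp
        also have "\<dots> = u" using p(2,3) g inv_cancel_left(1)[of "h \<otimes> g" u] by simp
        finally show ?thesis .
      qed
      ultimately show ?case by (simp add: p(1))
    qed
    then show ?thesis by (rule bij_betw_same_card[symmetric])
  qed
  have finHU: "finite (H \<times> U)"
    using fin H.subset U.subset by (intro finite_cartesian_product) (auto intro: finite_subset)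
  have card_D: "card (D g) * card (H \<inter> conj_set G g U) = card H * card U" if g: "g \<in> carrier G" for g
  proof -
    have "card (H \<times> U) = (\<Sum>x\<in>D g. card {p \<in> H \<times> U. (\<lambda>(h, u). h \<otimes> g \<otimes> u) p = x})"
      unfolding D_def using sum.image_gen[OF finHU, of "\<lambda>_. 1::nat"] by simp
    also have "\<dots> = card (D g) * card (H \<inter> conj_set G g U)" using fiber[OF g] by simp
    finally show ?thesis by (simp add: card_cartesian_product)
  qed
  have "finite H" "finite U" using fin H.subset U.subset finite_subset by blast+
  moreover have "H \<noteq> {}" "U \<noteq> {}" using H.one_closed U.one_closed by blast+
  ultimately have pos: "card H * card U \<noteq> 0" by simp
  have const: "F x * ?w x = F g * ?w g" if g: "g \<in> carrier G" and x: "x \<in> D g" for g x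
  proof -
    obtain h u where hu: "h \<in> H" "u \<in> U" "x = h \<otimes> g \<otimes> u" using x by (auto simp: D_def)
    have "x \<in> carrier G" using D_sub[OF g] x by blast
    then have "card (D g) * card (H \<inter> conj_set G x U) = card (D g) * card (H \<inter> conj_set G g U)"
      using card_D[of x] card_D[OF g] D_in[OF g x] by simp
    moreover have "card (D g) \<noteq> 0" using pos card_D[OF g] by (metis mult_zero_left)
    ultimately have "card (H \<inter> conj_set G x U) = card (H \<inter> conj_set G g U)" by simp
    moreover have "F x = F g" unfolding hu(3) by (rule F[OF hu(1) g hu(2)])
    ultimately show ?thesis by simp
  qed
  have coset: "(\<Sum>x\<in>d. F x * ?w x) = F (SOME g. g \<in> d) * of_nat (card H * card U)" if d: "d \<in> \<D>" for d
  proof -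
    let ?g = "SOME g. g \<in> d"
    have g: "?g \<in> carrier G" "D ?g = d" using some[OF d] by auto
    have "(\<Sum>x\<in>d. F x * ?w x) = (\<Sum>x\<in>d. F ?g * ?w ?g)"
      using const[OF g(1)] g(2) by (intro sum.cong) auto
    also have "\<dots> = F ?g * of_nat (card (D ?g) * card (H \<inter> conj_set G ?g U))" using g(2) by simp
    finally show ?thesis by (simp only: card_D[OF g(1)])
  qed
  have "(\<Sum>x\<in>carrier G. F x * ?w x) = (\<Sum>d\<in>\<D>. \<Sum>x\<in>d. F x * ?w x)"
  proof -
    have "sum (\<lambda>x. F x * ?w x) (\<Union>\<D>) = (sum \<circ> sum) (\<lambda>x. F x * ?w x) \<D>"
    proof (rule sum.Union_disjoint)
      show "\<forall>d\<in>\<D>. finite d" using some(2) finite_subset[OF _ fin] by blast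
      show "\<forall>d\<in>\<D>. \<forall>d'\<in>\<D>. d \<noteq> d' \<longrightarrow> d \<inter> d' = {}" using disj by blast
    qed
    then show ?thesis by (simp add: Union)
  qed
  also have "\<dots> = (\<Sum>d\<in>\<D>. F (SOME g. g \<in> d)) * of_nat (card H * card U)"
    using coset by (simp add: sum_distrib_right)
  also have "(\<Sum>d\<in>\<D>. F (SOME g. g \<in> d)) = (\<Sum>g\<in>double_coset_reps G H U. F g)"
    unfolding reps by (simp add: sum.reindex[OF inj])
  finally show ?thesis using pos by (simp add: field_simps)
qed

end

section \<open>Species as averages over the group\<close>

definition mark_term ::
  "('g, 'm) monoid_scheme \<Rightarrow> 'g set \<Rightarrow> (('g \<Rightarrow> 'a) \<Rightarrow> 'k::field) \<Rightarrow> 'g set \<times> ('g \<Rightarrow> 'a) \<Rightarrow> 'g \<Rightarrow> 'k" where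
  "mark_term G L \<Psi> p g =
     (if L \<subseteq> conj_set G g (fst p) then \<Psi> (twist G L g (snd p)) else 0)"

text \<open>
  Each coset \<open>gU\<close> contributes \<open>|U|\<close> equal terms, so this is the sum over the cosets that \<open>L\<close> fixes.
  For trivial \<open>A\<close> it is the classical mark, the number of fixed points of \<open>L\<close> on \<open>G/U\<close>.
\<close>
definition mark ::
  "('g, 'm) monoid_scheme \<Rightarrow> 'g set \<Rightarrow> (('g \<Rightarrow> 'a) \<Rightarrow> 'k::field) \<Rightarrow> 'g set \<times> ('g \<Rightarrow> 'a) \<Rightarrow> 'k" where
  "mark G L \<Psi> p = (\<Sum>g\<in>carrier G. mark_term G L \<Psi> p g) / of_nat (card (fst p))"

abbreviation class_rep :: "'e set \<Rightarrow> 'e" where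
  "class_rep c \<equiv> (SOME p. p \<in> c)"

abbreviation mark_lin ::
  "('g, 'm) monoid_scheme \<Rightarrow> 'g set \<Rightarrow> (('g \<Rightarrow> 'a) \<Rightarrow> 'k::field) \<Rightarrow> (('g, 'a) pair_class \<Rightarrow>\<^sub>0 'k) \<Rightarrow> 'k" where
  "mark_lin G L \<Psi> \<equiv> lin_eval (\<lambda>c. mark G L \<Psi> (class_rep c))"

context group
begin

lemma sum_translate_right:
  assumes "a \<in> carrier G"
  shows "(\<Sum>x\<in>carrier G. f (x \<otimes> a)) = (\<Sum>x\<in>carrier G. f x)"
  using assms
  by (intro sum.reindex_bij_witness[of _ "\<lambda>x. x \<otimes> inv a" "\<lambda>x. x \<otimes> a"]) (auto simp: m_assoc)

lemma char_pairsD: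
  assumes "(U, \<phi>) \<in> char_pairs G A"
  shows "subgroup U G" "U \<subseteq> carrier G" "\<phi> \<in> carrier (hom_group (G\<lparr>carrier := U\<rparr>) A)"
    "\<phi> \<in> extensional U"
  using assms hom_groupD(3)[of \<phi> "G\<lparr>carrier := U\<rparr>" A]
  by (auto simp: char_pairs_def dest: subgroup.subset)

lemma char_pairsI:
  "subgroup U G \<Longrightarrow> \<phi> \<in> carrier (hom_group (G\<lparr>carrier := U\<rparr>) A) \<Longrightarrow> (U, \<phi>) \<in> char_pairs G A"
  by (simp add: char_pairs_def)

lemma mark_term_conj:
  assumes p: "p \<in> char_pairs G A" and L: "L \<subseteq> carrier G" and a: "a \<in> carrier G" and g: "g \<in> carrier G"
  shows "mark_term G L \<Psi> (conj_pair G a p) g = mark_term G L \<Psi> p (g \<otimes> a)"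
proof -
  obtain U \<phi> where p_eq: "p = (U, \<phi>)" by fastforce
  have U: "U \<subseteq> carrier G" using char_pairsD(2) p p_eq by blast
  have "twist G L g (twist G (conj_set G a U) a \<phi>) = twist G L (g \<otimes> a) \<phi>"
    if "L \<subseteq> conj_set G g (conj_set G a U)"
    using twist_twist[OF that conj_set_subset[OF U a] g a] .
  then show ?thesis
    by (simp add: mark_term_def p_eq conj_pair_eq conj_set_mult[OF U g a])
qed

lemma mark_conj:
  assumes p: "p \<in> char_pairs G A" and L: "L \<subseteq> carrier G" and a: "a \<in> carrier G"
  shows "mark G L \<Psi> (conj_pair G a p) = mark G L \<Psi> p"
proof -
  obtain U \<phi> where p_eq: "p = (U, \<phi>)" by fastforce
  have "card (fst (conj_pair G a p)) = card (fst p)"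
    using card_conj_set[OF char_pairsD(2)[OF p[unfolded p_eq]] a] by (simp add: p_eq conj_pair_eq)
  moreover have "(\<Sum>g\<in>carrier G. mark_term G L \<Psi> (conj_pair G a p) g) = (\<Sum>g\<in>carrier G. mark_term G L \<Psi> p g)"
    unfolding sum_translate_right[OF a, of "mark_term G L \<Psi> p", symmetric]
    by (intro sum.cong refl mark_term_conj[OF p L a])
  ultimately show ?thesis by (simp add: mark_def)
qed

lemma class_rep_orbit:
  assumes p: "p \<in> char_pairs G A"
  defines "c \<equiv> orbit G (conj_pair G) p"
  shows "\<exists>g\<in>carrier G. class_rep c = conj_pair G g p"
    and "class_rep c \<in> char_pairs G A" and "orbit G (conj_pair G) (class_rep c) = c"
proof -
  have "class_rep c \<in> c"
    using orbit_refl[OF acts_conj_pair p] unfolding c_def by (rule someI)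
  then show "\<exists>g\<in>carrier G. class_rep c = conj_pair G g p"
    and "class_rep c \<in> char_pairs G A" and "orbit G (conj_pair G) (class_rep c) = c"
    using orbit_closed[OF acts_conj_pair p] orbit_eq[OF acts_conj_pair p]
    unfolding c_def by (auto simp: orbit_def)
qed

lemma mark_class_rep:
  assumes p: "p \<in> char_pairs G A" and L: "L \<subseteq> carrier G"
  shows "mark G L \<Psi> (class_rep (orbit G (conj_pair G) p)) = mark G L \<Psi> p"
  using class_rep_orbit(1)[OF p] mark_conj[OF p L] by metis

lemma burnside_keys:
  assumes "x \<in> burnside G A" "c \<in> Poly_Mapping.keys x"
  shows "class_rep c \<in> char_pairs G A" "orbit G (conj_pair G) (class_rep c) = c"
proof -
  obtain p where "p \<in> char_pairs G A" "c = orbit G (conj_pair G) p"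
    using assms by (auto simp: burnside_def orbits_def)
  then show "class_rep c \<in> char_pairs G A" "orbit G (conj_pair G) (class_rep c) = c"
    using class_rep_orbit(2,3) by blast+
qed

lemma conj_set_restrict:
  assumes "subgroup H G" "h \<in> H"
  shows "conj_set (G\<lparr>carrier := H\<rparr>) h U = conj_set G h U"
  using m_inv_consistent[OF assms] by (simp add: conj_set_def)

lemma twist_restrict:
  assumes "subgroup H G" "h \<in> H"
  shows "twist (G\<lparr>carrier := H\<rparr>) L h \<phi> = twist G L h \<phi>"
  using m_inv_consistent[OF assms] by (simp add: twist_def)

lemma conj_pair_restrict:
  assumes "subgroup H G" "h \<in> H"
  shows "conj_pair (G\<lparr>carrier := H\<rparr>) h p = conj_pair G h p"
proof -
  interpret H: group "G\<lparr>carrier := H\<rparr>" using assms(1) by (rule subgroup_imp_group)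
  obtain U \<phi> where "p = (U, \<phi>)" by fastforce
  then show ?thesis
    using conj_set_restrict[OF assms] twist_restrict[OF assms] by (simp add: conj_pair_eq H.conj_pair_eq)
qed

lemma subgroup_restrict_iff:
  assumes "subgroup H G"
  shows "subgroup L (G\<lparr>carrier := H\<rparr>) \<longleftrightarrow> subgroup L G \<and> L \<subseteq> H"
  using assms incl_subgroup[OF assms] subgroup_incl[OF _ assms]
    subgroup.subset[of L "G\<lparr>carrier := H\<rparr>"] by auto

lemma char_pairs_restrict_iff:
  assumes "subgroup H G"
  shows "(U, \<phi>) \<in> char_pairs (G\<lparr>carrier := H\<rparr>) A \<longleftrightarrow> (U, \<phi>) \<in> char_pairs G A \<and> U \<subseteq> H"
  by (auto simp: char_pairs_def subgroup_restrict_iff[OF assms])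

text \<open>
  A class whose subgroup is the whole group consists of one pair only, so the chosen representative is
  that pair.
\<close>
lemma proj_class:
  assumes "comm_group A" "(W, \<chi>) \<in> char_pairs G A"
  shows "lin_eval \<Psi> (let (U, \<phi>) = class_rep (pair_class G W \<chi>) in
      if U = carrier G then Poly_Mapping.single \<phi> 1 else 0) = (if W = carrier G then \<Psi> \<chi> else 0)"
proof -
  obtain g where g: "g \<in> carrier G" and rep: "class_rep (pair_class G W \<chi>) = conj_pair G g (W, \<chi>)"
    using class_rep_orbit(1)[OF assms(2)] by blast
  note W = char_pairsD[OF assms(2)]
  have "conj_set G g (carrier G) = carrier G"
    using conj_set_subgroup[OF subgroup_self g] .
  then have iff: "conj_set G g W = carrier G \<longleftrightarrow> W = carrier G"
    using conj_set_inv_cancel(1)[OF W(2) g] conj_set_inv_cancel(1)[OF order_refl g] by metis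
  show ?thesis
  proof (cases "W = carrier G")
    case True
    have "twist G W g \<chi> = \<chi>"
      using twist_inner[OF assms(1) W(1) _ W(3)] g True by simp
    moreover have "conj_set G g W = carrier G" using iff True by simp
    ultimately have "conj_pair G g (W, \<chi>) = (carrier G, \<chi>)" using True by (simp add: conj_pair_eq)
    then show ?thesis unfolding rep using True by simp
  next
    case False
    then show ?thesis unfolding rep using iff by (simp add: conj_pair_eq)
  qed
qed

lemma subgroup_Int_conj:
  "subgroup H G \<Longrightarrow> subgroup U G \<Longrightarrow> g \<in> carrier G \<Longrightarrow> subgroup (H \<inter> conj_set G g U) G"
  by (intro subgroups_Inter_pair subgroup_conj_set)

lemma Int_conj_double_coset:
  assumes H: "subgroup H G" and U: "subgroup U G" and h: "h \<in> H" and g: "g \<in> carrier G" and u: "u \<in> U"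
  shows "H \<inter> conj_set G (h \<otimes> g \<otimes> u) U = conj_set G h (H \<inter> conj_set G g U)"
proof -
  have c: "H \<subseteq> carrier G" "U \<subseteq> carrier G" using H U by (auto dest: subgroup.subset)
  have hu: "h \<in> carrier G" "u \<in> carrier G" using c h u by auto
  have "conj_set G (h \<otimes> g \<otimes> u) U = conj_set G h (conj_set G g (conj_set G u U))"
    using c hu g by (simp add: conj_set_mult conj_set_subset)
  also have "\<dots> = conj_set G h (conj_set G g U)" by (simp add: conj_set_subgroup[OF U u])
  finally show ?thesis
    using conj_set_Int[OF c(1) conj_set_subset[OF c(2) g] hu(1)] conj_set_subgroup[OF H h] by simp
qed

lemma twist_mult_right:
  assumes A: "comm_group A" and p: "(U, \<phi>) \<in> char_pairs G A" and g: "g \<in> carrier G" and u: "u \<in> U"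
    and L: "L \<subseteq> conj_set G g U"
  shows "twist G L (g \<otimes> u) \<phi> = twist G L g \<phi>"
proof -
  note U = char_pairsD[OF p]
  have "twist G L (g \<otimes> u) \<phi> = twist G L g (twist G U u \<phi>)"
    using twist_twist[OF L U(2) g, of u \<phi>] u U(2) by auto
  then show ?thesis by (simp add: twist_inner[OF A U(1) u U(3)])
qed

text \<open>
  The pair attached to \<open>g\<close> in the restriction formula changes, within the double coset \<open>HgU\<close>, only by conjugation with
  elements of \<open>H\<close>. Thus every function of its \<open>H\<close>-class is constant on double cosets, as the weighting formula requires.
\<close>
lemma conj_pair_double_coset:
  assumes A: "comm_group A" and H: "subgroup H G" and p: "(U, \<phi>) \<in> char_pairs G A"
    and h: "h \<in> H" and g: "g \<in> carrier G" and u: "u \<in> U"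
  defines "W \<equiv> \<lambda>g. H \<inter> conj_set G g U"
  shows "(W (h \<otimes> g \<otimes> u), twist G (W (h \<otimes> g \<otimes> u)) (h \<otimes> g \<otimes> u) \<phi>) =
    conj_pair G h (W g, twist G (W g) g \<phi>)"
proof -
  note U = char_pairsD[OF p]
  have hG: "h \<in> carrier G" using H h by (rule subgroup.mem_carrier)
  have W: "W (h \<otimes> g \<otimes> u) = conj_set G h (W g)"
    unfolding W_def by (rule Int_conj_double_coset[OF H U(1) h g u])
  have Wg: "W g \<subseteq> carrier G" unfolding W_def using H by (auto dest: subgroup.subset)
  have sub: "conj_set G h (W g) \<subseteq> conj_set G (h \<otimes> g) U"
    unfolding conj_set_mult[OF U(2) hG g] by (rule conj_set_mono) (simp add: W_def)
  have "twist G (W (h \<otimes> g \<otimes> u)) (h \<otimes> g \<otimes> u) \<phi> = twist G (conj_set G h (W g)) (h \<otimes> g) \<phi>"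
    unfolding W using hG g by (intro twist_mult_right[OF A p _ u sub]) simp
  also have "\<dots> = twist G (conj_set G h (W g)) h (twist G (W g) g \<phi>)"
    by (rule twist_twist[OF order_refl Wg hG g, symmetric])
  finally show ?thesis by (simp add: W conj_pair_eq)
qed

lemma Int_conj_in_char_pairs:
  assumes H: "subgroup H G" and p: "(U, \<phi>) \<in> char_pairs G A" and g: "g \<in> carrier G"
  shows "(H \<inter> conj_set G g U, twist G (H \<inter> conj_set G g U) g \<phi>) \<in> char_pairs G A"
proof -
  note U = char_pairsD[OF p]
  show ?thesis
    using subgroup_Int_conj[OF H U(1) g] twist_in_hom_group[OF U(1) _ g _ U(3)]
    by (intro char_pairsI) auto
qed

lemma double_coset_reps_subset:
  assumes "subgroup H G" "subgroup U G"
  shows "double_coset_reps G H U \<subseteq> carrier G"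
proof
  fix g assume "g \<in> double_coset_reps G H U"
  then obtain a where a: "a \<in> carrier G" "g = class_rep (H #> a <#> U)"
    by (auto simp: double_coset_reps_def)
  have "H #> a <#> U \<subseteq> carrier G"
    using assms[THEN subgroup.subset] a(1) by (intro set_mult_closed r_coset_subset_G)
  moreover have "\<one> \<otimes> a \<otimes> \<one> \<in> H #> a <#> U"
    using assms[THEN subgroup.one_closed] unfolding set_mult_def r_coset_def by blast
  ultimately show "g \<in> carrier G" unfolding a(2) by (metis someI subsetD)
qed

text \<open>
  Only double cosets of those \<open>g\<close> with \<open>L \<subseteq> gUg\<^sup>-\<^sup>1\<close> survive the projection. For them \<open>|L \<inter> gUg\<^sup>-\<^sup>1| = |L|\<close>, so
  the weight \<open>|L| / (|L||U|)\<close> becomes \<open>1 / |U|\<close>.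
\<close>
lemma species_eq_mark:
  fixes \<Psi> :: "('a \<Rightarrow> 'c) \<Rightarrow> 'k::field_char_0"
  assumes fin: "finite (carrier G)" and A: "comm_group A" and L: "subgroup L G"
    and x: "x \<in> burnside G A"
  shows "species G (L, \<Psi>) x = mark_lin G L \<Psi> x"
proof -
  interpret L: group "G\<lparr>carrier := L\<rparr>" using L by (rule subgroup_imp_group)
  have L_sub: "L \<subseteq> carrier G" using L by (rule subgroup.subset)
  have "species G (L, \<Psi>) x = lin_eval \<Psi> (proj (G\<lparr>carrier := L\<rparr>) (res G L x))"
    by (simp add: species_def lin_char_def lin_eval_def)
  also have "\<dots> = mark_lin G L \<Psi> x"
    unfolding proj_def res_def lin_eval_lin_ext
  proof (rule lin_eval_cong)
    fix c assume "c \<in> Poly_Mapping.keys x"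
    then have rep: "class_rep c \<in> char_pairs G A" using burnside_keys(1)[OF x] by blast
    obtain U \<phi> where U\<phi>: "class_rep c = (U, \<phi>)" by fastforce
    have p: "(U, \<phi>) \<in> char_pairs G A" using rep U\<phi> by simp
    note U = char_pairsD[OF p]
    let ?pr = "\<lambda>c. let (U, \<phi>) = class_rep c in
        if U = carrier (G\<lparr>carrier := L\<rparr>) then Poly_Mapping.single \<phi> 1 else 0"
    let ?W = "\<lambda>g. L \<inter> conj_set G g U"
    have pr_term: "lin_eval \<Psi> (?pr (pair_class (G\<lparr>carrier := L\<rparr>) (?W g) (restrict (conj_hom G g U \<phi>) (?W g)))) =
        mark_term G L \<Psi> (U, \<phi>) g" if g: "g \<in> carrier G" for g
    proof -
      have tw: "restrict (conj_hom G g U \<phi>) (?W g) = twist G (?W g) g \<phi>"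
        by (rule restrict_conj_hom) simp
      have "(?W g, twist G (?W g) g \<phi>) \<in> char_pairs (G\<lparr>carrier := L\<rparr>) A"
        using Int_conj_in_char_pairs[OF L p g] by (simp add: char_pairs_restrict_iff[OF L])
      then have "lin_eval \<Psi> (?pr (pair_class (G\<lparr>carrier := L\<rparr>) (?W g) (twist G (?W g) g \<phi>))) =
          (if ?W g = L then \<Psi> (twist G (?W g) g \<phi>) else 0)"
        using L.proj_class[OF A, of "?W g" "twist G (?W g) g \<phi>" \<Psi>] by simp
      also have "\<dots> = mark_term G L \<Psi> (U, \<phi>) g"
        by (simp add: mark_term_def inf.absorb_iff1)
      finally show ?thesis unfolding tw .
    qed
    note reps = double_coset_reps_subset[OF L U(1)]
    have const: "mark_term G L \<Psi> (U, \<phi>) (l \<otimes> g \<otimes> u) = mark_term G L \<Psi> (U, \<phi>) g"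
      if l: "l \<in> L" and g: "g \<in> carrier G" and u: "u \<in> U" for l g u
    proof -
      have lG: "l \<in> carrier G" using l L_sub by blast
      have eq: "(?W (l \<otimes> g \<otimes> u), twist G (?W (l \<otimes> g \<otimes> u)) (l \<otimes> g \<otimes> u) \<phi>) =
          (conj_set G l (?W g), twist G (conj_set G l (?W g)) l (twist G (?W g) g \<phi>))"
        using conj_pair_double_coset[OF A L p l g u] unfolding conj_pair_eq .
      have iff: "L \<subseteq> conj_set G y U \<longleftrightarrow> ?W y = L" for y by blast
      have Wg: "?W g \<subseteq> carrier G" using L_sub by blast
      show ?thesis
      proof (cases "?W g = L")
        case True
        have tL: "twist G L g \<phi> \<in> carrier (hom_group (G\<lparr>carrier := L\<rparr>) A)"
          using char_pairsD(3)[OF Int_conj_in_char_pairs[OF L p g]] True by simp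
        have "?W (l \<otimes> g \<otimes> u) = L" using eq True conj_set_subgroup[OF L l] by simp
        moreover have "twist G L (l \<otimes> g \<otimes> u) \<phi> = twist G L g \<phi>"
          using eq True calculation twist_inner[OF A L l tL] conj_set_subgroup[OF L l] by simp
        ultimately show ?thesis using True by (simp add: mark_term_def iff)
      next
        case False
        have "conj_set G l (?W g) \<noteq> L"
        proof
          assume "conj_set G l (?W g) = L"
          then have "conj_set G (inv l) (conj_set G l (?W g)) = conj_set G (inv l) L" by simp
          also have "\<dots> = L" using conj_set_subgroup[OF L, of "inv l"] subgroup.m_inv_closed[OF L l] by simp
          finally show False using conj_set_inv_cancel(1)[OF Wg lG] False by simp
        qed
        then show ?thesis using False eq by (simp add: mark_term_def iff)
      qed
    qed
    have "lin_eval (\<lambda>b. lin_eval \<Psi> (?pr b)) (let (U, \<phi>) = class_rep c in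
        \<Sum>g\<in>double_coset_reps G L U. let W = L \<inter> conj_set G g U in
          Poly_Mapping.single (pair_class (G\<lparr>carrier := L\<rparr>) W (restrict (conj_hom G g U \<phi>) W)) 1) =
        (\<Sum>g\<in>double_coset_reps G L U. mark_term G L \<Psi> (U, \<phi>) g)"
      unfolding U\<phi> Let_def prod.case lin_eval_sum lin_eval_single mult_1
      using reps pr_term[unfolded Let_def] by (intro sum.cong refl) blast
    also have "\<dots> = (\<Sum>g\<in>carrier G. mark_term G L \<Psi> (U, \<phi>) g * of_nat (card (?W g))) / of_nat (card L * card U)"
      by (rule sum_double_coset_reps[OF fin L U(1) const])
    also have "(\<Sum>g\<in>carrier G. mark_term G L \<Psi> (U, \<phi>) g * of_nat (card (?W g))) =
        (\<Sum>g\<in>carrier G. mark_term G L \<Psi> (U, \<phi>) g * of_nat (card L))"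
      by (intro sum.cong refl) (auto simp: mark_term_def inf.absorb1)
    also have "\<dots> / of_nat (card L * card U) = mark G L \<Psi> (U, \<phi>)"
    proof -
      have "finite L" using fin L_sub finite_subset by blast
      then have "card L \<noteq> 0" using subgroup.one_closed[OF L] by auto
      then show ?thesis by (simp add: mark_def sum_distrib_right[symmetric])
    qed
    finally show "lin_eval (\<lambda>b. lin_eval \<Psi> (?pr b)) (let (U, \<phi>) = class_rep c in
        \<Sum>g\<in>double_coset_reps G L U. let W = L \<inter> conj_set G g U in
          Poly_Mapping.single (pair_class (G\<lparr>carrier := L\<rparr>) W (restrict (conj_hom G g U \<phi>) W)) 1) =
        mark G L \<Psi> (class_rep c)"
      unfolding U\<phi> .
  qed
  finally show ?thesis .
qed

section \<open>Restriction and multiplication\<close>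
lemma mark_term_Int_conj:
  fixes \<Psi> :: "('a \<Rightarrow> 'c) \<Rightarrow> 'k::field_char_0"
  assumes H: "subgroup H G" and L: "L \<subseteq> H" and p: "(U, \<phi>) \<in> char_pairs G A" and g: "g \<in> carrier G"
    and h: "h \<in> H"
  defines "W \<equiv> H \<inter> conj_set G g U"
  shows "mark_term (G\<lparr>carrier := H\<rparr>) L \<Psi> (W, twist G W g \<phi>) h = mark_term G L \<Psi> (U, \<phi>) (h \<otimes> g)"
proof -
  note U = char_pairsD[OF p]
  have H_sub: "H \<subseteq> carrier G" using H by (rule subgroup.subset)
  have hG: "h \<in> carrier G" using H_sub h by blast
  have "conj_set G h W = H \<inter> conj_set G (h \<otimes> g) U"
    unfolding W_def conj_set_Int[OF H_sub conj_set_subset[OF U(2) g] hG]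
    by (simp add: conj_set_subgroup[OF H h] conj_set_mult[OF U(2) hG g])
  then have iff: "L \<subseteq> conj_set G h W \<longleftrightarrow> L \<subseteq> conj_set G (h \<otimes> g) U" using L by blast
  have "W \<subseteq> carrier G" using H_sub by (auto simp: W_def)
  then have tw: "twist G L h (twist G W g \<phi>) = twist G L (h \<otimes> g) \<phi>" if "L \<subseteq> conj_set G h W"
    using twist_twist[OF that _ hG g] by blast
  show ?thesis
    using iff tw by (simp add: mark_term_def conj_set_restrict[OF H h] twist_restrict[OF H h])
qed

text \<open>
  The weight \<open>|H \<inter> gUg\<^sup>-\<^sup>1|\<close> cancels the denominator of the mark in \<open>H\<close>. What remains is
  the double sum over \<open>h \<in> H\<close> and \<open>g \<in> G\<close> of the terms at \<open>hg\<close>, and translating \<open>g\<close> by \<open>h\<close> leaves \<open>|H|\<close> times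
  the sum that defines the mark in \<open>G\<close>.
\<close>
lemma mark_res:
  fixes \<Psi> :: "('a \<Rightarrow> 'c) \<Rightarrow> 'k::field_char_0"
  assumes fin: "finite (carrier G)" and A: "comm_group A" and H: "subgroup H G" and L: "L \<subseteq> H"
    and x: "x \<in> burnside G A"
  shows "mark_lin (G\<lparr>carrier := H\<rparr>) L \<Psi> (res G H x) = mark_lin G L \<Psi> x"
  unfolding res_def lin_eval_lin_ext
proof (rule lin_eval_cong)
  interpret H: group "G\<lparr>carrier := H\<rparr>" using H by (rule subgroup_imp_group)
  have H_sub: "H \<subseteq> carrier G" using H by (rule subgroup.subset)
  have finH: "finite H" using fin H_sub finite_subset by blast
  fix c assume "c \<in> Poly_Mapping.keys x"
  then have rep: "class_rep c \<in> char_pairs G A" using burnside_keys(1)[OF x] by blast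
  obtain U \<phi> where U\<phi>: "class_rep c = (U, \<phi>)" by fastforce
  have p: "(U, \<phi>) \<in> char_pairs G A" using rep U\<phi> by simp
  note U = char_pairsD[OF p]
  define W where "W g = H \<inter> conj_set G g U" for g
  let ?p = "\<lambda>g. (W g, twist G (W g) g \<phi>)"
  let ?F = "\<lambda>g. mark (G\<lparr>carrier := H\<rparr>) L \<Psi> (?p g)"
  have pW: "?p g \<in> char_pairs (G\<lparr>carrier := H\<rparr>) A" if g: "g \<in> carrier G" for g
    using Int_conj_in_char_pairs[OF H p g] unfolding char_pairs_restrict_iff[OF H] W_def by simp
  have LH: "L \<subseteq> carrier (G\<lparr>carrier := H\<rparr>)" using L by simp
  have val: "mark_lin (G\<lparr>carrier := H\<rparr>) L \<Psi>
      (Poly_Mapping.single (pair_class (G\<lparr>carrier := H\<rparr>) (W g) (restrict (conj_hom G g U \<phi>) (W g))) 1) = ?F g"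
    if g: "g \<in> carrier G" for g
  proof -
    have tw: "restrict (conj_hom G g U \<phi>) (W g) = twist G (W g) g \<phi>"
      by (rule restrict_conj_hom) (simp add: W_def)
    show ?thesis unfolding tw using H.mark_class_rep[OF pW[OF g] LH] by simp
  qed
  have const: "?F (h \<otimes> g \<otimes> u) = ?F g" if h: "h \<in> H" and g: "g \<in> carrier G" and u: "u \<in> U" for h g u
  proof -
    have "?p (h \<otimes> g \<otimes> u) = conj_pair (G\<lparr>carrier := H\<rparr>) h (?p g)"
      unfolding conj_pair_restrict[OF H h] W_def by (rule conj_pair_double_coset[OF A H p h g u])
    then show ?thesis using H.mark_conj[OF pW[OF g] LH, of h \<Psi>] h by simp
  qed
  have F_sum: "?F g * of_nat (card (H \<inter> conj_set G g U)) = (\<Sum>h\<in>H. mark_term G L \<Psi> (U, \<phi>) (h \<otimes> g))"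
    if g: "g \<in> carrier G" for g
  proof -
    have "finite (W g)" using finH by (simp add: W_def)
    moreover have "W g \<noteq> {}"
      using char_pairsD(1)[OF Int_conj_in_char_pairs[OF H p g]] subgroup.one_closed unfolding W_def by blast
    ultimately have "card (W g) \<noteq> 0" by simp
    moreover have "(\<Sum>h\<in>H. mark_term (G\<lparr>carrier := H\<rparr>) L \<Psi> (?p g) h) = (\<Sum>h\<in>H. mark_term G L \<Psi> (U, \<phi>) (h \<otimes> g))"
      unfolding W_def by (intro sum.cong refl mark_term_Int_conj[OF H L p g])
    ultimately show ?thesis by (simp add: mark_def W_def)
  qed
  have "lin_eval (\<lambda>b. mark (G\<lparr>carrier := H\<rparr>) L \<Psi> (class_rep b)) (let (U, \<phi>) = class_rep c in
      \<Sum>g\<in>double_coset_reps G H U. let W = H \<inter> conj_set G g U in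
        Poly_Mapping.single (pair_class (G\<lparr>carrier := H\<rparr>) W (restrict (conj_hom G g U \<phi>) W)) 1) =
      (\<Sum>g\<in>double_coset_reps G H U. ?F g)"
    unfolding U\<phi> Let_def prod.case lin_eval_sum[of _ _ "double_coset_reps G H U"]
    using double_coset_reps_subset[OF H U(1)] val[unfolded W_def] unfolding W_def
    by (intro sum.cong refl) blast
  also have "\<dots> = (\<Sum>g\<in>carrier G. ?F g * of_nat (card (H \<inter> conj_set G g U))) / of_nat (card H * card U)"
    by (rule sum_double_coset_reps[OF fin H U(1) const])
  also have "(\<Sum>g\<in>carrier G. ?F g * of_nat (card (H \<inter> conj_set G g U))) =
      (\<Sum>g\<in>carrier G. \<Sum>h\<in>H. mark_term G L \<Psi> (U, \<phi>) (h \<otimes> g))"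
    by (intro sum.cong refl F_sum)
  also have "\<dots> = (\<Sum>h\<in>H. \<Sum>g\<in>carrier G. mark_term G L \<Psi> (U, \<phi>) (h \<otimes> g))"
    by (rule sum.swap)
  also have "\<dots> = (\<Sum>h\<in>H. \<Sum>g\<in>carrier G. mark_term G L \<Psi> (U, \<phi>) g)"
    using H_sub by (intro sum.cong refl sum_translate) auto
  also have "\<dots> / of_nat (card H * card U) = mark G L \<Psi> (U, \<phi>)"
  proof -
    have "card H \<noteq> 0" using subgroup.one_closed[OF H] finH by auto
    then show ?thesis by (simp add: mark_def)
  qed
  finally show "lin_eval (\<lambda>b. mark (G\<lparr>carrier := H\<rparr>) L \<Psi> (class_rep b)) (let (U, \<phi>) = class_rep c in
      \<Sum>g\<in>double_coset_reps G H U. let W = H \<inter> conj_set G g U in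
        Poly_Mapping.single (pair_class (G\<lparr>carrier := H\<rparr>) W (restrict (conj_hom G g U \<phi>) W)) 1) =
      mark G L \<Psi> (class_rep c)"
    unfolding U\<phi> .
qed

lemma res_in_burnside:
  assumes H: "subgroup H G" and x: "x \<in> burnside G A"
  shows "res G H x \<in> burnside (G\<lparr>carrier := H\<rparr>) A"
  unfolding burnside_def res_def
proof (intro CollectI keys_lin_ext_subset)
  fix c assume "c \<in> Poly_Mapping.keys x"
  then have rep: "class_rep c \<in> char_pairs G A" using burnside_keys(1)[OF x] by blast
  obtain U \<phi> where U\<phi>: "class_rep c = (U, \<phi>)" by fastforce
  have p: "(U, \<phi>) \<in> char_pairs G A" using rep U\<phi> by simp
  show "Poly_Mapping.keys (let (U, \<phi>) = class_rep c in
      \<Sum>g\<in>double_coset_reps G H U. let W = H \<inter> conj_set G g U in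
        Poly_Mapping.single (pair_class (G\<lparr>carrier := H\<rparr>) W (restrict (conj_hom G g U \<phi>) W)) 1)
      \<subseteq> orbits (G\<lparr>carrier := H\<rparr>) (char_pairs (G\<lparr>carrier := H\<rparr>) A) (conj_pair (G\<lparr>carrier := H\<rparr>))"
    unfolding U\<phi> Let_def prod.case
  proof (rule keys_sum_subset)
    fix g assume "g \<in> double_coset_reps G H U"
    then have g: "g \<in> carrier G" using double_coset_reps_subset[OF H char_pairsD(1)[OF p]] by blast
    let ?W = "H \<inter> conj_set G g U"
    have tw: "restrict (conj_hom G g U \<phi>) ?W = twist G ?W g \<phi>" by (rule restrict_conj_hom) simp
    have "(?W, twist G ?W g \<phi>) \<in> char_pairs (G\<lparr>carrier := H\<rparr>) A"
      using Int_conj_in_char_pairs[OF H p g] by (simp add: char_pairs_restrict_iff[OF H])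
    then show "Poly_Mapping.keys (Poly_Mapping.single
        (pair_class (G\<lparr>carrier := H\<rparr>) ?W (restrict (conj_hom G g U \<phi>) ?W)) 1)
        \<subseteq> orbits (G\<lparr>carrier := H\<rparr>) (char_pairs (G\<lparr>carrier := H\<rparr>) A) (conj_pair (G\<lparr>carrier := H\<rparr>))"
      unfolding tw orbits_def by auto
  qed
qed

text \<open>
  The pair attached to \<open>g\<close> in the product formula, and its independence, up to conjugation, of the choice of \<open>g\<close> in the
  double coset. Restricting \<open>\<phi>\<close> is written as conjugation by \<open>\<one>\<close>, so that the rules for \<open>twist\<close> apply to both factors.
\<close>
lemma product_pair:
  assumes A: "comm_group A" and p: "(U, \<phi>) \<in> char_pairs G A" and q: "(V, \<psi>) \<in> char_pairs G A"
    and g: "g \<in> carrier G"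
  defines "W \<equiv> \<lambda>g. U \<inter> conj_set G g V"
  defines "P \<equiv> \<lambda>g. twist G (W g) \<one> \<phi> \<otimes>\<^bsub>hom_group (G\<lparr>carrier := W g\<rparr>) A\<^esub> twist G (W g) g \<psi>"
  shows "(W g, P g) \<in> char_pairs G A"
    and "u \<in> U \<Longrightarrow> v \<in> V \<Longrightarrow> (W (u \<otimes> g \<otimes> v), P (u \<otimes> g \<otimes> v)) = conj_pair G u (W g, P g)"
proof -
  note U = char_pairsD[OF p] and V = char_pairsD[OF q]
  have W: "subgroup (W g) G" unfolding W_def by (rule subgroup_Int_conj[OF U(1) V(1) g])
  interpret W: group "G\<lparr>carrier := W g\<rparr>" using W by (rule subgroup_imp_group)
  interpret D: comm_group "hom_group (G\<lparr>carrier := W g\<rparr>) A"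
    using W.group_axioms A by (rule comm_group_hom_group)
  have "P g \<in> carrier (hom_group (G\<lparr>carrier := W g\<rparr>) A)"
    unfolding P_def
  proof (rule D.m_closed)
    show "twist G (W g) \<one> \<phi> \<in> carrier (hom_group (G\<lparr>carrier := W g\<rparr>) A)"
      by (rule twist_in_hom_group[OF U(1) W one_closed _ U(3)]) (simp add: conj_set_one[OF U(2)] W_def)
    show "twist G (W g) g \<psi> \<in> carrier (hom_group (G\<lparr>carrier := W g\<rparr>) A)"
      by (rule twist_in_hom_group[OF V(1) W g _ V(3)]) (simp add: W_def)
  qed
  then show "(W g, P g) \<in> char_pairs G A" using W by (rule char_pairsI[rotated])
  assume u: "u \<in> U" and v: "v \<in> V"
  have uG: "u \<in> carrier G" using u U(2) by blast
  have W_eq: "W (u \<otimes> g \<otimes> v) = conj_set G u (W g)"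
    unfolding W_def by (rule Int_conj_double_coset[OF U(1) V(1) u g v])
  have Wg: "W g \<subseteq> carrier G" using U(2) by (auto simp: W_def)
  let ?W = "conj_set G u (W g)"
  have "?W \<subseteq> conj_set G u U" by (rule conj_set_mono) (simp add: W_def)
  then have WU: "?W \<subseteq> U" by (simp add: conj_set_subgroup[OF U(1) u])
  have "twist G ?W u (twist G (W g) \<one> \<phi>) = twist G ?W (\<one> \<otimes> u) \<phi>"
    using twist_twist[OF order_refl Wg uG one_closed] uG by simp
  also have "\<dots> = twist G ?W \<one> \<phi>"
    by (rule twist_mult_right[OF A p one_closed u]) (simp add: conj_set_one[OF U(2)] WU)
  finally have 1: "twist G ?W u (twist G (W g) \<one> \<phi>) = twist G ?W \<one> \<phi>" .
  have "(W (u \<otimes> g \<otimes> v), twist G (W (u \<otimes> g \<otimes> v)) (u \<otimes> g \<otimes> v) \<psi>) = conj_pair G u (W g, twist G (W g) g \<psi>)"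
    unfolding W_def by (rule conj_pair_double_coset[OF A U(1) q u g v])
  then have 2: "twist G ?W u (twist G (W g) g \<psi>) = twist G ?W (u \<otimes> g \<otimes> v) \<psi>"
    by (simp add: conj_pair_eq W_eq)
  have "twist G ?W u (P g) = P (u \<otimes> g \<otimes> v)"
    unfolding P_def W_eq twist_mult[OF order_refl Wg uG] 1 2 ..
  then show "(W (u \<otimes> g \<otimes> v), P (u \<otimes> g \<otimes> v)) = conj_pair G u (W g, P g)"
    by (simp add: conj_pair_eq W_eq)
qed

text \<open>
  Since \<open>L\<close> lies in the conjugate by \<open>h\<close> of \<open>U \<inter> gVg\<^sup>-\<^sup>1\<close> exactly if it lies in those of \<open>U\<close> by \<open>h\<close> and of \<open>V\<close> by \<open>hg\<close>,
  each term at \<open>(g, h)\<close> is the product of the term of the first factor at \<open>h\<close> and that of the second at \<open>hg\<close>.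
  The double sum then factors after translation by \<open>h\<close>.
\<close>
lemma mark_burnside_mult:
  fixes \<Psi> :: "('a \<Rightarrow> 'c) \<Rightarrow> 'k::field_char_0"
  assumes fin: "finite (carrier G)" and A: "comm_group A" and L: "subgroup L G"
    and \<Psi>: "\<Psi> \<in> carrier (hom_group (hom_group (G\<lparr>carrier := L\<rparr>) A) field_units)"
    and x: "x \<in> burnside G A" and y: "y \<in> burnside G A"
  shows "mark_lin G L \<Psi> (burnside_mult G A x y) = mark_lin G L \<Psi> x * mark_lin G L \<Psi> y"
proof -
  have L_sub: "L \<subseteq> carrier G" using L by (rule subgroup.subset)
  have key: "mark_lin G L \<Psi> (let (U, \<phi>) = class_rep c; (V, \<psi>) = class_rep d in
      \<Sum>g\<in>double_coset_reps G U V. let W = U \<inter> conj_set G g V in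
        Poly_Mapping.single (pair_class G W (restrict \<phi> W \<otimes>\<^bsub>hom_group (G\<lparr>carrier := W\<rparr>) A\<^esub>
          restrict (conj_hom G g V \<psi>) W)) 1) = mark G L \<Psi> (class_rep c) * mark G L \<Psi> (class_rep d)"
    if cd: "class_rep c \<in> char_pairs G A" "class_rep d \<in> char_pairs G A" for c d
  proof -
    obtain U \<phi> V \<psi> where c: "class_rep c = (U, \<phi>)" and d: "class_rep d = (V, \<psi>)" by fastforce
    have p: "(U, \<phi>) \<in> char_pairs G A" and q: "(V, \<psi>) \<in> char_pairs G A" using cd c d by simp_all
    note U = char_pairsD[OF p] and V = char_pairsD[OF q]
    define W where "W g = U \<inter> conj_set G g V" for g
    define P where "P g = twist G (W g) \<one> \<phi> \<otimes>\<^bsub>hom_group (G\<lparr>carrier := W g\<rparr>) A\<^esub> twist G (W g) g \<psi>" for g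
    have WP: "(W g, P g) \<in> char_pairs G A" if "g \<in> carrier G" for g
      unfolding P_def W_def by (rule product_pair(1)[OF A p q that])
    let ?F = "\<lambda>g. mark G L \<Psi> (W g, P g)"
    have const: "?F (u \<otimes> g \<otimes> v) = ?F g" if u: "u \<in> U" and g: "g \<in> carrier G" and v: "v \<in> V" for u g v
    proof -
      have "(W (u \<otimes> g \<otimes> v), P (u \<otimes> g \<otimes> v)) = conj_pair G u (W g, P g)"
        unfolding P_def W_def by (rule product_pair(2)[OF A p q g u v])
      then show ?thesis using mark_conj[OF WP[OF g] L_sub, of u \<Psi>] u U(2) by auto
    qed
    have val: "mark_lin G L \<Psi> (Poly_Mapping.single (pair_class G (W g)
          (restrict \<phi> (W g) \<otimes>\<^bsub>hom_group (G\<lparr>carrier := W g\<rparr>) A\<^esub> restrict (conj_hom G g V \<psi>) (W g))) 1) = ?F g"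
      if g: "g \<in> carrier G" for g
    proof -
      have "restrict \<phi> (W g) = twist G (W g) \<one> \<phi>"
        using U(2) by (auto simp: twist_def restrict_def fun_eq_iff W_def subsetD)
      moreover have "restrict (conj_hom G g V \<psi>) (W g) = twist G (W g) g \<psi>"
        by (rule restrict_conj_hom) (simp add: W_def)
      ultimately show ?thesis
        using mark_class_rep[OF WP[OF g] L_sub] by (simp add: P_def)
    qed
    have mterm: "mark_term G L \<Psi> (W g, P g) h =
        mark_term G L \<Psi> (U, \<phi>) h * mark_term G L \<Psi> (V, \<psi>) (h \<otimes> g)"
      if g: "g \<in> carrier G" and h: "h \<in> carrier G" for g h
    proof -
      have "conj_set G h (W g) = conj_set G h U \<inter> conj_set G (h \<otimes> g) V"
        unfolding W_def conj_set_Int[OF U(2) conj_set_subset[OF V(2) g] h] conj_set_mult[OF V(2) h g] ..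
      then have iff: "L \<subseteq> conj_set G h (W g) \<longleftrightarrow> L \<subseteq> conj_set G h U \<and> L \<subseteq> conj_set G (h \<otimes> g) V" by blast
      have "\<Psi> (twist G L h (P g)) = \<Psi> (twist G L h \<phi>) * \<Psi> (twist G L (h \<otimes> g) \<psi>)"
        if sub: "L \<subseteq> conj_set G h (W g)"
      proof -
        have Wg: "W g \<subseteq> carrier G" using U(2) by (auto simp: W_def)
        have "twist G L h (P g) = twist G L h \<phi> \<otimes>\<^bsub>hom_group (G\<lparr>carrier := L\<rparr>) A\<^esub> twist G L (h \<otimes> g) \<psi>"
          unfolding P_def twist_mult[OF sub Wg h] twist_twist[OF sub Wg h g] twist_twist[OF sub Wg h one_closed]
          using h by simp
        moreover have "twist G L h \<phi> \<in> carrier (hom_group (G\<lparr>carrier := L\<rparr>) A)"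
          using iff sub by (intro twist_in_hom_group[OF U(1) L h _ U(3)]) blast
        moreover have "twist G L (h \<otimes> g) \<psi> \<in> carrier (hom_group (G\<lparr>carrier := L\<rparr>) A)"
          using iff sub h g by (intro twist_in_hom_group[OF V(1) L _ _ V(3)]) auto
        ultimately show ?thesis using characterD(2)[OF \<Psi>] by simp
      qed
      then show ?thesis using iff by (auto simp: mark_term_def)
    qed
    have F_sum: "?F g * of_nat (card (U \<inter> conj_set G g V)) =
        (\<Sum>h\<in>carrier G. mark_term G L \<Psi> (U, \<phi>) h * mark_term G L \<Psi> (V, \<psi>) (h \<otimes> g))"
      if g: "g \<in> carrier G" for g
    proof -
      have "finite (W g)" using char_pairsD(2)[OF WP[OF g]] fin finite_subset by blast
      moreover have "W g \<noteq> {}"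
        using char_pairsD(1)[OF WP[OF g]] subgroup.one_closed by blast
      ultimately have "card (W g) \<noteq> 0" by simp
      moreover have "(\<Sum>h\<in>carrier G. mark_term G L \<Psi> (W g, P g) h) =
          (\<Sum>h\<in>carrier G. mark_term G L \<Psi> (U, \<phi>) h * mark_term G L \<Psi> (V, \<psi>) (h \<otimes> g))"
        by (intro sum.cong refl mterm[OF g])
      ultimately show ?thesis by (simp add: mark_def W_def[symmetric])
    qed
    have "mark_lin G L \<Psi> (let (U, \<phi>) = class_rep c; (V, \<psi>) = class_rep d in
      \<Sum>g\<in>double_coset_reps G U V. let W = U \<inter> conj_set G g V in
        Poly_Mapping.single (pair_class G W (restrict \<phi> W \<otimes>\<^bsub>hom_group (G\<lparr>carrier := W\<rparr>) A\<^esub>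
          restrict (conj_hom G g V \<psi>) W)) 1) = (\<Sum>g\<in>double_coset_reps G U V. ?F g)"
      unfolding c d Let_def prod.case lin_eval_sum[of _ _ "double_coset_reps G U V"] W_def[symmetric]
      using double_coset_reps_subset[OF U(1) V(1)] val by (intro sum.cong refl) blast
    also have "\<dots> = (\<Sum>g\<in>carrier G. ?F g * of_nat (card (U \<inter> conj_set G g V))) / of_nat (card U * card V)"
      by (rule sum_double_coset_reps[OF fin U(1) V(1) const])
    also have "(\<Sum>g\<in>carrier G. ?F g * of_nat (card (U \<inter> conj_set G g V))) =
        (\<Sum>g\<in>carrier G. \<Sum>h\<in>carrier G. mark_term G L \<Psi> (U, \<phi>) h * mark_term G L \<Psi> (V, \<psi>) (h \<otimes> g))"
      by (intro sum.cong refl F_sum)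
    also have "\<dots> = (\<Sum>h\<in>carrier G. \<Sum>g\<in>carrier G. mark_term G L \<Psi> (U, \<phi>) h * mark_term G L \<Psi> (V, \<psi>) (h \<otimes> g))"
      by (rule sum.swap)
    also have "\<dots> = (\<Sum>h\<in>carrier G. mark_term G L \<Psi> (U, \<phi>) h * (\<Sum>g\<in>carrier G. mark_term G L \<Psi> (V, \<psi>) g))"
      by (intro sum.cong refl) (simp add: sum_distrib_left[symmetric] sum_translate)
    also have "\<dots> / of_nat (card U * card V) = mark G L \<Psi> (U, \<phi>) * mark G L \<Psi> (V, \<psi>)"
      by (simp add: mark_def sum_distrib_right)
    finally show ?thesis unfolding c d .
  qed
  have "mark_lin G L \<Psi> (burnside_mult G A x y) =
      lin_eval (\<lambda>c. lin_eval (\<lambda>d. mark G L \<Psi> (class_rep c) * mark G L \<Psi> (class_rep d)) y) x"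
    unfolding burnside_mult_def lin_eval_bilin_ext
    by (intro lin_eval_cong key burnside_keys(1)[OF x] burnside_keys(1)[OF y])
  also have "\<dots> = mark_lin G L \<Psi> x * mark_lin G L \<Psi> y"
    unfolding lin_eval_def sum_product by (intro sum.cong refl) (simp add: sum_distrib_left mult_ac)
  finally show ?thesis .
qed

lemma burnside_mult_in_burnside:
  fixes x y :: "('a, 'c) pair_class \<Rightarrow>\<^sub>0 'k::field"
  assumes A: "comm_group A" and x: "x \<in> burnside G A" and y: "y \<in> burnside G A"
  shows "burnside_mult G A x y \<in> burnside G A"
proof -
  have "Poly_Mapping.keys (let (U, \<phi>) = class_rep c; (V, \<psi>) = class_rep d in
      \<Sum>g\<in>double_coset_reps G U V. let W = U \<inter> conj_set G g V in
        Poly_Mapping.single (pair_class G W (restrict \<phi> W \<otimes>\<^bsub>hom_group (G\<lparr>carrier := W\<rparr>) A\<^esub>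
          restrict (conj_hom G g V \<psi>) W)) (1 :: 'k)) \<subseteq> orbits G (char_pairs G A) (conj_pair G)"
    if cd: "class_rep c \<in> char_pairs G A" "class_rep d \<in> char_pairs G A" for c d :: "('a, 'c) pair_class"
  proof -
    obtain U \<phi> V \<psi> where c: "class_rep c = (U, \<phi>)" and d: "class_rep d = (V, \<psi>)" by fastforce
    have p: "(U, \<phi>) \<in> char_pairs G A" and q: "(V, \<psi>) \<in> char_pairs G A" using cd c d by simp_all
    note U = char_pairsD[OF p] and V = char_pairsD[OF q]
    show ?thesis
      unfolding c d Let_def prod.case
    proof (rule keys_sum_subset)
      fix g assume "g \<in> double_coset_reps G U V"
      then have g: "g \<in> carrier G" using double_coset_reps_subset[OF U(1) V(1)] by blast
      let ?W = "U \<inter> conj_set G g V"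
      have 1: "restrict \<phi> ?W = twist G ?W \<one> \<phi>"
        using U(2) by (auto simp: twist_def restrict_def fun_eq_iff subsetD)
      have 2: "restrict (conj_hom G g V \<psi>) ?W = twist G ?W g \<psi>"
        by (rule restrict_conj_hom) simp
      show "Poly_Mapping.keys (Poly_Mapping.single (pair_class G ?W
          (restrict \<phi> ?W \<otimes>\<^bsub>hom_group (G\<lparr>carrier := ?W\<rparr>) A\<^esub> restrict (conj_hom G g V \<psi>) ?W)) (1::'k))
          \<subseteq> orbits G (char_pairs G A) (conj_pair G)"
        unfolding 1 2 orbits_def using product_pair(1)[OF A p q g] by auto
    qed
  qed
  then show ?thesis
    using burnside_keys(1)[OF x] burnside_keys(1)[OF y]
    unfolding burnside_def burnside_mult_def bilin_ext_def
    by (intro CollectI keys_sum_subset subset_trans[OF keys_scale]) blast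
qed

end

section \<open>Conjugation of species\<close>

context group
begin

lemma species_pairsD:
  assumes "(L, \<Psi>) \<in> species_pairs G A"
  shows "subgroup L G" "L \<subseteq> carrier G"
    "\<Psi> \<in> carrier (hom_group (hom_group (G\<lparr>carrier := L\<rparr>) A) field_units)"
    "\<Psi> \<in> extensional (carrier (hom_group (G\<lparr>carrier := L\<rparr>) A))"
  using assms hom_groupD(3)[of \<Psi>]
  by (auto simp: species_pairs_def dest: subgroup.subset)

lemma conj_species_eq:
  assumes "L \<subseteq> carrier G" "g \<in> carrier G"
  shows "conj_species G A g (L, \<Psi>) = (conj_set G g L,
    \<lambda>\<phi>\<in>carrier (hom_group (G\<lparr>carrier := conj_set G g L\<rparr>) A). \<Psi> (twist G L (inv g) \<phi>))"
  by (simp add: conj_species_def Let_def conj_hom_def twist_def conj_set_inv_cancel(1)[OF assms])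

lemma twist_inv_in_hom_group:
  assumes "subgroup L G" "g \<in> carrier G" "\<phi> \<in> carrier (hom_group (G\<lparr>carrier := conj_set G g L\<rparr>) A)"
  shows "twist G L (inv g) \<phi> \<in> carrier (hom_group (G\<lparr>carrier := L\<rparr>) A)"
  using assms subgroup.subset[OF assms(1)]
  by (intro twist_in_hom_group[OF subgroup_conj_set[OF assms(1,2)] assms(1) _ _ assms(3)])
    (auto simp: conj_set_inv_cancel)

lemma conj_species_closed:
  assumes A: "comm_group A" and p: "p \<in> species_pairs G A" and g: "g \<in> carrier G"
  shows "conj_species G A g p \<in> species_pairs G A"
proof -
  obtain L \<Psi> where p_eq: "p = (L, \<Psi>)" by fastforce
  note L = species_pairsD[OF p[unfolded p_eq]]
  let ?gL = "conj_set G g L"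
  have gL: "subgroup ?gL G" by (rule subgroup_conj_set[OF L(1) g])
  have gL_sub: "?gL \<subseteq> carrier G" by (rule conj_set_subset[OF L(2) g])
  have sub: "L \<subseteq> conj_set G (inv g) ?gL" by (simp add: conj_set_inv_cancel(1)[OF L(2) g])
  interpret gL: group "G\<lparr>carrier := ?gL\<rparr>" using gL by (rule subgroup_imp_group)
  interpret D: comm_group "hom_group (G\<lparr>carrier := ?gL\<rparr>) A"
    using gL.group_axioms A by (rule comm_group_hom_group)
  have tw: "twist G L (inv g) \<phi> \<in> carrier (hom_group (G\<lparr>carrier := L\<rparr>) A)"
    if "\<phi> \<in> carrier (hom_group (G\<lparr>carrier := ?gL\<rparr>) A)" for \<phi>
    by (rule twist_inv_in_hom_group[OF L(1) g that])
  have "(\<lambda>\<phi>\<in>carrier (hom_group (G\<lparr>carrier := ?gL\<rparr>) A). \<Psi> (twist G L (inv g) \<phi>)) \<in>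
      carrier (hom_group (hom_group (G\<lparr>carrier := ?gL\<rparr>) A) field_units)"
  proof (rule characterI)
    fix \<phi> \<psi> assume \<phi>: "\<phi> \<in> carrier (hom_group (G\<lparr>carrier := ?gL\<rparr>) A)"
      and \<psi>: "\<psi> \<in> carrier (hom_group (G\<lparr>carrier := ?gL\<rparr>) A)"
    have "\<Psi> (twist G L (inv g) (\<phi> \<otimes>\<^bsub>hom_group (G\<lparr>carrier := ?gL\<rparr>) A\<^esub> \<psi>)) =
        \<Psi> (twist G L (inv g) \<phi>) * \<Psi> (twist G L (inv g) \<psi>)"
      unfolding twist_mult[OF sub gL_sub inv_closed[OF g]]
      by (rule characterD(2)[OF L(3) tw[OF \<phi>] tw[OF \<psi>]])
    then show "(\<lambda>\<phi>\<in>carrier (hom_group (G\<lparr>carrier := ?gL\<rparr>) A). \<Psi> (twist G L (inv g) \<phi>))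
        (\<phi> \<otimes>\<^bsub>hom_group (G\<lparr>carrier := ?gL\<rparr>) A\<^esub> \<psi>) =
        (\<lambda>\<phi>\<in>carrier (hom_group (G\<lparr>carrier := ?gL\<rparr>) A). \<Psi> (twist G L (inv g) \<phi>)) \<phi> *
        (\<lambda>\<phi>\<in>carrier (hom_group (G\<lparr>carrier := ?gL\<rparr>) A). \<Psi> (twist G L (inv g) \<phi>)) \<psi>"
      using \<phi> \<psi> by simp
  qed (simp_all add: characterD(1)[OF L(3) tw])
  then show ?thesis
    using gL by (simp add: p_eq conj_species_eq[OF L(2) g] species_pairs_def)
qed

lemma acts_conj_species:
  fixes A :: "('c, 'n) monoid_scheme"
  assumes A: "comm_group A"
  shows "acts G (conj_species G A) (species_pairs G A :: ('a set \<times> (('a \<Rightarrow> 'c) \<Rightarrow> 'k::field)) set)"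
  unfolding acts_def
proof (intro conjI ballI)
  fix p :: "'a set \<times> (('a \<Rightarrow> 'c) \<Rightarrow> 'k)" assume p: "p \<in> species_pairs G A"
  obtain L \<Psi> where p_eq: "p = (L, \<Psi>)" by fastforce
  note L = species_pairsD[OF p[unfolded p_eq]]
  show "conj_species G A \<one> p = p"
  proof -
    have "(\<lambda>\<phi>\<in>carrier (hom_group (G\<lparr>carrier := L\<rparr>) A). \<Psi> (twist G L \<one> \<phi>)) = \<Psi>"
      using L(2,4) hom_groupD(3)[of _ "G\<lparr>carrier := L\<rparr>" A]
      by (intro extensionalityI[of _ "carrier (hom_group (G\<lparr>carrier := L\<rparr>) A)"]) (auto simp: twist_one)
    then show ?thesis by (simp add: p_eq conj_species_eq[OF L(2)] conj_set_one[OF L(2)])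
  qed
  fix g assume g: "g \<in> carrier G"
  show "conj_species G A g p \<in> species_pairs G A" by (rule conj_species_closed[OF A p g])
  fix h assume h: "h \<in> carrier G"
  let ?hL = "conj_set G h L"
  let ?D = "carrier (hom_group (G\<lparr>carrier := conj_set G g ?hL\<rparr>) A)"
  have hL: "subgroup ?hL G" "?hL \<subseteq> carrier G"
    using subgroup_conj_set[OF L(1) h] conj_set_subset[OF L(2) h] .
  have "(\<lambda>\<phi>\<in>?D. \<Psi> (twist G L (inv (g \<otimes> h)) \<phi>)) =
      (\<lambda>\<phi>\<in>?D. (\<lambda>\<phi>\<in>carrier (hom_group (G\<lparr>carrier := ?hL\<rparr>) A). \<Psi> (twist G L (inv h) \<phi>)) (twist G ?hL (inv g) \<phi>))"
  proof (rule restrict_ext)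
    fix \<phi> assume \<phi>: "\<phi> \<in> ?D"
    have "twist G L (inv h) (twist G ?hL (inv g) \<phi>) = twist G L (inv h \<otimes> inv g) \<phi>"
      using hL(2) g h by (intro twist_twist) (simp_all add: conj_set_inv_cancel(1)[OF L(2) h])
    then show "\<Psi> (twist G L (inv (g \<otimes> h)) \<phi>) =
        (\<lambda>\<phi>\<in>carrier (hom_group (G\<lparr>carrier := ?hL\<rparr>) A). \<Psi> (twist G L (inv h) \<phi>)) (twist G ?hL (inv g) \<phi>)"
      using twist_inv_in_hom_group[OF hL(1) g \<phi>] g h by (simp add: inv_mult_group)
  qed
  then show "conj_species G A (g \<otimes> h) p = conj_species G A g (conj_species G A h p)"
    using g h by (simp add: p_eq conj_species_eq[OF L(2)] conj_species_eq[OF hL(2)] conj_set_mult[OF L(2)])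
qed

lemma mark_conj_species:
  assumes p: "(L, \<Psi>) \<in> species_pairs G A" and g: "g \<in> carrier G" and q: "(U, \<phi>) \<in> char_pairs G A"
  defines "p' \<equiv> conj_species G A g (L, \<Psi>)"
  shows "mark G (fst p') (snd p') (U, \<phi>) = mark G L \<Psi> (U, \<phi>)"
proof -
  note L = species_pairsD[OF p] and U = char_pairsD[OF q]
  let ?gL = "conj_set G g L"
  have gL: "subgroup ?gL G" by (rule subgroup_conj_set[OF L(1) g])
  have "mark_term G (fst p') (snd p') (U, \<phi>) (g \<otimes> y) = mark_term G L \<Psi> (U, \<phi>) y" if y: "y \<in> carrier G" for y
  proof -
    have gy: "g \<otimes> y \<in> carrier G" using g y by simp
    have iff: "?gL \<subseteq> conj_set G (g \<otimes> y) U \<longleftrightarrow> L \<subseteq> conj_set G y U"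
      unfolding conj_set_mult[OF U(2) g y] by (rule conj_set_subset_iff[OF L(2) conj_set_subset[OF U(2) y] g])
    have "snd p' (twist G ?gL (g \<otimes> y) \<phi>) = \<Psi> (twist G L y \<phi>)" if sub: "?gL \<subseteq> conj_set G (g \<otimes> y) U"
    proof -
      have "twist G ?gL (g \<otimes> y) \<phi> \<in> carrier (hom_group (G\<lparr>carrier := ?gL\<rparr>) A)"
        by (rule twist_in_hom_group[OF U(1) gL gy sub U(3)])
      then have "snd p' (twist G ?gL (g \<otimes> y) \<phi>) = \<Psi> (twist G L (inv g) (twist G ?gL (g \<otimes> y) \<phi>))"
        by (simp add: p'_def conj_species_eq[OF L(2) g])
      also have "twist G L (inv g) (twist G ?gL (g \<otimes> y) \<phi>) = twist G L (inv g \<otimes> (g \<otimes> y)) \<phi>"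
        using conj_set_subset[OF L(2) g] g gy
        by (intro twist_twist) (simp_all add: conj_set_inv_cancel(1)[OF L(2) g])
      finally show ?thesis using g y by (simp add: inv_cancel_left)
    qed
    then show ?thesis using iff by (simp add: mark_term_def p'_def conj_species_eq[OF L(2) g])
  qed
  then have "(\<Sum>y\<in>carrier G. mark_term G (fst p') (snd p') (U, \<phi>) (g \<otimes> y)) = (\<Sum>y\<in>carrier G. mark_term G L \<Psi> (U, \<phi>) y)"
    by (intro sum.cong refl)
  then show ?thesis unfolding mark_def sum_translate[OF g] by simp
qed

end

section \<open>Species separate elements, and primitive idempotents exist\<close>
locale fibered_burnside = group G + A: comm_group A
  for G :: "('g, 'm) monoid_scheme" (structure) and A :: "('a, 'n) monoid_scheme"
    and K :: "'k::field_char_0 itself" +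
  assumes fin: "finite (carrier G)"
    and fin_dual: "\<And>U. subgroup U G \<Longrightarrow> finite (carrier (hom_group (G\<lparr>carrier := U\<rparr>) A))"
    and split: "\<And>U. subgroup U G \<Longrightarrow> splitting_field TYPE('k) (hom_group (G\<lparr>carrier := U\<rparr>) A)"
begin

lemma comm_group_dual:
  assumes "subgroup U G"
  shows "comm_group (hom_group (G\<lparr>carrier := U\<rparr>) A)"
  using subgroup_imp_group[OF assms] A.comm_group_axioms by (rule comm_group_hom_group)

lemma finite_species_pairs: "finite (species_pairs G A :: ('g set \<times> (('g \<Rightarrow> 'a) \<Rightarrow> 'k)) set)"
proof (rule finite_subset)
  let ?S = "{U. subgroup U G}"
  show "species_pairs G A \<subseteq> Sigma ?S (\<lambda>U. carrier (hom_group (hom_group (G\<lparr>carrier := U\<rparr>) A) (field_units :: 'k monoid)))"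
    by (auto simp: species_pairs_def)
  have "?S \<subseteq> Pow (carrier G)" using subgroup.subset by blast
  then have "finite ?S" using fin by (meson finite_Pow_iff finite_subset)
  then show "finite (Sigma ?S (\<lambda>U. carrier (hom_group (hom_group (G\<lparr>carrier := U\<rparr>) A) (field_units :: 'k monoid))))"
    using fin_dual comm_group.axioms(2)[OF comm_group_dual] by (intro finite_SigmaI finite_characters) auto
qed

lemma species_lin_eval:
  fixes x :: "('g, 'a) pair_class \<Rightarrow>\<^sub>0 'k"
  assumes "p \<in> species_pairs G A" "x \<in> burnside G A"
  shows "species G p x = mark_lin G (fst p) (snd p) x"
proof -
  obtain L \<Psi> where p: "p = (L, \<Psi>)" by fastforce
  show ?thesis
    using species_eq_mark[OF fin A.comm_group_axioms species_pairsD(1)[OF assms(1)[unfolded p]] assms(2)]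
    by (simp add: p)
qed

lemma species_orbit:
  fixes x :: "('g, 'a) pair_class \<Rightarrow>\<^sub>0 'k"
  assumes p: "p \<in> species_pairs G A" and q: "q \<in> orbit G (conj_species G A) p" and x: "x \<in> burnside G A"
  shows "species G q x = species G p x"
proof -
  obtain L \<Psi> where p_eq: "p = (L, \<Psi>)" by fastforce
  obtain g where g: "g \<in> carrier G" "q = conj_species G A g p" using q by (auto simp: orbit_def)
  have qX: "q \<in> species_pairs G A" unfolding g(2) by (rule conj_species_closed[OF A.comm_group_axioms p g(1)])
  have "mark_lin G (fst q) (snd q) x = mark_lin G L \<Psi> x"
  proof (rule lin_eval_cong)
    fix c assume c: "c \<in> Poly_Mapping.keys x"
    obtain U \<phi> where U\<phi>: "class_rep c = (U, \<phi>)" by fastforce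
    show "mark G (fst q) (snd q) (class_rep c) = mark G L \<Psi> (class_rep c)"
      using mark_conj_species[OF p[unfolded p_eq] g(1)] burnside_keys(1)[OF x c] by (simp add: g(2) p_eq U\<phi>)
  qed
  then show ?thesis using species_lin_eval[OF p x] species_lin_eval[OF qX x] by (simp add: p_eq)
qed

text \<open>
  Take a class \<open>[U, \<phi>]\<close> in the support of \<open>x\<close> with \<open>|U|\<close> maximal. The species \<open>(U, \<Psi>)\<close> of \<open>x\<close>, as a function of \<open>\<Psi>\<close>, is the
  Fourier transform of a function \<open>f\<close> on \<open>Hom(U, A)\<close>, so \<open>f\<close> vanishes. By maximality, only \<open>[U, \<phi>]\<close> itself
  contributes to \<open>f \<phi>\<close>, and its contribution is a nonzero multiple of its coefficient.
\<close>
lemma species_separate: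
  fixes x :: "('g, 'a) pair_class \<Rightarrow>\<^sub>0 'k"
  assumes x: "x \<in> burnside G A" and vanish: "\<And>p. p \<in> species_pairs G A \<Longrightarrow> species G p x = 0"
  shows "x = 0"
proof (rule ccontr)
  assume "x \<noteq> 0"
  then have "Poly_Mapping.keys x \<noteq> {}" by simp
  let ?size = "\<lambda>c. card (fst (class_rep c))"
  have "Max (?size ` Poly_Mapping.keys x) \<in> ?size ` Poly_Mapping.keys x"
    using \<open>Poly_Mapping.keys x \<noteq> {}\<close> by (intro Max_in) simp_all
  then obtain c where c: "c \<in> Poly_Mapping.keys x" and "Max (?size ` Poly_Mapping.keys x) = ?size c"
    by blast
  then have max: "?size d \<le> ?size c" if "d \<in> Poly_Mapping.keys x" for d
    using that Max_ge[of "?size ` Poly_Mapping.keys x" "?size d"] by simp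
  obtain U \<phi> where U\<phi>: "class_rep c = (U, \<phi>)" by fastforce
  have p: "(U, \<phi>) \<in> char_pairs G A" using burnside_keys(1)[OF x c] U\<phi> by simp
  note U = char_pairsD[OF p]
  let ?D = "hom_group (G\<lparr>carrier := U\<rparr>) A"
  define N :: "('g, 'a) pair_class \<Rightarrow> ('g \<Rightarrow> 'a) \<Rightarrow> 'g set" where
    "N d \<chi> = {g \<in> carrier G. U \<subseteq> conj_set G g (fst (class_rep d)) \<and> twist G U g (snd (class_rep d)) = \<chi>}" for d \<chi>
  define f :: "('g \<Rightarrow> 'a) \<Rightarrow> 'k" where
    "f \<chi> = (\<Sum>d\<in>Poly_Mapping.keys x. Poly_Mapping.lookup x d * (of_nat (card (N d \<chi>)) / of_nat (?size d)))" for \<chi>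
  have "f \<phi> = 0"
  proof (rule characters_separate[OF comm_group_dual[OF U(1)] fin_dual[OF U(1)] split[OF U(1)] _ U(3)])
    fix \<Psi> assume \<Psi>: "\<Psi> \<in> carrier (hom_group ?D (field_units :: 'k monoid))"
    have "(\<Sum>\<chi>\<in>carrier ?D. of_nat (card (N d \<chi>)) / of_nat (?size d) * \<Psi> \<chi>) = mark G U \<Psi> (class_rep d)"
      if d: "d \<in> Poly_Mapping.keys x" for d
    proof -
      obtain V \<psi> where V\<psi>: "class_rep d = (V, \<psi>)" by fastforce
      have q: "(V, \<psi>) \<in> char_pairs G A" using burnside_keys(1)[OF x d] V\<psi> by simp
      note V = char_pairsD[OF q]
      have "(\<Sum>\<chi>\<in>carrier ?D. of_nat (card (N d \<chi>)) * \<Psi> \<chi>) =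
          (\<Sum>\<chi>\<in>carrier ?D. \<Sum>g\<in>carrier G. if U \<subseteq> conj_set G g V \<and> twist G U g \<psi> = \<chi> then \<Psi> \<chi> else 0)"
        by (intro sum.cong refl) (simp add: N_def V\<psi> sum.If_cases fin Int_def)
      also have "\<dots> = (\<Sum>g\<in>carrier G. \<Sum>\<chi>\<in>carrier ?D. if U \<subseteq> conj_set G g V \<and> twist G U g \<psi> = \<chi> then \<Psi> \<chi> else 0)"
        by (rule sum.swap)
      also have "\<dots> = (\<Sum>g\<in>carrier G. mark_term G U \<Psi> (V, \<psi>) g)"
      proof (intro sum.cong refl)
        fix g assume g: "g \<in> carrier G"
        show "(\<Sum>\<chi>\<in>carrier ?D. if U \<subseteq> conj_set G g V \<and> twist G U g \<psi> = \<chi> then \<Psi> \<chi> else 0) = mark_term G U \<Psi> (V, \<psi>) g"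
        proof (cases "U \<subseteq> conj_set G g V")
          case True
          then show ?thesis
            using twist_in_hom_group[OF V(1) U(1) g True V(3)] fin_dual[OF U(1)] by (simp add: mark_term_def)
        qed (simp add: mark_term_def)
      qed
      finally show ?thesis by (simp add: mark_def V\<psi> sum_divide_distrib[symmetric])
    qed
    then have "(\<Sum>d\<in>Poly_Mapping.keys x. \<Sum>\<chi>\<in>carrier ?D.
        Poly_Mapping.lookup x d * (of_nat (card (N d \<chi>)) / of_nat (?size d) * \<Psi> \<chi>)) = mark_lin G U \<Psi> x"
      unfolding sum_distrib_left[symmetric] lin_eval_def by (intro sum.cong refl) simp
    also have "\<dots> = species G (U, \<Psi>) x"
      using species_eq_mark[OF fin A.comm_group_axioms U(1) x] by simp
    also have "\<dots> = 0" using vanish[of "(U, \<Psi>)"] U(1) \<Psi> by (simp add: species_pairs_def)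
    finally show "(\<Sum>\<chi>\<in>carrier ?D. f \<chi> * \<Psi> \<chi>) = 0"
      unfolding f_def sum_distrib_right mult.assoc by (subst sum.swap) simp
  qed
  have "N d \<phi> = {}" if d: "d \<in> Poly_Mapping.keys x" "d \<noteq> c" for d
  proof (rule ccontr)
    assume "N d \<phi> \<noteq> {}"
    then obtain g where g: "g \<in> carrier G" "U \<subseteq> conj_set G g (fst (class_rep d))" "twist G U g (snd (class_rep d)) = \<phi>"
      by (auto simp: N_def)
    obtain V \<psi> where V\<psi>: "class_rep d = (V, \<psi>)" by fastforce
    have q: "(V, \<psi>) \<in> char_pairs G A" using burnside_keys(1)[OF x d(1)] V\<psi> by simp
    note V = char_pairsD[OF q]
    have "card (conj_set G g V) \<le> card U"
      using max[OF d(1)] by (simp add: V\<psi> U\<phi> card_conj_set[OF V(2) g(1)])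
    moreover have "finite (conj_set G g V)" using conj_set_subset[OF V(2) g(1)] fin finite_subset by blast
    ultimately have "U = conj_set G g V" using g(2) card_seteq[of "conj_set G g V" U] by (simp add: V\<psi>)
    then have "conj_pair G g (V, \<psi>) = (U, \<phi>)" using g(3) by (simp add: V\<psi> conj_pair_eq)
    then have "(U, \<phi>) \<in> orbit G (conj_pair G) (V, \<psi>)" using g(1) by (force simp: orbit_def)
    then have "orbit G (conj_pair G) (U, \<phi>) = orbit G (conj_pair G) (V, \<psi>)"
      by (rule orbit_eq[OF acts_conj_pair q])
    then show False using burnside_keys(2)[OF x c] burnside_keys(2)[OF x d(1)] d(2) by (simp add: U\<phi> V\<psi>)
  qed
  then have "f \<phi> = (\<Sum>d\<in>Poly_Mapping.keys x. if d = c then Poly_Mapping.lookup x c * (of_nat (card (N c \<phi>)) / of_nat (?size c)) else 0)"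
    unfolding f_def by (intro sum.cong) auto
  then have "f \<phi> = Poly_Mapping.lookup x c * (of_nat (card (N c \<phi>)) / of_nat (card U))"
    using c by (simp add: U\<phi>)
  moreover have "Poly_Mapping.lookup x c \<noteq> 0" using c by (simp add: in_keys_iff)
  moreover have "card (N c \<phi>) \<noteq> 0"
  proof -
    have "\<one> \<in> N c \<phi>" using U by (simp add: N_def U\<phi> conj_set_one twist_one)
    moreover have "finite (N c \<phi>)" using fin by (simp add: N_def)
    ultimately show ?thesis by auto
  qed
  moreover have "card U \<noteq> 0"
    using subgroup.one_closed[OF U(1)] finite_subset[OF U(2) fin] by auto
  ultimately show False using \<open>f \<phi> = 0\<close> by simp
qed

end

context fibered_burnside
begin

lemmas acts_species = acts_conj_species[OF A.comm_group_axioms]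

text \<open>
  On \<open>Hom(M, A)\<close> this is, up to the factor \<open>|Hom(M, A)|\<close>, the idempotent of the group algebra that belongs to \<open>\<Phi>\<close>. It is
  the leading term of the idempotent of \<open>(M, \<Phi>)\<close>.
\<close>
definition seed :: "'g set \<Rightarrow> (('g \<Rightarrow> 'a) \<Rightarrow> 'k) \<Rightarrow> (('g, 'a) pair_class \<Rightarrow>\<^sub>0 'k)" where
  "seed M \<Phi> = (\<Sum>\<chi>\<in>carrier (hom_group (G\<lparr>carrier := M\<rparr>) A).
     Poly_Mapping.single (pair_class G M \<chi>) (\<Phi> (inv\<^bsub>hom_group (G\<lparr>carrier := M\<rparr>) A\<^esub> \<chi>)))"

lemma seed_in_burnside:
  assumes "subgroup M G"
  shows "seed M \<Phi> \<in> burnside G A"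
  unfolding burnside_def seed_def
proof (intro CollectI keys_sum_subset)
  fix \<chi> assume \<chi>: "\<chi> \<in> carrier (hom_group (G\<lparr>carrier := M\<rparr>) A)"
  have "pair_class G M \<chi> \<in> orbits G (char_pairs G A) (conj_pair G)"
    using char_pairsI[OF assms \<chi>] unfolding orbits_def by blast
  then show "Poly_Mapping.keys (Poly_Mapping.single (pair_class G M \<chi>)
      (\<Phi> (inv\<^bsub>hom_group (G\<lparr>carrier := M\<rparr>) A\<^esub> \<chi>))) \<subseteq> orbits G (char_pairs G A) (conj_pair G)"
    by simp
qed

text \<open>
  If \<open>|M| \<le> |L|\<close>, a conjugate of \<open>M\<close> contains \<open>L\<close> only if it equals \<open>L\<close>. Orthogonality of characters
  then selects the elements \<open>g\<close> that conjugate the two species into each other.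
\<close>
lemma species_seed:
  fixes \<Phi> :: "('g \<Rightarrow> 'a) \<Rightarrow> 'k"
  assumes p: "(M, \<Phi>) \<in> species_pairs G A" and q: "q \<in> species_pairs G A"
    and card: "card M \<le> card (fst q)"
  shows "species G q (seed M \<Phi>) =
    of_nat (card (carrier (hom_group (G\<lparr>carrier := M\<rparr>) A))) *
    of_nat (card {g \<in> carrier G. conj_species G A (inv g) q = (M, \<Phi>)}) / of_nat (card M)"
proof -
  obtain L \<Psi> where q_eq: "q = (L, \<Psi>)" by fastforce
  note M = species_pairsD[OF p] and L = species_pairsD[OF q[unfolded q_eq]]
  let ?D = "hom_group (G\<lparr>carrier := M\<rparr>) A"
  interpret D: comm_group ?D using M(1) by (rule comm_group_dual)
  have inner: "(\<Sum>\<chi>\<in>carrier ?D. \<Phi> (inv\<^bsub>?D\<^esub> \<chi>) * mark_term G L \<Psi> (M, \<chi>) g) =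
      (if conj_species G A (inv g) q = (M, \<Phi>) then of_nat (card (carrier ?D)) else 0)"
    if g: "g \<in> carrier G" for g
  proof (cases "L \<subseteq> conj_set G g M")
    case True
    have "finite (conj_set G g M)" using conj_set_subset[OF M(2) g] fin finite_subset by blast
    then have L_eq: "L = conj_set G g M"
      using True card card_conj_set[OF M(2) g] card_seteq[of "conj_set G g M" L] by (simp add: q_eq)
    then have M_eq: "conj_set G (inv g) L = M" by (simp add: conj_set_inv_cancel(1)[OF M(2) g])
    let ?\<Psi> = "\<lambda>\<chi>\<in>carrier ?D. \<Psi> (twist G L g \<chi>)"
    have conj: "conj_species G A (inv g) q = (M, ?\<Psi>)"
      using g by (simp add: q_eq conj_species_eq[OF L(2)] M_eq)
    then have "?\<Psi> \<in> carrier (hom_group ?D field_units)"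
      using species_pairsD(3)[of M ?\<Psi>] conj_species_closed[OF A.comm_group_axioms q, of "inv g"] g by simp
    then have "(\<Sum>\<chi>\<in>carrier ?D. \<Phi> (inv\<^bsub>?D\<^esub> \<chi>) * ?\<Psi> \<chi>) = (if \<Phi> = ?\<Psi> then of_nat (card (carrier ?D)) else 0)"
      by (rule character_orthogonality[OF D.group_axioms M(3)])
    moreover have "(\<Sum>\<chi>\<in>carrier ?D. \<Phi> (inv\<^bsub>?D\<^esub> \<chi>) * mark_term G L \<Psi> (M, \<chi>) g) =
        (\<Sum>\<chi>\<in>carrier ?D. \<Phi> (inv\<^bsub>?D\<^esub> \<chi>) * ?\<Psi> \<chi>)"
      using True by (intro sum.cong refl) (simp add: mark_term_def)
    ultimately show ?thesis unfolding conj by auto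
  next
    case False
    have "conj_species G A (inv g) q \<noteq> (M, \<Phi>)"
    proof
      assume "conj_species G A (inv g) q = (M, \<Phi>)"
      then have "conj_set G (inv g) L = M" using g by (simp add: q_eq conj_species_eq[OF L(2)])
      then have "conj_set G g M = L" using conj_set_inv_cancel(2)[OF L(2) g] by simp
      then show False using False by simp
    qed
    then show ?thesis using False by (simp add: mark_term_def)
  qed
  have "species G q (seed M \<Phi>) = (\<Sum>\<chi>\<in>carrier ?D. \<Phi> (inv\<^bsub>?D\<^esub> \<chi>) * mark G L \<Psi> (M, \<chi>))"
    unfolding species_lin_eval[OF q seed_in_burnside[OF M(1)]]
    unfolding seed_def lin_eval_sum lin_eval_single q_eq fst_conv snd_conv
    by (intro sum.cong refl) (simp add: mark_class_rep[OF char_pairsI[OF M(1)] L(2)])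
  also have "\<dots> = (\<Sum>\<chi>\<in>carrier ?D. \<Sum>g\<in>carrier G. \<Phi> (inv\<^bsub>?D\<^esub> \<chi>) * mark_term G L \<Psi> (M, \<chi>) g) / of_nat (card M)"
    by (simp add: mark_def sum_divide_distrib sum_distrib_left)
  also have "(\<Sum>\<chi>\<in>carrier ?D. \<Sum>g\<in>carrier G. \<Phi> (inv\<^bsub>?D\<^esub> \<chi>) * mark_term G L \<Psi> (M, \<chi>) g) =
      (\<Sum>g\<in>carrier G. \<Sum>\<chi>\<in>carrier ?D. \<Phi> (inv\<^bsub>?D\<^esub> \<chi>) * mark_term G L \<Psi> (M, \<chi>) g)"
    by (rule sum.swap)
  also have "\<dots> = (\<Sum>g\<in>carrier G. if conj_species G A (inv g) q = (M, \<Phi>) then of_nat (card (carrier ?D)) else 0)"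
    by (intro sum.cong refl inner)
  also have "\<dots> = of_nat (card (carrier ?D)) * of_nat (card {g \<in> carrier G. conj_species G A (inv g) q = (M, \<Phi>)})"
    using fin by (simp add: sum.If_cases Int_def mult.commute)
  finally show ?thesis .
qed

lemma card_fst_orbit:
  assumes "p \<in> species_pairs G A" "q \<in> orbit G (conj_species G A) p"
  shows "card (fst q) = card (fst p)"
proof -
  obtain L \<Psi> where p: "p = (L, \<Psi>)" by fastforce
  note L = species_pairsD(2)[OF assms(1)[unfolded p]]
  obtain g where "g \<in> carrier G" "q = conj_species G A g p" using assms(2) by (auto simp: orbit_def)
  then show ?thesis by (simp add: p conj_species_eq[OF L] card_conj_set[OF L])
qed

lemma species_seed_eq_0_iff:
  fixes \<Phi> :: "('g \<Rightarrow> 'a) \<Rightarrow> 'k"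
  assumes p: "(M, \<Phi>) \<in> species_pairs G A" and q: "q \<in> species_pairs G A"
    and card: "card M \<le> card (fst q)"
  shows "species G q (seed M \<Phi>) = 0 \<longleftrightarrow> q \<notin> orbit G (conj_species G A) (M, \<Phi>)"
proof -
  note M = species_pairsD[OF p]
  let ?N = "{g \<in> carrier G. conj_species G A (inv g) q = (M, \<Phi>)}"
  interpret D: comm_group "hom_group (G\<lparr>carrier := M\<rparr>) A" using M(1) by (rule comm_group_dual)
  have "card (carrier (hom_group (G\<lparr>carrier := M\<rparr>) A)) \<noteq> 0"
    using D.one_closed fin_dual[OF M(1)] by auto
  moreover have "card M \<noteq> 0"
    using subgroup.one_closed[OF M(1)] finite_subset[OF M(2) fin] by auto
  moreover have "card ?N = 0 \<longleftrightarrow> (M, \<Phi>) \<notin> orbit G (conj_species G A) q"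
  proof -
    have "(M, \<Phi>) \<in> orbit G (conj_species G A) q \<longleftrightarrow> (\<exists>g\<in>carrier G. (M, \<Phi>) = conj_species G A g q)"
      by (auto simp: orbit_def)
    also have "\<dots> \<longleftrightarrow> (\<exists>g\<in>carrier G. conj_species G A (inv g) q = (M, \<Phi>))"
      by (metis inv_closed inv_inv)
    finally show ?thesis using fin by auto
  qed
  moreover have "(M, \<Phi>) \<in> orbit G (conj_species G A) q \<longleftrightarrow> q \<in> orbit G (conj_species G A) (M, \<Phi>)"
    using orbit_sym[OF acts_species p] orbit_sym[OF acts_species q] by blast
  ultimately show ?thesis unfolding species_seed[OF p q card] by simp
qed

lemma burnside_diff_scale_sum:
  fixes x :: "('g, 'a) pair_class \<Rightarrow>\<^sub>0 'k"
  assumes "x \<in> burnside G A" "\<And>i. i \<in> I \<Longrightarrow> y i \<in> burnside G A"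
  shows "scale a (x - (\<Sum>i\<in>I. scale (b i) (y i))) \<in> burnside G A"
proof -
  let ?B = "orbits G (char_pairs G A) (conj_pair G)"
  have "Poly_Mapping.keys (\<Sum>i\<in>I. scale (b i) (y i)) \<subseteq> ?B"
    using assms(2) keys_scale by (intro keys_sum_subset) (fastforce simp: burnside_def)
  then have "Poly_Mapping.keys (x - (\<Sum>i\<in>I. scale (b i) (y i))) \<subseteq> ?B"
    using assms(1) keys_diff[of x "\<Sum>i\<in>I. scale (b i) (y i)"] unfolding burnside_def by blast
  then show ?thesis using keys_scale[of a "x - (\<Sum>i\<in>I. scale (b i) (y i))"] unfolding burnside_def by blast
qed

text \<open>
  By induction on the order of the subgroup: the seed has the right values, up to a factor, at all species whose
  subgroup is at least as large, and its values at the smaller ones are removed by subtracting multiples of the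
  idempotents already constructed.
\<close>
lemma idempotent_exists:
  fixes p :: "'g set \<times> (('g \<Rightarrow> 'a) \<Rightarrow> 'k)"
  assumes "p \<in> species_pairs G A"
  shows "\<exists>e\<in>burnside G A. \<forall>q\<in>species_pairs G A.
    species G q e = (if q \<in> orbit G (conj_species G A) p then 1 else 0)"
  using assms
proof (induction "card (fst p)" arbitrary: p rule: less_induct)
  case less
  obtain M \<Phi> where p_eq: "p = (M, \<Phi>)" by fastforce
  have p: "(M, \<Phi>) \<in> species_pairs G A" using less.prems p_eq by simp
  note M = species_pairsD[OF p]
  let ?orb = "orbit G (conj_species G A) :: 'g set \<times> (('g \<Rightarrow> 'a) \<Rightarrow> 'k) \<Rightarrow> _"
  define Q where "Q = {q :: 'g set \<times> (('g \<Rightarrow> 'a) \<Rightarrow> 'k). q \<in> species_pairs G A \<and> card (fst q) < card M}"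
  have finQ: "finite Q" unfolding Q_def using finite_species_pairs by simp
  have "\<forall>q\<in>Q. \<exists>e. e \<in> burnside G A \<and> (\<forall>r\<in>species_pairs G A. species G r e = (if r \<in> ?orb q then 1 else 0))"
  proof
    fix q assume "q \<in> Q"
    then have "\<exists>e\<in>burnside G A. \<forall>r\<in>species_pairs G A. species G r e = (if r \<in> ?orb q then 1 else 0)"
      by (intro less.hyps) (simp_all add: Q_def p_eq)
    then show "\<exists>e. e \<in> burnside G A \<and> (\<forall>r\<in>species_pairs G A. species G r e = (if r \<in> ?orb q then 1 else 0))"
      by blast
  qed
  then obtain e where e: "\<And>q. q \<in> Q \<Longrightarrow> e q \<in> burnside G A"
      "\<And>q r. q \<in> Q \<Longrightarrow> r \<in> species_pairs G A \<Longrightarrow> species G r (e q) = (if r \<in> ?orb q then 1 else 0)"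
    by metis
  let ?x = "seed M \<Phi>"
  have x: "?x \<in> burnside G A" by (rule seed_in_burnside[OF M(1)])
  define a where "a = species G p ?x"
  have p_orb: "p \<in> ?orb p" by (rule orbit_refl[OF acts_species less.prems])
  have a: "a \<noteq> 0"
    using species_seed_eq_0_iff[OF p less.prems] p_orb by (simp add: a_def p_eq)
  \<comment> \<open>The sum below runs over all species and not over orbit representatives, so each orbit counts with its
      size.\<close>
  define b where "b q = species G q ?x / of_nat (card (?orb q))" for q
  define E where "E = scale (inverse a) (?x - (\<Sum>q\<in>Q. scale (b q) (e q)))"
  have E: "E \<in> burnside G A" unfolding E_def by (rule burnside_diff_scale_sum[OF x e(1)])
  have "species G r E = (if r \<in> ?orb p then 1 else 0)" if r: "r \<in> species_pairs G A" for r
  proof -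
    have "species G r E = inverse a * (species G r ?x - (\<Sum>q\<in>Q. b q * species G r (e q)))"
      unfolding species_lin_eval[OF r E] by (simp add: E_def species_lin_eval[OF r x] species_lin_eval[OF r e(1)])
    also have "(\<Sum>q\<in>Q. b q * species G r (e q)) = (\<Sum>q\<in>Q. if r \<in> ?orb q then b q else 0)"
      using e(2)[OF _ r] by (intro sum.cong refl) simp
    also have "\<dots> = (\<Sum>q\<in>{q \<in> Q. r \<in> ?orb q}. b q)"
      by (rule sum.inter_filter[OF finQ, symmetric])
    finally have val: "species G r E = inverse a * (species G r ?x - (\<Sum>q\<in>{q \<in> Q. r \<in> ?orb q}. b q))" .
    have card_orb: "card (fst s) = card (fst t)" if "s \<in> species_pairs G A" "t \<in> ?orb s"
      for s t :: "'g set \<times> (('g \<Rightarrow> 'a) \<Rightarrow> 'k)"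
      using card_fst_orbit[OF that] by simp
    show ?thesis
    proof (cases "card (fst r) < card M")
      case True
      have orb_sub: "?orb r \<subseteq> species_pairs G A" using orbit_closed[OF acts_species r] by blast
      have set_eq: "{q \<in> Q. r \<in> ?orb q} = ?orb r"
      proof (intro equalityI subsetI)
        fix q assume "q \<in> {q \<in> Q. r \<in> ?orb q}"
        then have "q \<in> species_pairs G A" "r \<in> ?orb q" by (simp_all add: Q_def)
        then show "q \<in> ?orb r" by (rule orbit_sym[OF acts_species])
      next
        fix q assume q: "q \<in> ?orb r"
        then have "q \<in> species_pairs G A" using orb_sub by blast
        then show "q \<in> {q \<in> Q. r \<in> ?orb q}"
          using card_orb[OF r q] True orbit_sym[OF acts_species r q] by (simp add: Q_def)
      qed
      have "b q = species G r ?x / of_nat (card (?orb r))" if "q \<in> ?orb r" for q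
        unfolding b_def by (simp add: species_orbit[OF r that x] orbit_eq[OF acts_species r that])
      then have "(\<Sum>q\<in>?orb r. b q) = of_nat (card (?orb r)) * (species G r ?x / of_nat (card (?orb r)))"
        by simp
      moreover have "card (?orb r) \<noteq> 0"
        using orbit_refl[OF acts_species r] finite_subset[OF orb_sub finite_species_pairs] by auto
      ultimately have "species G r E = 0" unfolding val set_eq by simp
      moreover have "r \<notin> ?orb p" using card_orb[OF less.prems, of r] True by (auto simp: p_eq)
      ultimately show ?thesis by simp
    next
      case False
      have "r \<notin> ?orb q" if "q \<in> Q" for q
        using card_orb[of q r] that False by (auto simp: Q_def)
      then have none: "{q \<in> Q. r \<in> ?orb q} = {}" by blast
      have "species G r E = inverse a * species G r ?x" unfolding val none by simp
      moreover have "species G r ?x = a" if "r \<in> ?orb p"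
        unfolding a_def by (rule species_orbit[OF less.prems that x])
      moreover have "species G r ?x = 0" if "r \<notin> ?orb p"
        using species_seed_eq_0_iff[OF p r] False that by (simp add: p_eq)
      ultimately show ?thesis using a by simp
    qed
  qed
  then show ?case using E by blast
qed

lemma burnside_eqI:
  fixes x y :: "('g, 'a) pair_class \<Rightarrow>\<^sub>0 'k"
  assumes x: "x \<in> burnside G A" and y: "y \<in> burnside G A"
    and eq: "\<And>p. p \<in> species_pairs G A \<Longrightarrow> species G p x = species G p y"
  shows "x = y"
proof -
  have "Poly_Mapping.keys (x - y) \<subseteq> orbits G (char_pairs G A) (conj_pair G)"
    using x y keys_diff[of x y] unfolding burnside_def by blast
  then have xy: "x - y \<in> burnside G A" by (simp add: burnside_def)
  have "x - y = 0"
    using species_separate[OF xy] eq by (simp add: species_lin_eval x y xy)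
  then show ?thesis by simp
qed

text \<open>
  Any element with these species values is idempotent, as its species values are \<open>0\<close> and \<open>1\<close>, species are
  multiplicative, and they separate elements.
\<close>
lemma idem_properties:
  fixes p :: "'g set \<times> (('g \<Rightarrow> 'a) \<Rightarrow> 'k)"
  assumes p: "p \<in> species_pairs G A"
  shows "idem G A p \<in> burnside G A"
    and "q \<in> species_pairs G A \<Longrightarrow>
      species G q (idem G A p) = (if q \<in> orbit G (conj_species G A) p then 1 else 0)"
proof -
  let ?P = "\<lambda>e. e \<in> burnside G A \<and> burnside_mult G A e e = e \<and>
     (\<forall>q\<in>species_pairs G A. species G q e = (if q \<in> orbit G (conj_species G A) p then 1 else 0))"
  obtain e :: "('g, 'a) pair_class \<Rightarrow>\<^sub>0 'k" where e: "e \<in> burnside G A"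
    and e_val: "\<And>q. q \<in> species_pairs G A \<Longrightarrow> species G q e = (if q \<in> orbit G (conj_species G A) p then 1 else 0)"
    using idempotent_exists[OF p] by blast
  have ee: "burnside_mult G A e e \<in> burnside G A"
    by (rule burnside_mult_in_burnside[OF A.comm_group_axioms e e])
  have "burnside_mult G A e e = e"
  proof (rule burnside_eqI[OF ee e])
    fix q :: "'g set \<times> (('g \<Rightarrow> 'a) \<Rightarrow> 'k)" assume q: "q \<in> species_pairs G A"
    obtain L \<Psi> where q_eq: "q = (L, \<Psi>)" by fastforce
    note L = species_pairsD[OF q[unfolded q_eq]]
    have "species G q (burnside_mult G A e e) = species G q e * species G q e"
      unfolding species_lin_eval[OF q e] species_lin_eval[OF q ee]
      using mark_burnside_mult[OF fin A.comm_group_axioms L(1,3) e e] by (simp add: q_eq)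
    then show "species G q (burnside_mult G A e e) = species G q e"
      using e_val[OF q] by simp
  qed
  then have "?P e" using e e_val by blast
  moreover have "f = e" if "?P f" for f
    using that e e_val by (intro burnside_eqI) auto
  ultimately have "?P (idem G A p)"
    unfolding idem_def by (rule theI)
  then show "idem G A p \<in> burnside G A"
    and "q \<in> species_pairs G A \<Longrightarrow>
      species G q (idem G A p) = (if q \<in> orbit G (conj_species G A) p then 1 else 0)"
    by blast+
qed

end

text \<open>
  The hypotheses speak of subquotients, whose elements are cosets. A subgroup is the quotient by its trivial subgroup, whose cosets are singletons,
  so homomorphisms on the subgroup and on the quotient correspond.
\<close>
lemma hom_group_Mod_trivial:
  assumes "group S"
  defines "i \<equiv> \<lambda>f. \<lambda>u\<in>carrier S. f {u}"
  shows "i \<in> hom (hom_group (S Mod {\<one>\<^bsub>S\<^esub>}) A) (hom_group S A)"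
    and "i ` carrier (hom_group (S Mod {\<one>\<^bsub>S\<^esub>}) A) = carrier (hom_group S A)"
proof -
  interpret S: group S by fact
  let ?Q = "S Mod {\<one>\<^bsub>S\<^esub>}"
  have Q: "carrier ?Q = (\<lambda>x. {x}) ` carrier S"
    by (auto simp: FactGroup_def RCOSETS_def r_coset_def)
  have Q_mult: "{x} \<otimes>\<^bsub>?Q\<^esub> {y} = {x \<otimes>\<^bsub>S\<^esub> y}" for x y
    by (simp add: set_mult_def)
  have closed: "i f \<in> carrier (hom_group S A)" if f: "f \<in> carrier (hom_group ?Q A)" for f
  proof (rule hom_groupI)
    fix x assume x: "x \<in> carrier S"
    then show "i f x \<in> carrier A" using hom_groupD(1)[OF f, of "{x}"] by (simp add: i_def Q)
    fix y assume y: "y \<in> carrier S"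
    have "f ({x} \<otimes>\<^bsub>?Q\<^esub> {y}) = f {x} \<otimes>\<^bsub>A\<^esub> f {y}" by (rule hom_groupD(2)[OF f]) (simp_all add: Q x y)
    then show "i f (x \<otimes>\<^bsub>S\<^esub> y) = i f x \<otimes>\<^bsub>A\<^esub> i f y" unfolding Q_mult using x y by (simp add: i_def)
  qed (simp add: i_def)
  show "i \<in> hom (hom_group ?Q A) (hom_group S A)"
  proof (rule homI)
    fix f g assume "f \<in> carrier (hom_group ?Q A)" "g \<in> carrier (hom_group ?Q A)"
    show "i (f \<otimes>\<^bsub>hom_group ?Q A\<^esub> g) = i f \<otimes>\<^bsub>hom_group S A\<^esub> i g"
      by (auto simp: i_def hom_group_def Q fun_eq_iff)
  qed (rule closed)
  show "i ` carrier (hom_group ?Q A) = carrier (hom_group S A)"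
  proof
    show "i ` carrier (hom_group ?Q A) \<subseteq> carrier (hom_group S A)" using closed by blast
    show "carrier (hom_group S A) \<subseteq> i ` carrier (hom_group ?Q A)"
    proof
      fix \<phi> assume \<phi>: "\<phi> \<in> carrier (hom_group S A)"
      let ?f = "\<lambda>Y\<in>carrier ?Q. \<phi> (the_elem Y)"
      have "?f \<in> carrier (hom_group ?Q A)"
      proof (rule hom_groupI)
        fix Y assume "Y \<in> carrier ?Q"
        then obtain x where x: "Y = {x}" "x \<in> carrier S" unfolding Q by blast
        then show "?f Y \<in> carrier A" using hom_groupD(1)[OF \<phi>] by (simp add: Q)
        fix Z assume "Z \<in> carrier ?Q"
        then obtain y where y: "Z = {y}" "y \<in> carrier S" unfolding Q by blast
        show "?f (Y \<otimes>\<^bsub>?Q\<^esub> Z) = ?f Y \<otimes>\<^bsub>A\<^esub> ?f Z"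
          unfolding x(1) y(1) Q_mult using x(2) y(2) hom_groupD(2)[OF \<phi>] by (simp add: Q)
      qed simp
      moreover have "\<phi> = i ?f"
        using hom_groupD(3)[OF \<phi>] by (intro extensionalityI[of _ "carrier S"]) (auto simp: i_def Q)
      ultimately show "\<phi> \<in> i ` carrier (hom_group ?Q A)" by (intro image_eqI[of \<phi> i ?f])
    qed
  qed
qed

section \<open>Restriction of the primitive idempotents\<close>
lemma (in group) species_pairs_restrict_iff:
  assumes "subgroup H G"
  shows "(L, \<Psi>) \<in> species_pairs (G\<lparr>carrier := H\<rparr>) A \<longleftrightarrow> (L, \<Psi>) \<in> species_pairs G A \<and> L \<subseteq> H"
  by (auto simp: species_pairs_def subgroup_restrict_iff[OF assms])

lemma (in group) conj_species_restrict:
  assumes "subgroup H G" "h \<in> H"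
  shows "conj_species (G\<lparr>carrier := H\<rparr>) A h p = conj_species G A h p"
proof -
  have "inv\<^bsub>G\<lparr>carrier := H\<rparr>\<^esub> h = inv h" by (rule m_inv_consistent[OF assms])
  moreover have "inv h \<in> H" using assms by (rule subgroup.m_inv_closed)
  moreover have "inv\<^bsub>G\<lparr>carrier := H\<rparr>\<^esub> (inv h) = inv (inv h)" by (rule m_inv_consistent[OF assms(1) \<open>inv h \<in> H\<close>])
  ultimately show ?thesis
    using conj_set_restrict[OF assms(1)] assms(2)
    by (cases p) (simp add: conj_species_def conj_hom_def Let_def)
qed

theorem proposition4p1:
  fixes G :: "('g, 'm) monoid_scheme" and A :: "('a, 'n) monoid_scheme" and H :: "'g set"
  assumes "group G" and "finite (carrier G)" and "comm_group A"
    and "\<And>U N. subgroup U G \<Longrightarrow> N \<lhd> G\<lparr>carrier := U\<rparr> \<Longrightarrow>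
           finite (carrier (hom_group (G\<lparr>carrier := U\<rparr> Mod N) A))"
    and "\<And>U N. subgroup U G \<Longrightarrow> N \<lhd> G\<lparr>carrier := U\<rparr> \<Longrightarrow>
           splitting_field TYPE('k::field_char_0) (hom_group (G\<lparr>carrier := U\<rparr> Mod N) A)"
    and "subgroup H G"
  shows
    "(\<forall>(L, \<Psi> :: ('g \<Rightarrow> 'a) \<Rightarrow> 'k) \<in> species_pairs (G\<lparr>carrier := H\<rparr>) A.
        \<forall>x\<in>burnside G A. (species (G\<lparr>carrier := H\<rparr>) (L, \<Psi>) \<circ> res G H) x = species G (L, \<Psi>) x)
   \<and> (\<forall>(K, \<Phi> :: ('g \<Rightarrow> 'a) \<Rightarrow> 'k) \<in> species_pairs G A.
        \<forall>R. transversal (G\<lparr>carrier := H\<rparr>) (conj_species (G\<lparr>carrier := H\<rparr>) A)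
              (species_pairs (G\<lparr>carrier := H\<rparr>) A) R \<longrightarrow>
          res G H (idem G A (K, \<Phi>)) =
            (\<Sum>(L, \<Psi>) \<in> {(L, \<Psi>) \<in> R. (L, \<Psi>) \<in> orbit G (conj_species G A) (K, \<Phi>)}.
               idem (G\<lparr>carrier := H\<rparr>) A (L, \<Psi>)))
   \<and> (\<forall>\<Phi> :: ('g \<Rightarrow> 'a) \<Rightarrow> 'k.
        \<Phi> \<in> carrier (hom_group (hom_group G A) field_units) \<and> H \<noteq> carrier G \<longrightarrow>
        res G H (idem G A (carrier G, \<Phi>)) = 0)"
proof -
  interpret G: group G by fact
  interpret A: comm_group A by fact
  have H_sub: "H \<subseteq> carrier G" using assms(6) by (rule subgroup.subset)
  have trivial: "{\<one>\<^bsub>G\<^esub>} \<lhd> G\<lparr>carrier := U\<rparr>" and grp: "group (G\<lparr>carrier := U\<rparr>)" if U: "subgroup U G" for U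
  proof -
    show "group (G\<lparr>carrier := U\<rparr>)" using U by (rule G.subgroup_imp_group)
    then show "{\<one>\<^bsub>G\<^esub>} \<lhd> G\<lparr>carrier := U\<rparr>" using group.one_is_normal by fastforce
  qed
  have fin_dual: "finite (carrier (hom_group (G\<lparr>carrier := U\<rparr>) A))" if U: "subgroup U G" for U
  proof -
    have "finite (carrier (hom_group (G\<lparr>carrier := U\<rparr> Mod {\<one>\<^bsub>G\<lparr>carrier := U\<rparr>\<^esub>}) A))"
      using assms(4)[OF U trivial[OF U]] by simp
    then show ?thesis
      unfolding hom_group_Mod_trivial(2)[OF grp[OF U], of A, symmetric] by (rule finite_imageI)
  qed
  have split: "splitting_field TYPE('k) (hom_group (G\<lparr>carrier := U\<rparr>) A)" if U: "subgroup U G" for U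
    using splitting_field_surj_hom[OF hom_group_Mod_trivial[OF grp[OF U], of A]] assms(5)[OF U trivial[OF U]] by simp
  interpret G: fibered_burnside G A "TYPE('k)"
    by unfold_locales (use assms(2) fin_dual split in auto)
  interpret GH: group "G\<lparr>carrier := H\<rparr>" by (rule grp[OF assms(6)])
  interpret H: fibered_burnside "G\<lparr>carrier := H\<rparr>" A "TYPE('k)"
  proof unfold_locales
    show "finite (carrier (G\<lparr>carrier := H\<rparr>))" using assms(2) H_sub finite_subset by auto
    fix U assume "subgroup U (G\<lparr>carrier := H\<rparr>)"
    then have "subgroup U G" using G.subgroup_restrict_iff[OF assms(6)] by blast
    then show "finite (carrier (hom_group (G\<lparr>carrier := H, carrier := U\<rparr>) A))"
      "splitting_field TYPE('k) (hom_group (G\<lparr>carrier := H, carrier := U\<rparr>) A)"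
      using fin_dual split by simp_all
  qed
  have species_res: "species (G\<lparr>carrier := H\<rparr>) q (res G H x) = species G q x"
    if q: "q \<in> species_pairs (G\<lparr>carrier := H\<rparr>) A" and x: "x \<in> burnside G A"
    for q :: "'g set \<times> (('g \<Rightarrow> 'a) \<Rightarrow> 'k)" and x
  proof -
    obtain L \<Psi> where q_eq: "q = (L, \<Psi>)" by fastforce
    have qG: "q \<in> species_pairs G A" and L: "L \<subseteq> H"
      using q G.species_pairs_restrict_iff[OF assms(6)] unfolding q_eq by blast+
    show ?thesis
      unfolding H.species_lin_eval[OF q G.res_in_burnside[OF assms(6) x]] G.species_lin_eval[OF qG x]
      using G.mark_res[OF assms(2,3,6) L x, of \<Psi>] by (simp add: q_eq)
  qed
  have restrict_G: "q \<in> species_pairs G A" if "q \<in> species_pairs (G\<lparr>carrier := H\<rparr>) A"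
    for q :: "'g set \<times> (('g \<Rightarrow> 'a) \<Rightarrow> 'k)"
    using that G.species_pairs_restrict_iff[OF assms(6)] by (cases q) blast
  have res_idem: "species (G\<lparr>carrier := H\<rparr>) q (res G H (idem G A p)) = (if q \<in> orbit G (conj_species G A) p then 1 else 0)"
    if q: "q \<in> species_pairs (G\<lparr>carrier := H\<rparr>) A" and p: "p \<in> species_pairs G A"
    for q p :: "'g set \<times> (('g \<Rightarrow> 'a) \<Rightarrow> 'k)"
    using species_res[OF q G.idem_properties(1)[OF p]] G.idem_properties(2)[OF p restrict_G[OF q]] by simp
  have b: "res G H (idem G A p) = (\<Sum>r\<in>{r \<in> R. r \<in> orbit G (conj_species G A) p}. idem (G\<lparr>carrier := H\<rparr>) A r)"
    if p: "p \<in> species_pairs G A"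
      and R: "transversal (G\<lparr>carrier := H\<rparr>) (conj_species (G\<lparr>carrier := H\<rparr>) A) (species_pairs (G\<lparr>carrier := H\<rparr>) A) R"
    for p :: "'g set \<times> (('g \<Rightarrow> 'a) \<Rightarrow> 'k)" and R
  proof -
    let ?GH = "G\<lparr>carrier := H\<rparr>"
    let ?R = "{r \<in> R. r \<in> orbit G (conj_species G A) p}"
    have R_sub: "R \<subseteq> species_pairs ?GH A" using R by (simp add: transversal_def)
    have finR: "finite R" using R_sub H.finite_species_pairs finite_subset by blast
    have sum_in: "(\<Sum>r\<in>?R. idem ?GH A r) \<in> burnside ?GH A"
    proof -
      have "Poly_Mapping.keys (idem ?GH A r) \<subseteq> orbits ?GH (char_pairs ?GH A) (conj_pair ?GH)"
        if "r \<in> ?R" for r :: "'g set \<times> (('g \<Rightarrow> 'a) \<Rightarrow> 'k)"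
        using H.idem_properties(1)[of r] that R_sub by (auto simp: burnside_def)
      then show ?thesis unfolding burnside_def by (intro CollectI keys_sum_subset)
    qed
    show ?thesis
    proof (rule H.burnside_eqI[OF G.res_in_burnside[OF assms(6) G.idem_properties(1)[OF p]] sum_in])
      fix q :: "'g set \<times> (('g \<Rightarrow> 'a) \<Rightarrow> 'k)" assume q: "q \<in> species_pairs ?GH A"
      obtain r0 where r0: "r0 \<in> R" "r0 \<in> orbit ?GH (conj_species ?GH A) q"
        and uniq: "\<And>r. r \<in> R \<Longrightarrow> r \<in> orbit ?GH (conj_species ?GH A) q \<Longrightarrow> r = r0"
        using R q unfolding transversal_def by metis
      have r0X: "r0 \<in> species_pairs ?GH A" using r0(1) R_sub by blast
      have iff: "q \<in> orbit ?GH (conj_species ?GH A) r \<longleftrightarrow> r = r0" if "r \<in> R" for r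
        using that uniq[OF that] r0(2) GH.orbit_sym[OF H.acts_species q] GH.orbit_sym[OF H.acts_species, of r q] R_sub by blast
      obtain h where h: "h \<in> H" "r0 = conj_species ?GH A h q" using r0(2) by (auto simp: orbit_def)
      then have "r0 = conj_species G A h q" using G.conj_species_restrict[OF assms(6) h(1)] by simp
      then have r0_orb: "r0 \<in> orbit G (conj_species G A) q" using h(1) H_sub unfolding orbit_def by blast
      have G_iff: "r0 \<in> orbit G (conj_species G A) p \<longleftrightarrow> q \<in> orbit G (conj_species G A) p"
      proof
        assume "q \<in> orbit G (conj_species G A) p"
        then show "r0 \<in> orbit G (conj_species G A) p" using r0_orb by (rule G.orbit_trans[OF G.acts_species p])
      next
        assume "r0 \<in> orbit G (conj_species G A) p"
        moreover have "q \<in> orbit G (conj_species G A) r0"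
          using r0_orb by (rule G.orbit_sym[OF G.acts_species restrict_G[OF q]])
        ultimately show "q \<in> orbit G (conj_species G A) p" by (rule G.orbit_trans[OF G.acts_species p])
      qed
      have "species ?GH q (\<Sum>r\<in>?R. idem ?GH A r) = (\<Sum>r\<in>?R. species ?GH q (idem ?GH A r))"
        using H.idem_properties(1) R_sub
        by (auto simp: H.species_lin_eval[OF q sum_in] H.species_lin_eval[OF q] intro!: sum.cong)
      also have "\<dots> = (\<Sum>r\<in>?R. if r = r0 then 1 else 0)"
      proof (intro sum.cong refl)
        fix r assume "r \<in> ?R"
        then have r: "r \<in> R" by simp
        have rX: "r \<in> species_pairs ?GH A" using r R_sub by blast
        show "species ?GH q (idem ?GH A r) = (if r = r0 then 1 else 0)"
          using H.idem_properties(2)[OF rX q] iff[OF r] by simp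
      qed
      also have "\<dots> = (if q \<in> orbit G (conj_species G A) p then 1 else 0)"
        using finR r0(1) G_iff by simp
      finally show "species ?GH q (res G H (idem G A p)) = species ?GH q (\<Sum>r\<in>?R. idem ?GH A r)"
        using res_idem[OF q p] by simp
    qed
  qed
  have c: "res G H (idem G A (carrier G, \<Phi>)) = 0"
    if \<Phi>: "\<Phi> \<in> carrier (hom_group (hom_group G A) field_units)" and ne: "H \<noteq> carrier G"
    for \<Phi> :: "('g \<Rightarrow> 'a) \<Rightarrow> 'k"
  proof -
    have p: "(carrier G, \<Phi>) \<in> species_pairs G A"
      using \<Phi> G.subgroup_self by (simp add: species_pairs_def)
    show ?thesis
    proof (rule H.species_separate[OF G.res_in_burnside[OF assms(6) G.idem_properties(1)[OF p]]])
      fix q :: "'g set \<times> (('g \<Rightarrow> 'a) \<Rightarrow> 'k)" assume q: "q \<in> species_pairs (G\<lparr>carrier := H\<rparr>) A"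
      have "q \<notin> orbit G (conj_species G A) (carrier G, \<Phi>)"
      proof
        assume "q \<in> orbit G (conj_species G A) (carrier G, \<Phi>)"
        then have "card (fst q) = card (carrier G)" using G.card_fst_orbit[OF p] by simp
        moreover have "fst q \<subseteq> H" using q G.species_pairs_restrict_iff[OF assms(6)] by (cases q) auto
        moreover have "card H < card (carrier G)" using H_sub ne assms(2) by (intro psubset_card_mono) auto
        moreover have "finite H" using H_sub assms(2) finite_subset by blast
        ultimately show False using card_mono[of H "fst q"] by simp
      qed
      then show "species (G\<lparr>carrier := H\<rparr>) q (res G H (idem G A (carrier G, \<Phi>))) = 0"
        using res_idem[OF q p] by simp
    qed
  qed
  have set_eq: "{(L, \<Psi>) \<in> R. (L, \<Psi>) \<in> orbit G (conj_species G A) p} = {r \<in> R. r \<in> orbit G (conj_species G A) p}"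
    for R and p :: "'g set \<times> (('g \<Rightarrow> 'a) \<Rightarrow> 'k)"
    by auto
  have sum_eq: "(\<Sum>(L, \<Psi>)\<in>R. idem (G\<lparr>carrier := H\<rparr>) A (L, \<Psi>)) = (\<Sum>r\<in>R. idem (G\<lparr>carrier := H\<rparr>) A r)"
    for R :: "('g set \<times> (('g \<Rightarrow> 'a) \<Rightarrow> 'k)) set"
    by (intro sum.cong) auto
  show ?thesis
    unfolding set_eq sum_eq
  proof (intro conjI allI impI)
    show "\<forall>(L, \<Psi> :: ('g \<Rightarrow> 'a) \<Rightarrow> 'k) \<in> species_pairs (G\<lparr>carrier := H\<rparr>) A.
        \<forall>x\<in>burnside G A. (species (G\<lparr>carrier := H\<rparr>) (L, \<Psi>) \<circ> res G H) x = species G (L, \<Psi>) x"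
      by (clarify, simp only: comp_apply species_res)
    show "\<forall>(K, \<Phi> :: ('g \<Rightarrow> 'a) \<Rightarrow> 'k) \<in> species_pairs G A.
        \<forall>R. transversal (G\<lparr>carrier := H\<rparr>) (conj_species (G\<lparr>carrier := H\<rparr>) A)
              (species_pairs (G\<lparr>carrier := H\<rparr>) A) R \<longrightarrow>
          res G H (idem G A (K, \<Phi>)) =
            (\<Sum>r\<in>{r \<in> R. r \<in> orbit G (conj_species G A) (K, \<Phi>)}. idem (G\<lparr>carrier := H\<rparr>) A r)"
      by (clarify, rule b)
  qed (blast intro: c)
qed

end
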